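(* Let $\mathbf R$ be a commutative ring with unity $1$ and zero $0$; let $x=(x_1,\ldots,x_n)$, $y=(y_1,\ldots,y_n)$, $f(x)=(f_1(x),\ldots,f_s(x))\in\mathbf R[x]^s$, $F(x)=(F_1(x),\ldots,F_t(x))\in\mathbf R[x]^t$; let $\partial:\widehat f_x,\widehat f'_x\mapsto f(x)$, $\widehat F_x,\widehat F'_x\mapsto F(x)$, $\widehat f_y,\widehat f'_y\mapsto f(y)$, $\widehat F_y,\widehat F'_y\mapsto F(y)$, $\widehat u\mapsto(x-y)=(x_1-y_1,\ldots,x_n-y_n)$. Then 1) $$\mathop{\top}\limits_{\widehat f_y}\mathop{\top}\limits_{\widehat F_y}\det\left\|\begin{matrix}\nabla F(x,y)&\nabla f(x,y)\\ \widehat F_x-\widehat F_y&\widehat f_x-\widehat f_y\end{matrix}\right\|\,y^0\det\|\widehat f^y_*\|\exp(\widehat F'_y\widehat F^y_* )=\mathop{\top}\limits_{\widehat F'_x}x^0(\widehat f_x)^0\exp(\widehat F_x\widehat F'^x_* )\det\left\|\begin{matrix}\nabla F(x,y)\\ \widehat F'_x-\widehat F'_y\end{matrix}\right\|,$$ 2) $$\mathop{\top}\limits_{\widehat f_y}\det\left\|\begin{matrix}\nabla f(x,y)\\ \widehat f_x-\widehat f_y\end{matrix}\right\|\,y^0(\widehat F'_y)^0\exp(\widehat f'_y\widehat f^y_* )=\mathop{\top}\limits_{\widehat f'_x}\mathop{\top}\limits_{\widehat F'_x}(-1)^{tn}x^0\det\|\widehat F'^x_*\|\exp(\widehat f_x\widehat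 f'^x_* )\det\left\|\begin{matrix}\nabla F(x,y)&\nabla f(x,y)\\ \widehat F'_x-\widehat F'_y&\widehat f'_x-\widehat f'_y\end{matrix}\right\|.$$ Hence: 1') for every $c(y_*,\widehat F^y_* )\in\mathbf C(y_*,\widehat F^y_* )$, $$\mathop{\top}\limits_{y}\mathop{\top}\limits_{\widehat f_y}\mathop{\top}\limits_{\widehat F_y}\det\left\|\begin{matrix}\nabla F(x,y)&\nabla f(x,y)\\ \widehat F_x-\widehat F_y&\widehat f_x-\widehat f_y\end{matrix}\right\|\left(\det\|\widehat f^y_*\|\,c(y_*,\widehat F^y_* )\right)=(\widehat f_x)^0\left(\mathop{\top}\limits_{y}\mathop{\top}\limits_{\widehat F_y}\det\left\|\begin{matrix}\nabla F(x,y)\\ \widehat F_x-\widehat F_y\end{matrix}\right\|c(y_*,\widehat F^y_* )\right);$$ 2') for every $c(y_*,\widehat f^y_*,\widehat F^y_* )\in\mathbf C(y_*,\widehat f^y_*,\widehat F^y_* )$, $$\mathop{\top}\limits_{y}\mathop{\top}\limits_{\widehat f_y}\det\left\|\begin{matrix}\nabla f(x,y)\\ \widehat f_x-\widehat f_y\end{matrix}\right\|\left(\mathop{\top}\limits_{\widehat F_y}(\widehat F_y)^0c(y_*,\widehat f^y_*,\widehat F^y_* )\right)=\mathop{\top}\limits_{\widehat F_x}(-1)^{tn}\det\|\widehat F^x_*\|\left(\mathop{\top}\limits_{y}\mathop{\top}\limits_{\widehat f_y}\mathop{\top}\limits_{\widehat F_y}\det\left\|\begin{matrix}\nabla F(x,y)&\nabla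 f(x,y)\\ \widehat F_x-\widehat F_y&\widehat f_x-\widehat f_y\end{matrix}\right\|c(y_*,\widehat f^y_*,\widehat F^y_* )\right).$$
   Context: Variables. $\widehat f_x,\widehat f'_x,\widehat f_y,\widehat f'_y$ are collections of $s$, $\widehat F_x,\widehat F'_x,\widehat F_y,\widehat F'_y$ collections of $t$, and $\widehat u$ a collection of $n$ Grassmann (anticommuting, square-zero) variables; variables from different collections also anticommute. $\Lambda_A(\widehat v)$ is the Grassmann algebra in $\widehat v$ over a commutative ring $A$; $|w|\in\mathbb Z/2$ is the parity of a homogeneous element or linear map. Zeroth powers $x^0,y^0,(\widehat f_x)^0,(\widehat F_y)^0,\ldots$ denote $1$. Complexes. $\mathbf C(y,\widehat f_y,\widehat F_y)=\Lambda_{\mathbf R[y]}(\widehat f_y,\widehat F_y)$ with differential the odd $\mathbf R[y]$-linear derivation $\partial(ab)=\partial(a)b+(-1)^{|a|}a\,\partial(b)$ with $\partial(\widehat f_{i,y})=f_i(y)$, $\partial(\widehat F_{j,y})=F_j(y)$; similarly for $\mathbf C(y,\widehat f_y)$, $\mathbf C(y,\widehat F_y)$ and for other sets of variables. $\mathbf C(y_*,\widehat F^y_* )=\mathrm{Hom}_{\mathbf R}(\mathbf C(y,\widehat F_y),\mathbf R)$ and $\mathbf C(y_*,\widehat f^y_*,\widehat F^y_* )=\mathrm{Hom}_{\mathbf R}(\mathbf C(y,\widehat f_y,\widehat F_y),\mathbf R)$. Difference quotients. For $H(x)\in\mathbf R[x]$, $\widehat u\nabla H(x,y)=\sum_{k=1}^n\widehat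 u_k\nabla^kH(x,y)$ is a fixed choice of element with $\nabla^kH(x,y)\in\mathbf R[x,y]$ and $\sum_{k=1}^n(x_k-y_k)\nabla^kH(x,y)=H(x)-H(y)$ (the same choice is used in all occurrences). Functionals and contraction. A homogeneous linear map $\varphi$ on functions of variables $v$ is extended linearly over the polynomial variables other than $v$ and, for additional Grassmann parameters $\theta$, by $\varphi(\theta w)=(-1)^{|\varphi||\theta|}\theta\varphi(w)$. Contraction is $\mathop{\top}\limits_v\varphi\,w=\varphi(w)$ and, with the function written first, $\mathop{\top}\limits_v w\,\varphi=(-1)^{|w||\varphi|}\varphi(w)$; everything is extended additively to inhomogeneous elements. The product of functionals is composition (right factor applied first). $\det\|\widehat v_*\|$ for $\widehat v=(\widehat v_1,\ldots,\widehat v_m)$ is the linear functional of parity $m\bmod 2$ on $\Lambda_A(\widehat v)$ equal to $1$ on $\widehat v_1\widehat v_2\cdots\widehat v_m$ and $0$ on the other monomials. $\exp(\widehat F'_y\widehat F^y_* )$ is the (even) algebra homomorphism substituting $\widehat F_{j,y}\mapsto\widehat F'_{j,y}$; similarly $\exp(\widehat F_x\widehat F'^x_* )$ substitutes $\widehat F'_{j,x}\mapsto\widehat F_{j,x}$, $\exp(\widehat f'_y\widehat f^y_* )$ substitutes $\widehat f_{i,y}\mapsto\widehat f'_{i,y}$, and $\exp(\widehat f_x\widehat f'^x_* )$ substitutes $\widehat f'_{i,x}\mapsto\widehat f_{i,x}$. Explicitly, $\det\|\widehat f^y_*\|\,c$ in 1') is the functional $w\mapsto(-1)^{s|c|}c\left(\det\|\widehat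 f^y_*\|.w\right)$ on $\mathbf C(y,\widehat f_y,\widehat F_y)$, and $\mathop{\top}\limits_{\widehat F_y}(\widehat F_y)^0c$ in 2') is the restriction of $c$ to $\mathbf C(y,\widehat f_y)\subset\mathbf C(y,\widehat f_y,\widehat F_y)$. Determinants with a Grassmann row. For polynomials $H_1,\ldots,H_m$ and odd elements $\widehat w_1,\ldots,\widehat w_m$ not involving $\widehat u$, $$\det\left\|\begin{matrix}\nabla H(x,y)\\ \widehat w\end{matrix}\right\|$$ is the element $Q$ not involving $\widehat u$ such that $\widehat u_1\widehat u_2\cdots\widehat u_n\,Q$ is the component of top degree $n$ in $\widehat u$ of the ordered product $\prod_{j=1}^m\left(\sum_{k=1}^n\widehat u_k\nabla^kH_j(x,y)+\widehat w_j\right)$; it has parity $m-n$ (and is $0$ if $m<n$). Thus $\det\left\|\begin{matrix}\nabla F(x,y)\\ \widehat F_x-\widehat F_y\end{matrix}\right\|$ uses $H=(F_1,\ldots,F_t)$, $\widehat w_j=\widehat F_{j,x}-\widehat F_{j,y}$; the one with $f$ is analogous; and the determinant with two block columns uses $H=(F_1,\ldots,F_t,f_1,\ldots,f_s)$ and $\widehat w=(\widehat F_x-\widehat F_y,\widehat f_x-\widehat f_y)$ in this order (with primes where indicated). *)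

theory Defs
  imports "HOL-Library.Poly_Mapping" "HOL-Library.FuncSet"
begin

section \<open>Grassmann algebras\<close>

text \<open>
  An element of the Grassmann algebra over a commutative ring \<open>'a\<close> in anticommuting
  variables of the linearly ordered type \<open>'v\<close> is given by its coefficients with respect to the
  basis \<open>e S\<close>, where \<open>e S\<close> is the product of the elements of the finite set \<open>S\<close> in increasing order.
  \<open>shuffle_sign S T\<close> is the sign with \<open>e S * e T = shuffle_sign S T * e (S \<union> T)\<close>
  for disjoint \<open>S\<close>, \<open>T\<close>.
\<close>

typedef (overloaded) ('v, 'a::zero) grassmann =
  "{g :: 'v set \<Rightarrow> 'a. finite {S. g S \<noteq> 0} \<and> (\<forall>S. g S \<noteq> 0 \<longrightarrow> finite S)}"
  morphisms gcoeff Abs_grassmann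
  by (rule exI[of _ "\<lambda>_. 0"]) simp

setup_lifting type_definition_grassmann

definition gsupp :: "('v, 'a::zero) grassmann \<Rightarrow> 'v set set" where
  "gsupp w = {S. gcoeff w S \<noteq> 0}"

lemma finite_gsupp [simp]: "finite (gsupp w)"
  using gcoeff[of w] by (simp add: gsupp_def)

lemma gcoeff_infinite [simp]: "infinite S \<Longrightarrow> gcoeff w S = 0"
  using gcoeff[of w] by auto

lemma finite_in_gsupp: "S \<in> gsupp w \<Longrightarrow> finite S"
  using gcoeff[of w] by (auto simp: gsupp_def)

lemma grassmann_eqI: "(\<And>S. finite S \<Longrightarrow> gcoeff v S = gcoeff w S) \<Longrightarrow> v = w"
  by (metis gcoeff_inject gcoeff_infinite ext)

definition shuffle_sign :: "'v::linorder set \<Rightarrow> 'v set \<Rightarrow> 'a::comm_ring_1" where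
  "shuffle_sign S T = (- 1) ^ card {(a, b). a \<in> S \<and> b \<in> T \<and> b < a}"

lemma shuffle_sign_empty [simp]: "shuffle_sign {} T = 1" "shuffle_sign S {} = 1"
  by (simp_all add: shuffle_sign_def)

lemma finite_inv: "finite S \<Longrightarrow> finite T \<Longrightarrow> finite {(a, b). a \<in> S \<and> b \<in> T \<and> b < (a::'v::linorder)}"
  by (rule finite_subset[of _ "S \<times> T"]) auto

lemma shuffle_sign_Un_left:
  assumes "finite S" "finite T" "finite U" "S \<inter> T = {}"
  shows "shuffle_sign (S \<union> T) U = shuffle_sign S U * shuffle_sign T U"
proof -
  have "{(a, b). a \<in> S \<union> T \<and> b \<in> U \<and> b < a} =
      {(a, b). a \<in> S \<and> b \<in> U \<and> b < a} \<union> {(a, b). a \<in> T \<and> b \<in> U \<and> b < a}" by auto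
  moreover have "{(a, b). a \<in> S \<and> b \<in> U \<and> b < a} \<inter> {(a, b). a \<in> T \<and> b \<in> U \<and> b < a} = {}"
    using assms(4) by auto
  ultimately show ?thesis
    unfolding shuffle_sign_def
    using card_Un_disjoint[OF finite_inv[OF assms(1,3)] finite_inv[OF assms(2,3)]]
    by (simp add: power_add)
qed

lemma shuffle_sign_Un_right:
  assumes "finite S" "finite T" "finite U" "T \<inter> U = {}"
  shows "shuffle_sign S (T \<union> U) = shuffle_sign S T * shuffle_sign S U"
proof -
  have "{(a, b). a \<in> S \<and> b \<in> T \<union> U \<and> b < a} =
      {(a, b). a \<in> S \<and> b \<in> T \<and> b < a} \<union> {(a, b). a \<in> S \<and> b \<in> U \<and> b < a}" by auto
  moreover have "{(a, b). a \<in> S \<and> b \<in> T \<and> b < a} \<inter> {(a, b). a \<in> S \<and> b \<in> U \<and> b < a} = {}"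
    using assms(4) by auto
  ultimately show ?thesis
    unfolding shuffle_sign_def
    using card_Un_disjoint[OF finite_inv[OF assms(1,2)] finite_inv[OF assms(1,3)]]
    by (simp add: power_add)
qed

lemma shuffle_sign_square [simp]: "shuffle_sign S T * shuffle_sign S T = 1"
  by (simp add: shuffle_sign_def flip: power_mult_distrib)

lemma shuffle_sign_square' [simp]: "shuffle_sign S T * (shuffle_sign S T * x) = x"
  by (simp flip: mult.assoc)

instantiation grassmann :: (type, ab_group_add) ab_group_add
begin

lift_definition zero_grassmann :: "('a, 'b) grassmann" is "\<lambda>_. 0" by simp

lift_definition plus_grassmann :: "('a, 'b) grassmann \<Rightarrow> ('a, 'b) grassmann \<Rightarrow> ('a, 'b) grassmann"
  is "\<lambda>f g S. f S + g S"
proof -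
  fix f g :: "'a set \<Rightarrow> 'b"
  assume "finite {S. f S \<noteq> 0} \<and> (\<forall>S. f S \<noteq> 0 \<longrightarrow> finite S)"
     and "finite {S. g S \<noteq> 0} \<and> (\<forall>S. g S \<noteq> 0 \<longrightarrow> finite S)"
  moreover have "{S. f S + g S \<noteq> 0} \<subseteq> {S. f S \<noteq> 0} \<union> {S. g S \<noteq> 0}" by auto
  ultimately show "finite {S. f S + g S \<noteq> 0} \<and> (\<forall>S. f S + g S \<noteq> 0 \<longrightarrow> finite S)"
    by (metis (no_types, lifting) add_0 finite_UnI finite_subset)
qed

lift_definition uminus_grassmann :: "('a, 'b) grassmann \<Rightarrow> ('a, 'b) grassmann" is "\<lambda>f S. - f S"
  by simp

lift_definition minus_grassmann :: "('a, 'b) grassmann \<Rightarrow> ('a, 'b) grassmann \<Rightarrow> ('a, 'b) grassmann"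
  is "\<lambda>f g S. f S - g S"
proof -
  fix f g :: "'a set \<Rightarrow> 'b"
  assume "finite {S. f S \<noteq> 0} \<and> (\<forall>S. f S \<noteq> 0 \<longrightarrow> finite S)"
     and "finite {S. g S \<noteq> 0} \<and> (\<forall>S. g S \<noteq> 0 \<longrightarrow> finite S)"
  moreover have "{S. f S - g S \<noteq> 0} \<subseteq> {S. f S \<noteq> 0} \<union> {S. g S \<noteq> 0}" by auto
  ultimately show "finite {S. f S - g S \<noteq> 0} \<and> (\<forall>S. f S - g S \<noteq> 0 \<longrightarrow> finite S)"
    by (metis (no_types, lifting) diff_self finite_UnI finite_subset)
qed

instance
  by standard (transfer; auto simp: fun_eq_iff algebra_simps)+

end

lemma gcoeff_0 [simp]: "gcoeff 0 S = 0" by transfer simp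
lemma gcoeff_add [simp]: "gcoeff (v + w) S = gcoeff v S + gcoeff w S" by transfer simp
lemma gcoeff_diff [simp]: "gcoeff (v - w) S = gcoeff v S - gcoeff w S" by transfer simp
lemma gcoeff_uminus [simp]: "gcoeff (- v) S = - gcoeff v S" by transfer simp

lemma gcoeff_sum: "gcoeff (\<Sum>i\<in>I. h i) S = (\<Sum>i\<in>I. gcoeff (h i) S)"
  by (induction I rule: infinite_finite_induct) auto

instantiation grassmann :: (linorder, comm_ring_1) ring_1
begin

lift_definition one_grassmann :: "('a, 'b) grassmann" is "\<lambda>S. if S = {} then 1 else 0"
  by (auto intro: finite_subset[of _ "{{}}"])

lift_definition times_grassmann :: "('a, 'b) grassmann \<Rightarrow> ('a, 'b) grassmann \<Rightarrow> ('a, 'b) grassmann"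
  is "\<lambda>f g S. \<Sum>T\<in>Pow S. shuffle_sign T (S - T) * f T * g (S - T)"
proof -
  fix f g :: "'a set \<Rightarrow> 'b"
  assume f: "finite {S. f S \<noteq> 0} \<and> (\<forall>S. f S \<noteq> 0 \<longrightarrow> finite S)"
     and g: "finite {S. g S \<noteq> 0} \<and> (\<forall>S. g S \<noteq> 0 \<longrightarrow> finite S)"
  let ?h = "\<lambda>S. \<Sum>T\<in>Pow S. shuffle_sign T (S - T) * f T * g (S - T)"
  have "{S. ?h S \<noteq> 0} \<subseteq> (\<lambda>(T, U). T \<union> U) ` ({S. f S \<noteq> 0} \<times> {S. g S \<noteq> 0})"
  proof
    fix S assume "S \<in> {S. ?h S \<noteq> 0}"
    then obtain T where "T \<in> Pow S" "shuffle_sign T (S - T) * f T * g (S - T) \<noteq> 0"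
      unfolding mem_Collect_eq by (rule sum.not_neutral_contains_not_neutral)
    then have T: "f T \<noteq> 0" "g (S - T) \<noteq> 0" "S = T \<union> (S - T)" by auto
    show "S \<in> (\<lambda>(T, U). T \<union> U) ` ({S. f S \<noteq> 0} \<times> {S. g S \<noteq> 0})"
      by (rule image_eqI[of _ _ "(T, S - T)"]) (use T in simp_all)
  qed
  then have "finite {S. ?h S \<noteq> 0}"
    using f g by (meson finite_SigmaI finite_imageI finite_subset)
  moreover have "finite S" if "?h S \<noteq> 0" for S
    using that by (metis (no_types, lifting) finite_Pow_iff sum.infinite)
  ultimately show "finite {S. ?h S \<noteq> 0} \<and> (\<forall>S. ?h S \<noteq> 0 \<longrightarrow> finite S)" by blast
qed

lemma gcoeff_times: "gcoeff (v * w) S = (\<Sum>T\<in>Pow S. shuffle_sign T (S - T) * gcoeff v T * gcoeff w (S - T))"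
  by transfer simp

lemma gcoeff_one: "gcoeff 1 S = (if S = {} then 1 else 0)"
  by transfer simp

instance
proof
  fix a b c :: "('a, 'b) grassmann"
  show "(0::('a, 'b) grassmann) \<noteq> 1"
    by (metis gcoeff_0 gcoeff_one zero_neq_one)
  show "(a + b) * c = a * c + b * c" "a * (b + c) = a * b + a * c"
    by (rule grassmann_eqI; simp add: gcoeff_times algebra_simps sum.distrib)+
  show "1 * a = a"
  proof (rule grassmann_eqI)
    fix S :: "'a set" assume "finite S"
    have "gcoeff (1 * a) S = (\<Sum>T\<in>{{}}. shuffle_sign T (S - T) * gcoeff 1 T * gcoeff a (S - T))"
      unfolding gcoeff_times using \<open>finite S\<close>
      by (intro sum.mono_neutral_right) (auto simp: gcoeff_one)
    then show "gcoeff (1 * a) S = gcoeff a S" by (simp add: gcoeff_one)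
  qed
  show "a * 1 = a"
  proof (rule grassmann_eqI)
    fix S :: "'a set" assume "finite S"
    have "gcoeff (a * 1) S = (\<Sum>T\<in>{S}. shuffle_sign T (S - T) * gcoeff a T * gcoeff 1 (S - T))"
      unfolding gcoeff_times using \<open>finite S\<close>
      by (intro sum.mono_neutral_right) (auto simp: gcoeff_one)
    then show "gcoeff (a * 1) S = gcoeff a S" by (simp add: gcoeff_one)
  qed
  show "a * b * c = a * (b * c)"
  proof (rule grassmann_eqI)
    fix S :: "'a set" assume S: "finite S"
    let ?t = "\<lambda>T U. shuffle_sign T (S - T) * gcoeff a T * (shuffle_sign U (S - T - U) * gcoeff b U * gcoeff c (S - T - U))"
    have "gcoeff (a * b * c) S = (\<Sum>W\<in>Pow S. \<Sum>T\<in>Pow W.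
        shuffle_sign W (S - W) * (shuffle_sign T (W - T) * gcoeff a T * gcoeff b (W - T)) * gcoeff c (S - W))"
      by (simp add: gcoeff_times sum_distrib_left sum_distrib_right)
    also have "\<dots> = (\<Sum>(W, T)\<in>Sigma (Pow S) Pow.
        shuffle_sign W (S - W) * (shuffle_sign T (W - T) * gcoeff a T * gcoeff b (W - T)) * gcoeff c (S - W))"
      using S by (subst sum.Sigma) (auto intro: finite_subset)
    also have "\<dots> = (\<Sum>(T, U)\<in>Sigma (Pow S) (\<lambda>T. Pow (S - T)). ?t T U)"
    proof (rule sum.reindex_bij_witness[where i = "\<lambda>(T, U). (T \<union> U, T)" and j = "\<lambda>(W, T). (T, W - T)"])
      show "(case p of (W, T) \<Rightarrow> (T, W - T)) \<in> Sigma (Pow S) (\<lambda>T. Pow (S - T))"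
        and "(case (case p of (W, T) \<Rightarrow> (T, W - T)) of (T, U) \<Rightarrow> (T \<union> U, T)) = p"
        if "p \<in> Sigma (Pow S) Pow" for p using that by auto
      show "(case q of (T, U) \<Rightarrow> (T \<union> U, T)) \<in> Sigma (Pow S) Pow"
        and "(case (case q of (T, U) \<Rightarrow> (T \<union> U, T)) of (W, T) \<Rightarrow> (T, W - T)) = q"
        if "q \<in> Sigma (Pow S) (\<lambda>T. Pow (S - T))" for q using that by auto
      fix p assume "p \<in> Sigma (Pow S) Pow"
      then obtain W T where p: "p = (W, T)" and WT: "W \<subseteq> S" "T \<subseteq> W" by auto
      then have fin: "finite T" "finite (W - T)" "finite (S - W)" using S by (auto intro: finite_subset)
      have eq: "S - T = (W - T) \<union> (S - W)" "T \<union> (W - T) = W" "S - T - (W - T) = S - W"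
        and disj: "(W - T) \<inter> (S - W) = {}" "T \<inter> (W - T) = {}" using WT by auto
      have "shuffle_sign T (S - T) = (shuffle_sign T (W - T) * shuffle_sign T (S - W) :: 'b)"
        unfolding eq(1) by (rule shuffle_sign_Un_right[OF fin disj(1)])
      moreover have "shuffle_sign W (S - W) = (shuffle_sign T (S - W) * shuffle_sign (W - T) (S - W) :: 'b)"
        using shuffle_sign_Un_left[OF fin disj(2), where ?'b = 'b] unfolding eq(2) .
      ultimately show "(case (case p of (W, T) \<Rightarrow> (T, W - T)) of (T, U) \<Rightarrow> ?t T U) =
        (case p of (W, T) \<Rightarrow> shuffle_sign W (S - W) *
          (shuffle_sign T (W - T) * gcoeff a T * gcoeff b (W - T)) * gcoeff c (S - W))"
        by (simp add: p eq(3) ac_simps)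
    qed
    also have "\<dots> = (\<Sum>T\<in>Pow S. \<Sum>U\<in>Pow (S - T). ?t T U)"
      using S by (subst sum.Sigma) (auto intro: finite_subset)
    also have "\<dots> = gcoeff (a * (b * c)) S"
      by (simp add: gcoeff_times sum_distrib_left)
    finally show "gcoeff (a * b * c) S = gcoeff (a * (b * c)) S" .
  qed
qed

end

lift_definition scal :: "'a \<Rightarrow> ('v, 'a::zero) grassmann" is "\<lambda>r S. if S = {} then r else 0"
  by (auto intro: finite_subset[of _ "{{}}"])

lift_definition gbasis :: "'v set \<Rightarrow> ('v, 'a::comm_ring_1) grassmann"
  is "\<lambda>S T. if T = S \<and> finite S then 1 else 0"
  by (auto intro: finite_subset[of _ "{S}" for S])

abbreviation gen :: "'v \<Rightarrow> ('v, 'a::comm_ring_1) grassmann" where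
  "gen v \<equiv> gbasis {v}"

lift_definition gfilter :: "('v set \<Rightarrow> bool) \<Rightarrow> ('v, 'a::zero) grassmann \<Rightarrow> ('v, 'a) grassmann"
  is "\<lambda>P g S. if P S then g S else 0"
  by (auto intro: rev_finite_subset)

text \<open>
  \<open>hcomp p w\<close> is the component of parity \<open>p\<close> of \<open>w\<close>, and \<open>parity_part p \<phi>\<close> the component of parity \<open>p\<close>
  of a linear map \<open>\<phi>\<close>; parities are natural numbers, read modulo 2.
\<close>

definition hcomp :: "nat \<Rightarrow> ('v, 'a::zero) grassmann \<Rightarrow> ('v, 'a) grassmann" where
  "hcomp p = gfilter (\<lambda>S. card S mod 2 = p mod 2)"

definition parity_part ::
    "nat \<Rightarrow> (('v, 'a::ab_group_add) grassmann \<Rightarrow> ('w, 'b::ab_group_add) grassmann)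
       \<Rightarrow> ('v, 'a) grassmann \<Rightarrow> ('w, 'b) grassmann" where
  "parity_part p \<phi> w = (\<Sum>q\<in>{0, 1}. hcomp (p + q) (\<phi> (hcomp q w)))"

text \<open>The algebra endomorphism that sends each variable \<open>v\<close> to the variable \<open>\<sigma> v\<close>.\<close>

definition gsubst ::
    "('v \<Rightarrow> 'v) \<Rightarrow> ('v::linorder, 'a::comm_ring_1) grassmann \<Rightarrow> ('v, 'a) grassmann" where
  "gsubst \<sigma> w = (\<Sum>S\<in>gsupp w. scal (gcoeff w S) * prod_list (map (gen \<circ> \<sigma>) (sorted_list_of_set S)))"

definition odd_derivation ::
    "(('v::linorder, 'a::comm_ring_1) grassmann \<Rightarrow> ('v, 'a) grassmann) \<Rightarrow> bool" where
  "odd_derivation D \<longleftrightarrow>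
     (\<forall>a b. D (a + b) = D a + D b) \<and>
     (\<forall>r a. D (scal r * a) = scal r * D a) \<and>
     (\<forall>p a. hcomp p a = a \<longrightarrow> hcomp (p + 1) (D a) = D a) \<and>
     (\<forall>p a b. hcomp p a = a \<longrightarrow> D (a * b) = D a * b + (- 1) ^ p * a * D b)"

lemma gcoeff_scal: "gcoeff (scal r) S = (if S = {} then r else 0)" by transfer simp
lemma gcoeff_gbasis: "gcoeff (gbasis S) T = (if T = S \<and> finite S then 1 else 0)" by transfer simp
lemma gcoeff_gfilter: "gcoeff (gfilter P w) S = (if P S then gcoeff w S else 0)" by transfer simp
lemma gcoeff_hcomp: "gcoeff (hcomp p w) S = (if card S mod 2 = p mod 2 then gcoeff w S else 0)"
  by (simp add: hcomp_def gcoeff_gfilter)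

lemma gcoeff_scal_times [simp]:
  "gcoeff (scal r * w) S = (r::'a::comm_ring_1) * gcoeff (w :: ('v::linorder, 'a) grassmann) S"
proof (cases "finite S")
  case True
  have "gcoeff (scal r * w) S = (\<Sum>T\<in>{{}}. shuffle_sign T (S - T) * gcoeff (scal r) T * gcoeff w (S - T))"
    unfolding gcoeff_times using True by (intro sum.mono_neutral_right) (auto simp: gcoeff_scal)
  then show ?thesis by (simp add: gcoeff_scal)
qed simp

lemma gcoeff_times_scal [simp]:
  "gcoeff (w * scal r) S = (r::'a::comm_ring_1) * gcoeff (w :: ('v::linorder, 'a) grassmann) S"
proof (cases "finite S")
  case True
  have "gcoeff (w * scal r) S = (\<Sum>T\<in>{S}. shuffle_sign T (S - T) * gcoeff w T * gcoeff (scal r) (S - T))"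
    unfolding gcoeff_times using True by (intro sum.mono_neutral_right) (auto simp: gcoeff_scal)
  then show ?thesis by (simp add: gcoeff_scal ac_simps)
qed simp

lemma scal_commute: "w * scal r = scal r * (w :: ('v::linorder, 'a::comm_ring_1) grassmann)"
  by (rule grassmann_eqI) simp

lemma scal_add: "scal (r + s) = (scal r + scal s :: ('v, 'a::ab_group_add) grassmann)"
  by (rule grassmann_eqI) (simp add: gcoeff_scal)

lemma scal_mult: "scal (r * s) = (scal r * scal s :: ('v::linorder, 'a::comm_ring_1) grassmann)"
  by (rule grassmann_eqI) (simp add: gcoeff_scal)

lemma scal_0 [simp]: "scal 0 = (0 :: ('v, 'a::ab_group_add) grassmann)"
  by (rule grassmann_eqI) (simp add: gcoeff_scal)

lemma scal_1 [simp]: "scal 1 = (1 :: ('v::linorder, 'a::comm_ring_1) grassmann)"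
  by (rule grassmann_eqI) (simp add: gcoeff_scal gcoeff_one)

lemma scal_uminus: "scal (- r) = - (scal r :: ('v, 'a::ab_group_add) grassmann)"
  by (rule grassmann_eqI) (simp add: gcoeff_scal)

lemma scal_power: "scal (r ^ k) = (scal r ^ k :: ('v::linorder, 'a::comm_ring_1) grassmann)"
  by (induction k) (simp_all add: scal_mult)

lemma gbasis_empty [simp]: "gbasis {} = (1 :: ('v::linorder, 'a::comm_ring_1) grassmann)"
  by (rule grassmann_eqI) (simp add: gcoeff_gbasis gcoeff_one)

lemma gcoeff_gbasis_times:
  assumes U: "finite U"
  shows "gcoeff (gbasis U * w) S =
    (if U \<subseteq> S then shuffle_sign U (S - U) * gcoeff (w :: ('v::linorder, 'a::comm_ring_1) grassmann) (S - U) else 0)"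
proof (cases "finite S")
  case True
  have "gcoeff (gbasis U * w) S = (\<Sum>T\<in>Pow S \<inter> {U}. shuffle_sign T (S - T) * gcoeff (gbasis U) T * gcoeff w (S - T))"
    unfolding gcoeff_times using True by (intro sum.mono_neutral_right) (auto simp: gcoeff_gbasis)
  also have "Pow S \<inter> {U} = (if U \<subseteq> S then {U} else {})" by auto
  finally show ?thesis using U by (auto simp: gcoeff_gbasis)
qed (use U in simp)

lemma gbasis_mult:
  assumes "finite S" "finite T"
  shows "gbasis S * gbasis T =
    (if S \<inter> T = {} then scal (shuffle_sign S T) * gbasis (S \<union> T) else 0 :: ('v::linorder, 'a::comm_ring_1) grassmann)"
proof (rule grassmann_eqI)
  fix V :: "'v set"
  have "S \<subseteq> V \<and> V - S = T \<longleftrightarrow> S \<inter> T = {} \<and> V = S \<union> T" by auto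
  then show "gcoeff (gbasis S * gbasis T) V =
      gcoeff (if S \<inter> T = {} then scal (shuffle_sign S T) * gbasis (S \<union> T) else 0) V"
    using assms by (auto simp: gcoeff_gbasis_times gcoeff_gbasis)
qed

lemma grassmann_expand:
  "w = (\<Sum>S\<in>gsupp w. scal (gcoeff w S) * gbasis S :: ('v::linorder, 'a::comm_ring_1) grassmann)"
proof (rule grassmann_eqI)
  fix T :: "'v set" assume T: "finite T"
  have "(\<Sum>S\<in>gsupp w. gcoeff w S * gcoeff (gbasis S) T) = (\<Sum>S\<in>gsupp w. if S = T then gcoeff w T else 0)"
    using T by (intro sum.cong) (auto simp: gcoeff_gbasis)
  also have "\<dots> = gcoeff w T" by (auto simp: gsupp_def sum.delta[OF finite_gsupp, unfolded gsupp_def])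
  finally show "gcoeff w T = gcoeff (\<Sum>S\<in>gsupp w. scal (gcoeff w S) * gbasis S) T"
    by (simp add: gcoeff_sum)
qed

lemma prod_list_gen:
  "sorted_wrt (<) vs \<Longrightarrow> prod_list (map gen vs) = (gbasis (set vs) :: ('v::linorder, 'a::comm_ring_1) grassmann)"
proof (induction vs)
  case (Cons v vs)
  then have "{(a, b). a \<in> {v} \<and> b \<in> set vs \<and> b < a} = {}" by auto
  then have "shuffle_sign {v} (set vs) = (1::'a)"
    unfolding shuffle_sign_def by (metis card.empty power_0)
  moreover have "v \<notin> set vs" using Cons.prems by auto
  ultimately show ?case using Cons by (simp add: gbasis_mult)
qed simp

lemma gen_anticommute: "gen v * gen w = - (gen w * gen v :: ('v::linorder, 'a::comm_ring_1) grassmann)"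
proof -
  have "shuffle_sign {v} {w} = (if w < v then - 1 else 1 :: 'a)" for v w :: 'v
  proof -
    have "{(a, b). a \<in> {v} \<and> b \<in> {w} \<and> b < a} = (if w < v then {(v, w)} else {})" by auto
    then show ?thesis unfolding shuffle_sign_def by auto
  qed
  then show ?thesis
    by (cases v w rule: linorder_cases) (auto simp: gbasis_mult insert_commute scal_uminus)
qed

lemma scal_left_commute:
  "a * (scal r * b) = scal r * (a * b :: ('v::linorder, 'a::comm_ring_1) grassmann)"
  by (metis mult.assoc scal_commute)

lemma scal_scal: "scal r * (scal s * b) = scal (r * s) * (b :: ('v::linorder, 'a::comm_ring_1) grassmann)"
  by (simp add: scal_mult mult.assoc)

lemma hcomp_gsupp: "hcomp p a = a \<Longrightarrow> S \<in> gsupp a \<Longrightarrow> card S mod 2 = p mod 2"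
  by (metis (mono_tags) gcoeff_hcomp gsupp_def mem_Collect_eq)

lemma hcomp_eqI: "(\<And>S. S \<in> gsupp a \<Longrightarrow> card S mod 2 = p mod 2) \<Longrightarrow> hcomp p a = a"
  by (rule grassmann_eqI) (auto simp: gcoeff_hcomp gsupp_def)

lemma prepend_gen_sign:
  assumes "finite T" "v \<notin> T" "w \<in> T"
  shows "shuffle_sign {v} T * shuffle_sign {w} (insert v (T - {w})) =
    - (shuffle_sign {w} (T - {w}) * shuffle_sign {v} (T - {w}) :: 'a::comm_ring_1)"
proof -
  have 1: "shuffle_sign {v} ((T - {w}) \<union> {w}) = (shuffle_sign {v} (T - {w}) * shuffle_sign {v} {w} :: 'a)"
    using assms by (intro shuffle_sign_Un_right) auto
  have 2: "shuffle_sign {w} ((T - {w}) \<union> {v}) = (shuffle_sign {w} (T - {w}) * shuffle_sign {w} {v} :: 'a)"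
    using assms by (intro shuffle_sign_Un_right) auto
  have eq: "(T - {w}) \<union> {w} = T" "(T - {w}) \<union> {v} = insert v (T - {w})" using assms by auto
  have "shuffle_sign {v} {w} * shuffle_sign {w} {v} = (- 1 :: 'a)"
  proof -
    have "shuffle_sign {v} {w} = (if w < v then - 1 else 1 :: 'a)" for v w :: 'b
    proof -
      have "{(a, b). a \<in> {v} \<and> b \<in> {w} \<and> b < a} = (if w < v then {(v, w)} else {})" by auto
      then show ?thesis unfolding shuffle_sign_def by auto
    qed
    then show ?thesis using assms by (cases v w rule: linorder_cases) auto
  qed
  moreover have "shuffle_sign {v} T * shuffle_sign {w} (insert v (T - {w})) =
      (shuffle_sign {w} (T - {w}) * shuffle_sign {v} (T - {w})) * (shuffle_sign {v} {w} * shuffle_sign {w} {v} :: 'a)"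
    using 1 2 unfolding eq by (simp only: ac_simps)
  ultimately show ?thesis by simp
qed

definition diff_basis :: "('v::linorder \<Rightarrow> 'a::comm_ring_1) \<Rightarrow> 'v set \<Rightarrow> ('v, 'a) grassmann" where
  "diff_basis \<delta> S = (\<Sum>v\<in>S. scal (shuffle_sign {v} (S - {v}) * \<delta> v) * gbasis (S - {v}))"

definition diff_ext :: "('v::linorder \<Rightarrow> 'a::comm_ring_1) \<Rightarrow> ('v, 'a) grassmann \<Rightarrow> ('v, 'a) grassmann" where
  "diff_ext \<delta> w = (\<Sum>S\<in>gsupp w. scal (gcoeff w S) * diff_basis \<delta> S)"

lemma diff_ext_superset:
  "finite A \<Longrightarrow> gsupp w \<subseteq> A \<Longrightarrow> diff_ext \<delta> w = (\<Sum>S\<in>A. scal (gcoeff w S) * diff_basis \<delta> S)"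
  unfolding diff_ext_def by (rule sum.mono_neutral_left) (auto simp: gsupp_def)

lemma diff_ext_add: "diff_ext \<delta> (a + b) = diff_ext \<delta> a + diff_ext \<delta> b"
proof -
  let ?A = "gsupp a \<union> gsupp b"
  have "gsupp (a + b) \<subseteq> ?A" by (auto simp: gsupp_def)
  then show ?thesis
    by (simp add: diff_ext_superset[of ?A] scal_add distrib_right sum.distrib)
qed

lemma diff_ext_scal: "diff_ext \<delta> (scal r * a) = scal r * diff_ext \<delta> a"
proof -
  have "gsupp (scal r * a) \<subseteq> gsupp a" by (auto simp: gsupp_def)
  then show ?thesis
    by (simp add: diff_ext_superset[of "gsupp a"] scal_mult sum_distrib_left mult.assoc)
qed

lemma diff_ext_0: "diff_ext \<delta> 0 = 0"
  using diff_ext_scal[of \<delta> 0 0] by simp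

lemma diff_ext_sum: "diff_ext \<delta> (\<Sum>i\<in>I. h i) = (\<Sum>i\<in>I. diff_ext \<delta> (h i))"
  by (induction I rule: infinite_finite_induct) (auto simp: diff_ext_add diff_ext_0)

lemma diff_ext_gbasis: "finite S \<Longrightarrow> diff_ext \<delta> (gbasis S) = diff_basis \<delta> S"
  by (subst diff_ext_superset[of "{S}"]) (auto simp: gsupp_def gcoeff_gbasis split: if_splits)

lemma diff_ext_gen_gbasis:
  assumes T: "finite T"
  shows "diff_ext \<delta> (gen v * gbasis T) = scal (\<delta> v) * gbasis T - gen v * diff_ext \<delta> (gbasis T)"
proof (cases "v \<in> T")
  case True
  have "gen v * (scal (shuffle_sign {w} (T - {w}) * \<delta> w) * gbasis (T - {w})) =
      (if w = v then scal (\<delta> v) * gbasis T else 0)" if "w \<in> T" for w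
  proof -
    have "gen v * (scal (shuffle_sign {w} (T - {w}) * \<delta> w) * gbasis (T - {w})) =
        scal (shuffle_sign {w} (T - {w}) * \<delta> w) * (gen v * gbasis (T - {w}))"
      by (rule scal_left_commute)
    also have "\<dots> = (if w = v then scal (\<delta> v) * gbasis T else 0)"
      using T True by (auto simp: gbasis_mult insert_absorb scal_scal mult.commute mult.left_commute)
    finally show ?thesis .
  qed
  then have "gen v * diff_basis \<delta> T = (\<Sum>w\<in>T. if w = v then scal (\<delta> v) * gbasis T else 0)"
    unfolding diff_basis_def sum_distrib_left by (rule sum.cong[OF refl])
  also have "\<dots> = scal (\<delta> v) * gbasis T" using T True by simp
  finally show ?thesis using T True by (simp add: diff_ext_gbasis gbasis_mult diff_ext_0)
next
  case False
  have L: "diff_ext \<delta> (gen v * gbasis T) = scal (shuffle_sign {v} T) * diff_basis \<delta> (insert v T)"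
    using T False by (simp add: gbasis_mult diff_ext_scal diff_ext_gbasis)
  have "diff_basis \<delta> (insert v T) = scal (shuffle_sign {v} T * \<delta> v) * gbasis T +
      (\<Sum>w\<in>T. scal (shuffle_sign {w} (insert v T - {w}) * \<delta> w) * gbasis (insert v T - {w}))"
    using T False by (simp add: diff_basis_def)
  then have "diff_ext \<delta> (gen v * gbasis T) = scal (\<delta> v) * gbasis T +
      (\<Sum>w\<in>T. scal (shuffle_sign {v} T) * (scal (shuffle_sign {w} (insert v T - {w}) * \<delta> w) * gbasis (insert v T - {w})))"
    unfolding L by (simp add: distrib_left sum_distrib_left scal_scal)
  also have "(\<Sum>w\<in>T. scal (shuffle_sign {v} T) * (scal (shuffle_sign {w} (insert v T - {w}) * \<delta> w) * gbasis (insert v T - {w})))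
    = (\<Sum>w\<in>T. - (gen v * (scal (shuffle_sign {w} (T - {w}) * \<delta> w) * gbasis (T - {w}))))"
  proof (rule sum.cong[OF refl])
    fix w assume w: "w \<in> T"
    have i: "insert v T - {w} = insert v (T - {w})" using w False by auto
    have "gen v * (scal (shuffle_sign {w} (T - {w}) * \<delta> w) * gbasis (T - {w})) =
        scal (shuffle_sign {w} (T - {w}) * \<delta> w) * (gen v * gbasis (T - {w}))"
      by (rule scal_left_commute)
    also have "\<dots> = scal (shuffle_sign {w} (T - {w}) * shuffle_sign {v} (T - {w}) * \<delta> w) * gbasis (insert v (T - {w}))"
      using T False by (simp add: gbasis_mult scal_scal mult.commute mult.left_commute)
    finally show "scal (shuffle_sign {v} T) * (scal (shuffle_sign {w} (insert v T - {w}) * \<delta> w) * gbasis (insert v T - {w})) =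
        - (gen v * (scal (shuffle_sign {w} (T - {w}) * \<delta> w) * gbasis (T - {w})))"
      unfolding i scal_scal using arg_cong[OF prepend_gen_sign[OF T False w], of "\<lambda>r. r * \<delta> w"]
      by (simp add: mult.assoc scal_uminus)
  qed
  also have "\<dots> = - (gen v * diff_basis \<delta> T)"
    by (simp add: diff_basis_def sum_distrib_left sum_negf)
  finally show ?thesis using T by (simp add: diff_ext_gbasis)
qed

lemma diff_ext_gen: "diff_ext \<delta> (gen v * w) = scal (\<delta> v) * w - gen v * diff_ext \<delta> w"
proof -
  have 1: "diff_ext \<delta> (gen v * (scal (gcoeff w T) * gbasis T)) =
      scal (\<delta> v) * (scal (gcoeff w T) * gbasis T) - gen v * diff_ext \<delta> (scal (gcoeff w T) * gbasis T)"
    if "T \<in> gsupp w" for T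
    unfolding scal_left_commute[of "gbasis {v}"] diff_ext_scal diff_ext_gen_gbasis[OF finite_in_gsupp[OF that]]
      right_diff_distrib scal_left_commute[of "scal (\<delta> v)"] ..
  let ?w = "\<Sum>T\<in>gsupp w. scal (gcoeff w T) * gbasis T"
  have "diff_ext \<delta> (gen v * ?w) = scal (\<delta> v) * ?w - gen v * diff_ext \<delta> ?w"
    unfolding sum_distrib_left diff_ext_sum sum_subtractf[symmetric] by (rule sum.cong[OF refl 1])
  then show ?thesis unfolding grassmann_expand[symmetric] .
qed

lemma diff_ext_gbasis_times:
  assumes "finite S"
  shows "diff_ext \<delta> (gbasis S * w) = diff_ext \<delta> (gbasis S) * w + (- 1) ^ card S * gbasis S * diff_ext \<delta> w"
  using assms
proof (induction S)
  case empty
  have "diff_ext \<delta> 1 = 0" using diff_ext_gbasis[of "{}" \<delta>] by (simp add: diff_basis_def)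
  then show ?case by simp
next
  case (insert v S)
  let ?s = "scal (shuffle_sign {v} S) :: ('a, 'b) grassmann"
  have e: "gbasis (insert v S) = ?s * (gen v * gbasis S)"
    using insert.hyps by (simp add: gbasis_mult scal_scal)
  have sgn: "(- 1) ^ card (insert v S) * x = - ((- 1) ^ card S * x)" for x :: "('a, 'b) grassmann"
    using insert.hyps by simp
  have c: "x * ((- 1) ^ k * y) = (- 1) ^ k * (x * y)" for k and x y :: "('a, 'b) grassmann"
    by (cases "even k") auto
  have "diff_ext \<delta> (gen v * (gbasis S * w)) =
      scal (\<delta> v) * (gbasis S * w) - gen v * (diff_ext \<delta> (gbasis S) * w + (- 1) ^ card S * (gbasis S * diff_ext \<delta> w))"
    by (simp only: diff_ext_gen insert.IH mult.assoc)
  also have "\<dots> = diff_ext \<delta> (gen v * gbasis S) * w + (- 1) ^ card (insert v S) * (gen v * (gbasis S * diff_ext \<delta> w))"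
    unfolding sgn diff_ext_gen by (simp only: left_diff_distrib distrib_left mult.assoc c) simp
  finally show ?case
    unfolding e by (simp only: mult.assoc diff_ext_scal distrib_left scal_left_commute)
qed

lemma odd_derivation_exists:
  "\<exists>D. odd_derivation D \<and> (\<forall>v. D (gen v) = scal (\<delta> v :: 'a::comm_ring_1))"
proof (intro exI[of _ "diff_ext \<delta>"] conjI allI)
  show "diff_ext \<delta> (gen v) = scal (\<delta> v)" for v
    by (simp add: diff_ext_gbasis diff_basis_def)
  show "odd_derivation (diff_ext \<delta>)"
    unfolding odd_derivation_def
  proof (intro conjI allI impI)
    fix p and a b :: "('b, 'a) grassmann" assume a: "hcomp p a = a"
    show "hcomp (p + 1) (diff_ext \<delta> a) = diff_ext \<delta> a"
    proof (rule hcomp_eqI)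
      fix T assume "T \<in> gsupp (diff_ext \<delta> a)"
      then have "(\<Sum>S\<in>gsupp a. gcoeff (scal (gcoeff a S) * diff_basis \<delta> S) T) \<noteq> 0"
        by (simp add: gsupp_def diff_ext_def gcoeff_sum)
      then obtain S where S: "S \<in> gsupp a" "gcoeff (scal (gcoeff a S) * diff_basis \<delta> S) T \<noteq> 0"
        by (rule sum.not_neutral_contains_not_neutral)
      then have "(\<Sum>v\<in>S. gcoeff (scal (shuffle_sign {v} (S - {v}) * \<delta> v) * gbasis (S - {v})) T) \<noteq> 0"
        by (auto simp: diff_basis_def gcoeff_sum)
      then obtain v where v: "v \<in> S" "gcoeff (scal (shuffle_sign {v} (S - {v}) * \<delta> v) * gbasis (S - {v})) T \<noteq> 0"
        by (rule sum.not_neutral_contains_not_neutral)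
      then have "T = S - {v}" by (auto simp: gcoeff_gbasis split: if_splits)
      then have "Suc (card T) = card S" using S(1) v(1) finite_in_gsupp by (metis card_Suc_Diff1)
      then show "card T mod 2 = (p + 1) mod 2" using hcomp_gsupp[OF a S(1)] by presburger
    qed
    show "diff_ext \<delta> (a * b) = diff_ext \<delta> a * b + (- 1) ^ p * a * diff_ext \<delta> b"
    proof -
      have c: "x * ((- 1) ^ k * y) = (- 1) ^ k * (x * y)" for k and x y :: "('b, 'a) grassmann"
        by (cases "even k") auto
      have 1: "diff_ext \<delta> (scal (gcoeff a S) * gbasis S * b) =
          diff_ext \<delta> (scal (gcoeff a S) * gbasis S) * b +
          (- 1) ^ p * (scal (gcoeff a S) * gbasis S) * diff_ext \<delta> b" if S: "S \<in> gsupp a" for S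
      proof -
        have "even (card S) \<longleftrightarrow> even p" using hcomp_gsupp[OF a S] by presburger
        then have "(- 1) ^ card S = ((- 1) ^ p :: ('b, 'a) grassmann)"
          by (simp add: minus_one_power_iff)
        then show ?thesis
          using diff_ext_gbasis_times[OF finite_in_gsupp[OF S], of \<delta> b]
          by (simp only: mult.assoc diff_ext_scal distrib_left c)
      qed
      let ?a = "\<Sum>S\<in>gsupp a. scal (gcoeff a S) * gbasis S"
      have "diff_ext \<delta> (?a * b) = diff_ext \<delta> ?a * b + (- 1) ^ p * ?a * diff_ext \<delta> b"
        unfolding sum_distrib_right sum_distrib_left diff_ext_sum sum.distrib[symmetric]
        by (rule sum.cong[OF refl 1])
      then show ?thesis unfolding grassmann_expand[symmetric] .
    qed
  qed (simp_all add: diff_ext_add diff_ext_scal)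
qed

section \<open>The variables and the polynomial rings\<close>

datatype pvar = PX nat | PY nat

text \<open>
  The Grassmann variables: \<open>VU k\<close> is \<open>u\<^sub>k\<close>, \<open>Vfx i\<close>, \<open>Vfx' i\<close>, \<open>Vfy i\<close>, \<open>Vfy' i\<close> are the
  variables of the four collections attached to \<open>f\<close>, and similarly for \<open>F\<close>. All collections are
  indexed from 1. The order puts \<open>v\<^sub>1, v\<^sub>2, \<dots>\<close> of each collection in increasing order, so that
  \<open>gbasis {v\<^sub>1, \<dots>, v\<^sub>m} = v\<^sub>1 * v\<^sub>2 * \<dots> * v\<^sub>m\<close> (see \<open>prod_list_collection\<close> below).
\<close>

datatype gvar = VU nat | Vfx nat | Vfx' nat | Vfy nat | Vfy' nat | VFx nat | VFx' nat | VFy nat | VFy' nat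

fun gvar_code :: "gvar \<Rightarrow> nat \<times> nat" where
  "gvar_code (VU k) = (0, k)"
| "gvar_code (Vfx k) = (1, k)"
| "gvar_code (Vfx' k) = (2, k)"
| "gvar_code (Vfy k) = (3, k)"
| "gvar_code (Vfy' k) = (4, k)"
| "gvar_code (VFx k) = (5, k)"
| "gvar_code (VFx' k) = (6, k)"
| "gvar_code (VFy k) = (7, k)"
| "gvar_code (VFy' k) = (8, k)"

lemma gvar_code_inject: "gvar_code v = gvar_code w \<Longrightarrow> v = w"
  by (cases v; cases w) auto

instantiation gvar :: linorder
begin

definition less_eq_gvar :: "gvar \<Rightarrow> gvar \<Rightarrow> bool" where
  "v \<le> w \<longleftrightarrow> fst (gvar_code v) < fst (gvar_code w) \<or>
     fst (gvar_code v) = fst (gvar_code w) \<and> snd (gvar_code v) \<le> snd (gvar_code w)"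

definition less_gvar :: "gvar \<Rightarrow> gvar \<Rightarrow> bool" where
  "v < w \<longleftrightarrow> v \<le> w \<and> \<not> w \<le> (v::gvar)"

instance
proof
  fix v w :: gvar
  assume "v \<le> w" "w \<le> v"
  then show "v = w" by (intro gvar_code_inject prod_eqI) (auto simp: less_eq_gvar_def)
qed (auto simp: less_eq_gvar_def less_gvar_def)

end

type_synonym 'r poly1 = "(nat \<Rightarrow>\<^sub>0 nat) \<Rightarrow>\<^sub>0 'r"
type_synonym 'r poly2 = "(pvar \<Rightarrow>\<^sub>0 nat) \<Rightarrow>\<^sub>0 'r"
type_synonym 'r galg = "(gvar, 'r poly2) grassmann"

text \<open>The polynomials whose variables lie in \<open>V\<close>.\<close>

definition polys_in :: "'v set \<Rightarrow> (('v \<Rightarrow>\<^sub>0 nat) \<Rightarrow>\<^sub>0 'r::zero) set" where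
  "polys_in V = {p. \<forall>m\<in>Poly_Mapping.keys p. Poly_Mapping.keys m \<subseteq> V}"

definition pvariable :: "pvar \<Rightarrow> 'r::comm_ring_1 poly2" where
  "pvariable v = Poly_Mapping.single (Poly_Mapping.single v 1) 1"

text \<open>\<open>poly_at PX H\<close> is \<open>H(x)\<close> and \<open>poly_at PY H\<close> is \<open>H(y)\<close>.\<close>

definition poly_at :: "(nat \<Rightarrow> pvar) \<Rightarrow> 'r::comm_ring_1 poly1 \<Rightarrow> 'r poly2" where
  "poly_at v H = (\<Sum>m\<in>Poly_Mapping.keys H.
     Poly_Mapping.single 0 (Poly_Mapping.lookup H m) *
     (\<Prod>k\<in>Poly_Mapping.keys m. pvariable (v k) ^ Poly_Mapping.lookup m k))"

abbreviation xvars :: "nat \<Rightarrow> pvar set" where "xvars n \<equiv> PX ` {1..n}"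
abbreviation yvars :: "nat \<Rightarrow> pvar set" where "yvars n \<equiv> PY ` {1..n}"

definition difference_quotients :: "nat \<Rightarrow> ('r::comm_ring_1 poly1 \<Rightarrow> nat \<Rightarrow> 'r poly2) \<Rightarrow> bool" where
  "difference_quotients n nabla \<longleftrightarrow> (\<forall>H\<in>polys_in {1..n}.
     (\<forall>k\<in>{1..n}. nabla H k \<in> polys_in (xvars n \<union> yvars n)) \<and>
     (\<Sum>k=1..n. (pvariable (PX k) - pvariable (PY k)) * nabla H k) = poly_at PX H - poly_at PY H)"

lemma prod_list_collection:
  assumes "\<And>i j. i < j \<Longrightarrow> v i < (v j :: gvar)"
  shows "prod_list (map (gen \<circ> v) [1..<Suc m]) = (gbasis (v ` {1..m}) :: 'r::comm_ring_1 galg)"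
proof -
  have "sorted_wrt (<) (map v [1..<Suc m])"
    unfolding sorted_wrt_map by (rule sorted_wrt_mono_rel[OF _ sorted_wrt_upt]) (rule assms)
  from prod_list_gen[OF this] show ?thesis
    by (simp add: comp_def atLeastLessThanSuc_atLeastAtMost del: upt_Suc)
qed

text \<open>The Grassmann algebra over \<open>R[P]\<close> in the variables \<open>V\<close>.\<close>

definition Lam :: "pvar set \<Rightarrow> gvar set \<Rightarrow> 'r::comm_ring_1 galg set" where
  "Lam P V = {w. \<forall>S\<in>gsupp w. S \<subseteq> V \<and> gcoeff w S \<in> polys_in P}"

text \<open>
  The Koszul differential, as a derivation of the Grassmann algebra in all the variables;
  it restricts to each of the complexes \<open>Lam (yvars n) (Vfy ` {1..s} \<union> VFy ` {1..t})\<close> etc.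
\<close>

definition koszul_differential ::
    "nat \<Rightarrow> nat \<Rightarrow> nat \<Rightarrow> (nat \<Rightarrow> 'r::comm_ring_1 poly1) \<Rightarrow> (nat \<Rightarrow> 'r poly1)
       \<Rightarrow> ('r galg \<Rightarrow> 'r galg) \<Rightarrow> bool" where
  "koszul_differential n s t f F D \<longleftrightarrow> odd_derivation D \<and>
     (\<forall>i\<in>{1..s}. D (gen (Vfx i)) = scal (poly_at PX (f i)) \<and> D (gen (Vfx' i)) = scal (poly_at PX (f i)) \<and>
        D (gen (Vfy i)) = scal (poly_at PY (f i)) \<and> D (gen (Vfy' i)) = scal (poly_at PY (f i))) \<and>
     (\<forall>j\<in>{1..t}. D (gen (VFx j)) = scal (poly_at PX (F j)) \<and> D (gen (VFx' j)) = scal (poly_at PX (F j)) \<and>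
        D (gen (VFy j)) = scal (poly_at PY (F j)) \<and> D (gen (VFy' j)) = scal (poly_at PY (F j))) \<and>
     (\<forall>k\<in>{1..n}. D (gen (VU k)) = scal (pvariable (PX k) - pvariable (PY k)))"

lemma koszul_differential_exists: "\<exists>D. koszul_differential n s t f F D"
proof -
  define \<delta> where "\<delta> z = (case z of VU k \<Rightarrow> pvariable (PX k) - pvariable (PY k)
    | Vfx i \<Rightarrow> poly_at PX (f i) | Vfx' i \<Rightarrow> poly_at PX (f i)
    | Vfy i \<Rightarrow> poly_at PY (f i) | Vfy' i \<Rightarrow> poly_at PY (f i)
    | VFx j \<Rightarrow> poly_at PX (F j) | VFx' j \<Rightarrow> poly_at PX (F j)
    | VFy j \<Rightarrow> poly_at PY (F j) | VFy' j \<Rightarrow> poly_at PY (F j))" for z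
  obtain D where "odd_derivation D" "\<And>z. D (gen z) = scal (\<delta> z)"
    using odd_derivation_exists[of \<delta>] by blast
  then have "koszul_differential n s t f F D"
    by (simp add: koszul_differential_def \<delta>_def)
  then show ?thesis by (rule exI[of _ D])
qed

text \<open>\<open>Hom\<^sub>R(Lam P V, R)\<close>.\<close>

definition dual :: "pvar set \<Rightarrow> gvar set \<Rightarrow> ('r::comm_ring_1 galg \<Rightarrow> 'r) set" where
  "dual P V = {c \<in> extensional (Lam P V).
     (\<forall>a\<in>Lam P V. \<forall>b\<in>Lam P V. c (a + b) = c a + c b) \<and>
     (\<forall>r. \<forall>a\<in>Lam P V. c (scal (Poly_Mapping.single 0 r) * a) = r * c a)}"

definition functional :: "('r::comm_ring_1 galg \<Rightarrow> 'r) \<Rightarrow> 'r galg \<Rightarrow> 'r galg" where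
  "functional c w = scal (Poly_Mapping.single 0 (c w))"

section \<open>Extension of functionals and contraction\<close>

definition mon_restrict :: "'v set \<Rightarrow> ('v \<Rightarrow>\<^sub>0 nat) \<Rightarrow> 'v \<Rightarrow>\<^sub>0 nat" where
  "mon_restrict P m = Poly_Mapping.mapp (\<lambda>v e. if v \<in> P then e else 0) m"

text \<open>
  \<open>extend p P V \<phi>\<close> is the extension of a linear map \<open>\<phi>\<close> of parity \<open>p\<close> on functions of the polynomial
  variables \<open>P\<close> and the Grassmann variables \<open>V\<close>, by linearity over the other polynomial variables
  and by \<open>\<phi>(\<theta> w) = (-1)\<^bsup>p|\<theta>|\<^esup> \<theta> \<phi>(w)\<close> for products \<open>\<theta>\<close> of other Grassmann variables
  (see \<open>extend_parameter\<close>). Each term \<open>a x\<^sup>m e\<^sub>S\<close> is split as \<open>\<theta> w\<close>, where \<open>w\<close> contains the variables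
  in \<open>P\<close> and \<open>V\<close> and \<open>\<theta>\<close> the others; reordering \<open>e\<^sub>S\<close> gives the sign.
\<close>

definition extend ::
    "nat \<Rightarrow> pvar set \<Rightarrow> gvar set \<Rightarrow> ('r::comm_ring_1 galg \<Rightarrow> 'r galg) \<Rightarrow> 'r galg \<Rightarrow> 'r galg" where
  "extend p P V \<phi> w = (\<Sum>S\<in>gsupp w. \<Sum>m\<in>Poly_Mapping.keys (gcoeff w S).
     (- 1) ^ (p * card (S - V)) *
     (scal (Poly_Mapping.single (mon_restrict (- P) m)
        (shuffle_sign (S - V) (S \<inter> V) * Poly_Mapping.lookup (gcoeff w S) m)) * gbasis (S - V)) *
     \<phi> (scal (Poly_Mapping.single (mon_restrict P m) 1) * gbasis (S \<inter> V)))"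

lemma lookup_mon_restrict: "Poly_Mapping.lookup (mon_restrict P m) v = (if v \<in> P then Poly_Mapping.lookup m v else 0)"
  by (simp add: mon_restrict_def lookup_mapp when_def) (simp add: in_keys_iff)

lemma mon_restrict_add: "mon_restrict P (a + b) = mon_restrict P a + mon_restrict P b"
  by (rule poly_mapping_eqI) (simp add: lookup_mon_restrict lookup_add)

lemma mon_restrict_id: "Poly_Mapping.keys m \<subseteq> P \<Longrightarrow> mon_restrict P m = m"
  by (rule poly_mapping_eqI, subst lookup_mon_restrict) (metis in_keys_iff subsetD)

lemma mon_restrict_0: "Poly_Mapping.keys m \<inter> P = {} \<Longrightarrow> mon_restrict P m = 0"
  by (rule poly_mapping_eqI, subst lookup_mon_restrict) (metis disjoint_iff in_keys_iff lookup_zero)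

definition gmon :: "'r \<Rightarrow> (pvar \<Rightarrow>\<^sub>0 nat) \<Rightarrow> gvar set \<Rightarrow> 'r::comm_ring_1 galg" where
  "gmon r m S = scal (Poly_Mapping.single m r) * gbasis S"

definition extend_term where
  "extend_term p P V \<phi> S m (r::'r::comm_ring_1) = (- 1) ^ (p * card (S - V)) *
     gmon (shuffle_sign (S - V) (S \<inter> V) * r) (mon_restrict (- P) m) (S - V) *
     \<phi> (gmon 1 (mon_restrict P m) (S \<inter> V))"

lemma gmon_add: "gmon (a + b) m S = gmon a m S + gmon b m S"
  by (simp add: gmon_def single_add scal_add distrib_right)

lemma gmon_0: "gmon 0 m S = 0"
  by (simp add: gmon_def)

lemma extend_term_add: "extend_term p P V \<phi> S m (a + b) = extend_term p P V \<phi> S m a + extend_term p P V \<phi> S m b"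
  by (simp add: extend_term_def distrib_left gmon_add distrib_right)

lemma extend_term_0: "extend_term p P V \<phi> S m 0 = 0"
  by (simp add: extend_term_def gmon_0)

lemma extend_superset:
  assumes "finite A" "finite B" "gsupp w \<subseteq> A" "\<And>S. Poly_Mapping.keys (gcoeff w S) \<subseteq> B"
  shows "extend p P V \<phi> w = (\<Sum>S\<in>A. \<Sum>m\<in>B. extend_term p P V \<phi> S m (Poly_Mapping.lookup (gcoeff w S) m))"
proof -
  have "extend p P V \<phi> w = (\<Sum>S\<in>gsupp w. \<Sum>m\<in>Poly_Mapping.keys (gcoeff w S). extend_term p P V \<phi> S m (Poly_Mapping.lookup (gcoeff w S) m))"
    unfolding extend_def extend_term_def gmon_def ..
  also have "\<dots> = (\<Sum>S\<in>gsupp w. \<Sum>m\<in>B. extend_term p P V \<phi> S m (Poly_Mapping.lookup (gcoeff w S) m))"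
    by (rule sum.cong[OF refl], rule sum.mono_neutral_left[OF assms(2,4)]) (simp add: in_keys_iff extend_term_0)
  also have "\<dots> = (\<Sum>S\<in>A. \<Sum>m\<in>B. extend_term p P V \<phi> S m (Poly_Mapping.lookup (gcoeff w S) m))"
    by (rule sum.mono_neutral_left[OF assms(1,3)]) (simp add: gsupp_def extend_term_0)
  finally show ?thesis .
qed

lemma finite_all_keys: "finite (\<Union>S. Poly_Mapping.keys (gcoeff w S))"
proof -
  have "(\<Union>S. Poly_Mapping.keys (gcoeff w S)) \<subseteq> (\<Union>S\<in>gsupp w. Poly_Mapping.keys (gcoeff w S))"
  proof clarify
    fix S m assume m: "m \<in> Poly_Mapping.keys (gcoeff w S)"
    then have "S \<in> gsupp w" unfolding gsupp_def by force
    then show "m \<in> (\<Union>S\<in>gsupp w. Poly_Mapping.keys (gcoeff w S))" using m by (rule UN_I)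
  qed
  then show ?thesis by (rule finite_subset) simp
qed

lemma extend_add: "extend p P V \<phi> (a + b) = extend p P V \<phi> a + extend p P V \<phi> b"
proof -
  let ?A = "gsupp a \<union> gsupp b"
  let ?B = "(\<Union>S. Poly_Mapping.keys (gcoeff a S)) \<union> (\<Union>S. Poly_Mapping.keys (gcoeff b S))"
  have f: "finite ?A" "finite ?B" using finite_all_keys by auto
  have a: "gsupp a \<subseteq> ?A" "\<And>S. Poly_Mapping.keys (gcoeff a S) \<subseteq> ?B" by blast+
  have b: "gsupp b \<subseteq> ?A" "\<And>S. Poly_Mapping.keys (gcoeff b S) \<subseteq> ?B" by blast+
  have "gsupp (a + b) \<subseteq> ?A" by (auto simp: gsupp_def)
  moreover have "Poly_Mapping.keys (gcoeff (a + b) S) \<subseteq> ?B" for S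
    using keys_add[of "gcoeff a S" "gcoeff b S"] unfolding gcoeff_add by blast
  ultimately show ?thesis
    unfolding extend_superset[OF f a] extend_superset[OF f b]
    by (subst extend_superset[OF f]) (simp_all only: gcoeff_add lookup_add extend_term_add sum.distrib)
qed

lemma extend_0: "extend p P V \<phi> 0 = 0"
  by (simp add: extend_def gsupp_def)

lemma extend_sum: "extend p P V \<phi> (\<Sum>i\<in>I. h i) = (\<Sum>i\<in>I. extend p P V \<phi> (h i))"
  by (induction I rule: infinite_finite_induct) (auto simp: extend_add extend_0)

lemma extend_gmon:
  assumes "finite S"
  shows "extend p P V \<phi> (gmon r m S) = extend_term p P V \<phi> S m r"
proof -
  have g: "gcoeff (gmon r m S) T = (if T = S then Poly_Mapping.single m r else 0)" for T
    using assms by (simp add: gmon_def gcoeff_gbasis)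
  have "extend p P V \<phi> (gmon r m S) =
      (\<Sum>T\<in>{S}. \<Sum>k\<in>{m}. extend_term p P V \<phi> T k (Poly_Mapping.lookup (gcoeff (gmon r m S) T) k))"
    by (rule extend_superset) (auto simp: gsupp_def g split: if_splits)
  then show ?thesis by (simp add: g)
qed

lemma gmon_mult:
  assumes "finite S" "finite T" "S \<inter> T = {}"
  shows "gmon a m S * gmon b k T = gmon (shuffle_sign S T * (a * b)) (m + k) (S \<union> T)"
proof -
  have "(- 1) ^ j = (Poly_Mapping.single 0 ((- 1) ^ j) :: 'a poly2)" for j
    by (cases "even j") (simp_all add: single_uminus)
  then have s: "(shuffle_sign S T :: 'a poly2) = Poly_Mapping.single 0 (shuffle_sign S T)"
    unfolding shuffle_sign_def by blast
  have "gmon a m S * gmon b k T = scal (Poly_Mapping.single m a) * (scal (Poly_Mapping.single k b) * (gbasis S * gbasis T))"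
    unfolding gmon_def mult.assoc scal_left_commute[of "gbasis S"] ..
  also have "gbasis S * gbasis T = (scal (Poly_Mapping.single 0 (shuffle_sign S T)) * gbasis (S \<union> T) :: 'a galg)"
    using assms by (simp add: gbasis_mult s)
  finally show ?thesis
    by (simp add: scal_scal mult_single gmon_def mult.commute mult.left_commute)
qed

lemma gmon_scal: "gmon r m S = scal (Poly_Mapping.single 0 r) * gmon 1 m S"
  by (simp add: gmon_def scal_scal mult_single)

lemma gmon_expand:
  "w = (\<Sum>S\<in>gsupp w. \<Sum>m\<in>Poly_Mapping.keys (gcoeff w S). gmon (Poly_Mapping.lookup (gcoeff w S) m) m S)"
proof -
  have c: "c = (\<Sum>m\<in>Poly_Mapping.keys c. Poly_Mapping.single m (Poly_Mapping.lookup c m))" for c :: "'a poly2"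
    by (rule poly_mapping_eqI) (simp add: lookup_sum lookup_single when_def in_keys_iff)
  have "scal (\<Sum>m\<in>M. h m) = (\<Sum>m\<in>M. scal (h m) :: 'a galg)" for M :: "(pvar \<Rightarrow>\<^sub>0 nat) set" and h
    by (induction M rule: infinite_finite_induct) (auto simp: scal_add)
  then have s: "(\<Sum>m\<in>Poly_Mapping.keys c. scal (Poly_Mapping.single m (Poly_Mapping.lookup c m))) = (scal c :: 'a galg)" for c
    using c by metis
  show ?thesis
    unfolding gmon_def sum_distrib_right[symmetric] s by (rule grassmann_expand)
qed

lemma extend_parameter:
  assumes add: "\<And>a b. a \<in> Lam P V \<Longrightarrow> b \<in> Lam P V \<Longrightarrow> \<phi> (a + b) = \<phi> a + \<phi> b"
    and scale: "\<And>r a. a \<in> Lam P V \<Longrightarrow>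
      \<phi> (scal (Poly_Mapping.single 0 r) * a) = scal (Poly_Mapping.single 0 r) * \<phi> a"
    and \<theta>: "\<theta> \<in> Lam (- P) (- V)" "hcomp q \<theta> = \<theta>" and w: "w \<in> Lam P V"
  shows "extend p P V \<phi> (\<theta> * w) = (- 1) ^ (p * q) * \<theta> * \<phi> w"
proof -
  have z: "0 \<in> Lam P V" by (simp add: Lam_def gsupp_def)
  have \<phi>0: "\<phi> 0 = 0" using scale[OF z, of 0] by simp
  have L_add: "a + b \<in> Lam P V" if "a \<in> Lam P V" "b \<in> Lam P V" for a b :: "'a galg"
    unfolding Lam_def
  proof (clarify, intro conjI)
    fix S assume S: "S \<in> gsupp (a + b)"
    then have "S \<in> gsupp a \<or> S \<in> gsupp b" by (auto simp: gsupp_def)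
    then show "S \<subseteq> V" using that by (auto simp: Lam_def)
    have in0: "gcoeff c S \<in> polys_in P" if "c \<in> Lam P V" for c :: "'a galg"
      using that by (cases "S \<in> gsupp c") (auto simp: Lam_def gsupp_def polys_in_def)
    show "gcoeff (a + b) S \<in> polys_in P"
      using in0[OF that(1)] in0[OF that(2)] keys_add[of "gcoeff a S" "gcoeff b S"]
      unfolding polys_in_def gcoeff_add by blast
  qed
  have L_sum: "(\<Sum>i\<in>I. h i) \<in> Lam P V \<and> \<phi> (\<Sum>i\<in>I. h i) = (\<Sum>i\<in>I. \<phi> (h i))"
    if "\<And>i. i \<in> I \<Longrightarrow> h i \<in> Lam P V" for I and h :: "'b \<Rightarrow> 'a galg"
    using that by (induction I rule: infinite_finite_induct) (auto simp: z \<phi>0 add L_add)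
  have L_sum': "(\<Sum>i\<in>I. h i) \<in> Lam P V \<and> \<phi> (\<Sum>i\<in>I. h i) = (\<Sum>i\<in>I. \<phi> (h i))"
    if "\<And>i. i \<in> I \<Longrightarrow> h i \<in> Lam P V" for I and h :: "'c \<Rightarrow> 'a galg"
    using that by (induction I rule: infinite_finite_induct) (auto simp: z \<phi>0 add L_add)
  have gmon_Lam: "gmon r m S \<in> Lam P V" if "S \<subseteq> V" "Poly_Mapping.keys m \<subseteq> P" for r :: 'a and m S
  proof -
    have "gcoeff (gmon r m S) T = (if T = S \<and> finite S then Poly_Mapping.single m r else 0)" for T
      by (simp add: gmon_def gcoeff_gbasis)
    then show ?thesis using that by (auto simp: Lam_def gsupp_def polys_in_def)
  qed
  have c: "x * ((- 1) ^ k * y) = (- 1) ^ k * (x * y)" for k and x y :: "'a galg"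
    by (cases "even k") auto
  have mono: "extend p P V \<phi> (gmon a m S * gmon b k T) = (- 1) ^ (p * q) * (gmon a m S * \<phi> (gmon b k T))"
    if S: "S \<subseteq> - V" "finite S" "card S mod 2 = q mod 2" "Poly_Mapping.keys m \<subseteq> - P"
      and T: "T \<subseteq> V" "finite T" "Poly_Mapping.keys k \<subseteq> P" for a b S T m k
  proof -
    have d: "S \<inter> T = {}" "(S \<union> T) - V = S" "(S \<union> T) \<inter> V = T" using S T by auto
    have r: "mon_restrict P (m + k) = k" "mon_restrict (- P) (m + k) = m"
      using S T by (auto simp: mon_restrict_add mon_restrict_id mon_restrict_0 disjoint_eq_subset_Compl)
    have "extend p P V \<phi> (gmon a m S * gmon b k T) = (- 1) ^ (p * card S) * (gmon (a * b) m S * \<phi> (gmon 1 k T))"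
      using S T d by (simp add: gmon_mult extend_gmon extend_term_def r mult.assoc)
    also have "(- 1) ^ (p * card S) = ((- 1) ^ (p * q) :: 'a galg)"
    proof -
      have "even (card S) \<longleftrightarrow> even q" using S(3) by presburger
      then show ?thesis by (simp add: minus_one_power_iff)
    qed
    also have "gmon (a * b) m S * \<phi> (gmon 1 k T) = gmon a m S * \<phi> (gmon b k T)"
    proof -
      have "\<phi> (gmon b k T) = scal (Poly_Mapping.single 0 b) * \<phi> (gmon 1 k T)"
        using scale[OF gmon_Lam[OF T(1,3)], of b 1] unfolding gmon_scal[of b k T] .
      moreover have "gmon a m S * (scal (Poly_Mapping.single 0 b) * x) = gmon (a * b) m S * x" for x
        unfolding scal_left_commute unfolding gmon_def mult.assoc scal_scal mult_single
        by (simp add: mult.commute)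
      ultimately show ?thesis by simp
    qed
    finally show ?thesis .
  qed
  let ?K = "\<lambda>x S. Poly_Mapping.keys (gcoeff (x :: 'a galg) S)"
  let ?t = "\<lambda>x S m. gmon (Poly_Mapping.lookup (gcoeff (x :: 'a galg) S) m) m S"
  have wt: "T \<subseteq> V \<and> finite T \<and> Poly_Mapping.keys k \<subseteq> P" if "T \<in> gsupp w" "k \<in> ?K w T" for T k
  proof (intro conjI)
    from w that(1) have "T \<subseteq> V \<and> gcoeff w T \<in> polys_in P" unfolding Lam_def by blast
    then show "T \<subseteq> V" "Poly_Mapping.keys k \<subseteq> P" using that(2) unfolding polys_in_def by blast+
    show "finite T" using that(1) by (rule finite_in_gsupp)
  qed
  have tt: "S \<subseteq> - V \<and> finite S \<and> card S mod 2 = q mod 2 \<and> Poly_Mapping.keys m \<subseteq> - P"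
    if "S \<in> gsupp \<theta>" "m \<in> ?K \<theta> S" for S m
  proof (intro conjI)
    from \<theta>(1) that(1) have "S \<subseteq> - V \<and> gcoeff \<theta> S \<in> polys_in (- P)" unfolding Lam_def by blast
    then show "S \<subseteq> - V" "Poly_Mapping.keys m \<subseteq> - P" using that(2) unfolding polys_in_def by blast+
    show "finite S" using that(1) by (rule finite_in_gsupp)
    show "card S mod 2 = q mod 2" using \<theta>(2) that(1) by (rule hcomp_gsupp)
  qed
  have \<phi>w: "\<phi> w = (\<Sum>T\<in>gsupp w. \<Sum>k\<in>?K w T. \<phi> (?t w T k))"
  proof -
    have 1: "(\<Sum>k\<in>?K w T. ?t w T k) \<in> Lam P V \<and> \<phi> (\<Sum>k\<in>?K w T. ?t w T k) = (\<Sum>k\<in>?K w T. \<phi> (?t w T k))"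
      if "T \<in> gsupp w" for T
    proof (rule L_sum, rule gmon_Lam)
      fix k assume "k \<in> ?K w T"
      from wt[OF that this] show "T \<subseteq> V" "Poly_Mapping.keys k \<subseteq> P" by blast+
    qed
    have "\<phi> (\<Sum>T\<in>gsupp w. \<Sum>k\<in>?K w T. ?t w T k) = (\<Sum>T\<in>gsupp w. \<phi> (\<Sum>k\<in>?K w T. ?t w T k))"
      by (rule L_sum'[THEN conjunct2]) (rule 1[THEN conjunct1])
    also have "\<dots> = (\<Sum>T\<in>gsupp w. \<Sum>k\<in>?K w T. \<phi> (?t w T k))"
      by (rule sum.cong[OF refl]) (rule 1[THEN conjunct2])
    finally show ?thesis unfolding gmon_expand[symmetric] .
  qed
  have "extend p P V \<phi> (\<theta> * w) = extend p P V \<phi>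
      ((\<Sum>S\<in>gsupp \<theta>. \<Sum>m\<in>?K \<theta> S. ?t \<theta> S m) * (\<Sum>T\<in>gsupp w. \<Sum>k\<in>?K w T. ?t w T k))"
    unfolding gmon_expand[symmetric] ..
  also have "\<dots> = (\<Sum>T\<in>gsupp w. \<Sum>k\<in>?K w T. \<Sum>S\<in>gsupp \<theta>. \<Sum>m\<in>?K \<theta> S.
      extend p P V \<phi> (?t \<theta> S m * ?t w T k))"
    unfolding sum_distrib_right sum_distrib_left extend_sum ..
  also have "\<dots> = (\<Sum>T\<in>gsupp w. \<Sum>k\<in>?K w T. \<Sum>S\<in>gsupp \<theta>. \<Sum>m\<in>?K \<theta> S.
      (- 1) ^ (p * q) * (?t \<theta> S m * \<phi> (?t w T k)))"
  proof (intro sum.cong[OF refl])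
    fix T k S m assume "S \<in> gsupp \<theta>" "m \<in> ?K \<theta> S" "T \<in> gsupp w" "k \<in> ?K w T"
    then show "extend p P V \<phi> (?t \<theta> S m * ?t w T k) = (- 1) ^ (p * q) * (?t \<theta> S m * \<phi> (?t w T k))"
      using tt[of S m] wt[of T k] by (intro mono) blast+
  qed
  also have "\<dots> = (- 1) ^ (p * q) * ((\<Sum>S\<in>gsupp \<theta>. \<Sum>m\<in>?K \<theta> S. ?t \<theta> S m) * \<phi> w)"
    unfolding \<phi>w sum_distrib_right sum_distrib_left ..
  finally show ?thesis unfolding gmon_expand[symmetric] by (simp only: mult.assoc)
qed

text \<open>Contraction over the variables \<open>P\<close>, \<open>V\<close> with the functional written first.\<close>

definition contract_left ::
    "pvar set \<Rightarrow> gvar set \<Rightarrow> ('r::comm_ring_1 galg \<Rightarrow> 'r galg) \<Rightarrow> 'r galg \<Rightarrow> 'r galg" where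
  "contract_left P V \<phi> w = (\<Sum>p\<in>{0, 1}. extend p P V (parity_part p \<phi>) w)"

text \<open>Contraction over the variables \<open>P\<close>, \<open>V\<close> with the function written first.\<close>

definition contract_right ::
    "pvar set \<Rightarrow> gvar set \<Rightarrow> 'r::comm_ring_1 galg \<Rightarrow> ('r galg \<Rightarrow> 'r galg) \<Rightarrow> 'r galg" where
  "contract_right P V w \<phi> =
     (\<Sum>p\<in>{0, 1}. \<Sum>q\<in>{0, 1}. (- 1) ^ (p * q) * extend p P V (parity_part p \<phi>) (hcomp q w))"

text \<open>
  The functional \<open>det \<parallel>v\<^sub>*\<parallel>\<close> for the collection \<open>v\<close> with index set \<open>{1..m}\<close>,
  extended to all other variables as parameters: on the algebra in \<open>v\<close> alone it takes the
  coefficient of \<open>v\<^sub>1 v\<^sub>2 \<dots> v\<^sub>m\<close>, which is \<open>gbasis (v ` {1..m})\<close> by \<open>prod_list_collection\<close>.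
\<close>

definition det_star :: "(nat \<Rightarrow> gvar) \<Rightarrow> nat \<Rightarrow> 'r::comm_ring_1 galg \<Rightarrow> 'r galg" where
  "det_star v m = contract_left {} (v ` {1..m}) (\<lambda>w. scal (gcoeff w (v ` {1..m})))"

text \<open>
  \<open>exp_star w v m\<close> is \<open>exp(w v\<^sub>*)\<close>, the substitution of \<open>w\<^sub>i\<close> for \<open>v\<^sub>i\<close> (\<open>1 \<le> i \<le> m\<close>),
  the other variables being fixed.
\<close>

definition exp_star :: "(nat \<Rightarrow> gvar) \<Rightarrow> (nat \<Rightarrow> gvar) \<Rightarrow> nat \<Rightarrow> 'r::comm_ring_1 galg \<Rightarrow> 'r galg" where
  "exp_star w v m = gsubst (\<lambda>z. if z \<in> v ` {1..m} then w (inv_into {1..m} v z) else z)"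

section \<open>Determinants with a Grassmann row\<close>

text \<open>A column of the determinant is a pair of the coefficients \<open>k \<mapsto> \<nabla>\<^sup>k H\<close> and the odd element below.\<close>

definition gdet :: "nat \<Rightarrow> ((nat \<Rightarrow> 'r::comm_ring_1 poly2) \<times> 'r galg) list \<Rightarrow> 'r galg" where
  "gdet n cs = (THE Q. (\<forall>S\<in>gsupp Q. S \<inter> VU ` {1..n} = {}) \<and>
     prod_list (map (\<lambda>k. gen (VU k)) [1..<Suc n]) * Q =
       gfilter (\<lambda>S. card (S \<inter> VU ` {1..n}) = n)
         (prod_list (map (\<lambda>(h, w). (\<Sum>k=1..n. gen (VU k) * scal (h k)) + w) cs)))"

definition columns ::
    "('r::comm_ring_1 poly1 \<Rightarrow> nat \<Rightarrow> 'r poly2) \<Rightarrow> (nat \<Rightarrow> 'r poly1) \<Rightarrow>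
     (nat \<Rightarrow> gvar) \<Rightarrow> (nat \<Rightarrow> gvar) \<Rightarrow> nat \<Rightarrow> ((nat \<Rightarrow> 'r poly2) \<times> 'r galg) list" where
  "columns nabla H v w m = map (\<lambda>j. (nabla (H j), gen (v j) - gen (w j))) [1..<Suc m]"

lemma gdet_unique:
  "\<exists>!Q. (\<forall>S\<in>gsupp Q. S \<inter> VU ` {1..n} = {}) \<and>
     prod_list (map (\<lambda>k. gen (VU k)) [1..<Suc n]) * Q =
       gfilter (\<lambda>S. card (S \<inter> VU ` {1..n}) = n) (z :: 'r::comm_ring_1 galg)"
proof -
  let ?U = "VU ` {1..n}"
  have U: "finite ?U" and cU: "card ?U = n" by (simp_all add: card_image inj_on_def)
  have e: "prod_list (map (\<lambda>k. gen (VU k)) [1..<Suc n]) = (gbasis ?U :: 'r galg)"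
    using prod_list_collection[of VU n, where 'r = 'r]
    by (simp add: comp_def less_gvar_def less_eq_gvar_def del: upt_Suc)
  have sub: "card (S \<inter> ?U) = n \<longleftrightarrow> ?U \<subseteq> S" for S
  proof
    assume "card (S \<inter> ?U) = n"
    then have "S \<inter> ?U = ?U" using U cU by (intro card_subset_eq) auto
    then show "?U \<subseteq> S" by auto
  next
    assume "?U \<subseteq> S"
    then show "card (S \<inter> ?U) = n" using cU by (simp add: Int_absorb1)
  qed
  have iff: "(\<forall>S\<in>gsupp Q. S \<inter> ?U = {}) \<and> gbasis ?U * Q = gfilter (\<lambda>S. card (S \<inter> ?U) = n) z \<longleftrightarrow>
      (\<forall>T. gcoeff Q T = (if T \<inter> ?U = {} then shuffle_sign ?U T * gcoeff z (?U \<union> T) else 0))" for Q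
  proof
    assume Q: "(\<forall>S\<in>gsupp Q. S \<inter> ?U = {}) \<and> gbasis ?U * Q = gfilter (\<lambda>S. card (S \<inter> ?U) = n) z"
    show "\<forall>T. gcoeff Q T = (if T \<inter> ?U = {} then shuffle_sign ?U T * gcoeff z (?U \<union> T) else 0)"
    proof
      fix T
      show "gcoeff Q T = (if T \<inter> ?U = {} then shuffle_sign ?U T * gcoeff z (?U \<union> T) else 0)"
      proof (cases "T \<inter> ?U = {}")
        case True
        then have "?U \<union> T - ?U = T" by auto
        moreover have "gcoeff (gbasis ?U * Q) (?U \<union> T) = gcoeff z (?U \<union> T)"
          unfolding conjunct2[OF Q] gcoeff_gfilter sub by simp
        ultimately have "shuffle_sign ?U T * gcoeff Q T = gcoeff z (?U \<union> T)"
          unfolding gcoeff_gbasis_times[OF U] by simp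
        then have "shuffle_sign ?U T * (shuffle_sign ?U T * gcoeff Q T) = shuffle_sign ?U T * gcoeff z (?U \<union> T)"
          by simp
        then show ?thesis using True by simp
      next
        case False
        then show ?thesis using Q by (auto simp: gsupp_def)
      qed
    qed
  next
    assume Q: "\<forall>T. gcoeff Q T = (if T \<inter> ?U = {} then shuffle_sign ?U T * gcoeff z (?U \<union> T) else 0)"
    have "gbasis ?U * Q = gfilter (\<lambda>S. card (S \<inter> ?U) = n) z"
    proof (rule grassmann_eqI)
      fix S :: "gvar set"
      have "(S - ?U) \<inter> ?U = {}" and "?U \<subseteq> S \<Longrightarrow> ?U \<union> (S - ?U) = S" by auto
      then show "gcoeff (gbasis ?U * Q) S = gcoeff (gfilter (\<lambda>S. card (S \<inter> ?U) = n) z) S"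
        unfolding gcoeff_gbasis_times[OF U] gcoeff_gfilter sub Q[rule_format] by simp
    qed
    moreover have "\<forall>S\<in>gsupp Q. S \<inter> ?U = {}"
      unfolding gsupp_def Q[rule_format] by (simp split: if_splits)
    ultimately show "(\<forall>S\<in>gsupp Q. S \<inter> ?U = {}) \<and> gbasis ?U * Q = gfilter (\<lambda>S. card (S \<inter> ?U) = n) z" by blast
  qed
  define g where "g = (\<lambda>T. if T \<inter> ?U = {} then shuffle_sign ?U T * gcoeff z (?U \<union> T) else 0)"
  have "{T. g T \<noteq> 0} \<subseteq> (\<lambda>S. S - ?U) ` gsupp z"
  proof
    fix T assume "T \<in> {T. g T \<noteq> 0}"
    then have T: "T \<inter> ?U = {}" "gcoeff z (?U \<union> T) \<noteq> 0" by (auto simp: g_def split: if_splits)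
    show "T \<in> (\<lambda>S. S - ?U) ` gsupp z"
    proof (rule image_eqI)
      show "T = ?U \<union> T - ?U" using T(1) by blast
      show "?U \<union> T \<in> gsupp z" using T(2) by (simp add: gsupp_def)
    qed
  qed
  then have "finite {T. g T \<noteq> 0}" by (rule finite_subset) simp
  moreover have "\<forall>T. g T \<noteq> 0 \<longrightarrow> finite T"
  proof (intro allI impI)
    fix T assume "g T \<noteq> 0"
    then have "gcoeff z (?U \<union> T) \<noteq> 0" unfolding g_def by (metis mult_zero_right)
    then have "finite (?U \<union> T)" by (rule contrapos_np) (rule gcoeff_infinite)
    then show "finite T" by simp
  qed
  ultimately have 1: "gcoeff (Abs_grassmann g) = g"
    by (intro Abs_grassmann_inverse) simp
  show ?thesis unfolding e iff
  proof (rule ex1I[of _ "Abs_grassmann g"])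
    show "\<forall>T. gcoeff (Abs_grassmann g) T =
        (if T \<inter> ?U = {} then shuffle_sign ?U T * gcoeff z (?U \<union> T) else 0)"
      unfolding 1 by (simp add: g_def)
    fix Q assume Q: "\<forall>T. gcoeff Q T = (if T \<inter> ?U = {} then shuffle_sign ?U T * gcoeff z (?U \<union> T) else 0)"
    show "Q = Abs_grassmann g"
    proof (rule grassmann_eqI)
      show "gcoeff Q T = gcoeff (Abs_grassmann g) T" for T
        by (simp only: 1) (simp only: g_def Q)
    qed
  qed
qed

end

theory Submission
  imports Defs HOL.Modules
begin

text \<open>
  Let \<open>Q\<close> be the determinant with the two block columns \<open>F\<close> and \<open>f\<close>, and let \<open>Q\<^sub>F\<close> and \<open>Q\<^sub>f\<close> be the
  determinants over one block. All four identities follow from the terms of \<open>Q\<close> that contain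
  every variable of one collection. The factor that belongs to \<open>f\<^sub>i\<close> is linear in \<open>Vfy i\<close> with coefficient \<open>-1\<close>, and no other
  factor contains \<open>Vfy i\<close>. So the full monomial in the \<open>Vfy\<close> arises in exactly one way, and \<open>Q\<close> is
  \<open>(-1)\<^sup>s Q\<^sub>F\<close> times this monomial plus terms that lack some \<open>Vfy i\<close> (\<open>gdet_append_lower\<close>).
  In the same way \<open>Q\<close> is \<open>(-1)\<^bsup>tn\<^esup>\<close> times the full monomial in the \<open>VFx\<close> times \<open>Q\<^sub>f\<close>, plus terms that
  lack some \<open>VFx j\<close>; here the sign is that of moving the \<open>t\<close> variables past \<open>u\<^sub>1 \<dots> u\<^sub>n\<close>
  (\<open>gdet_append_upper\<close>).

  A functional that applies \<open>det \<parallel>v\<^sub>*\<parallel>\<close> kills the terms that lack a variable of \<open>v\<close> and strips the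
  full monomial from the others, so that the contraction of \<open>Q\<close> becomes a contraction of \<open>Q\<^sub>F\<close> or
  \<open>Q\<^sub>f\<close> with what is left of the functional (\<open>contract_right_through_top\<close>,
  \<open>contract_left_through_top\<close>). The signs of the contraction cancel those of the leading part.
  In the identities without \<open>c\<close> both sides are now the same one-block determinant with renamed
  variables. In those with \<open>c\<close> the remaining contraction with \<open>c\<close> is the other side; in the second of
  them the monomial in the \<open>VFx\<close> first has to leave the contraction with \<open>c\<close>, which costs no sign
  because the function is written first (\<open>contract_right_functional_parameter\<close>).

  All computations are done on monomials. The renamings that occur preserve the order of the
  variables involved, so they take basis monomials to basis monomials without signs.
\<close>

section \<open>Elements spanned by prescribed monomials\<close>

text \<open>
  The argument never needs the exact terms that a determinant contains beyond its leading ones, only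
  which sets of variables they involve. \<open>gspan (Pow A)\<close> is the subalgebra in the variables \<open>A\<close>, and
  \<open>lacking W\<close> consists of the elements all of whose terms miss some variable of \<open>W\<close>. Congruence modulo
  \<open>lacking W\<close> is the tool for isolating the leading part with respect to \<open>W\<close>.
\<close>

definition gspan :: "'v set set \<Rightarrow> ('v, 'a::zero) grassmann set" where
  "gspan X = {w. gsupp w \<subseteq> X}"

abbreviation lacking :: "'v set \<Rightarrow> ('v, 'a::zero) grassmann set" where
  "lacking W \<equiv> gspan {S. \<not> W \<subseteq> S}"

lemma gspanI: "(\<And>S. gcoeff w S \<noteq> 0 \<Longrightarrow> S \<in> X) \<Longrightarrow> w \<in> gspan X"
  by (auto simp: gspan_def gsupp_def)

lemma gspanD: "w \<in> gspan X \<Longrightarrow> S \<notin> X \<Longrightarrow> gcoeff w S = 0"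
  by (auto simp: gspan_def gsupp_def)

lemma gspan_mono: "w \<in> gspan X \<Longrightarrow> X \<subseteq> Y \<Longrightarrow> w \<in> gspan Y"
  by (auto simp: gspan_def)

lemma gspan_Int: "w \<in> gspan X \<Longrightarrow> w \<in> gspan Y \<Longrightarrow> w \<in> gspan (X \<inter> Y)"
  by (auto simp: gspan_def)

lemma gspan_0: "0 \<in> gspan X"
  by (rule gspanI) simp

lemma gspan_add: "a \<in> gspan X \<Longrightarrow> b \<in> gspan X \<Longrightarrow> a + b \<in> gspan X"
  by (rule gspanI) (metis gcoeff_add gspanD add_0)

lemma gspan_uminus: "a \<in> gspan X \<Longrightarrow> - a \<in> gspan X"
  by (rule gspanI) (metis gcoeff_uminus gspanD neg_equal_0_iff_equal)

lemma gspan_diff: "a \<in> gspan X \<Longrightarrow> b \<in> gspan X \<Longrightarrow> a - b \<in> gspan X"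
  using gspan_add[of a X "- b"] gspan_uminus[of b X] by simp

lemma gspan_sum: "(\<And>i. i \<in> I \<Longrightarrow> h i \<in> gspan X) \<Longrightarrow> sum h I \<in> gspan X"
  by (induction I rule: infinite_finite_induct) (auto simp: gspan_0 gspan_add)

lemma gspan_gbasis: "S \<in> X \<Longrightarrow> gbasis S \<in> gspan X"
  by (rule gspanI) (auto simp: gcoeff_gbasis split: if_splits)

lemma gspan_scal_times:
  "a \<in> gspan X \<Longrightarrow> scal r * a \<in> (gspan X :: ('v::linorder, 'a::comm_ring_1) grassmann set)"
  by (rule gspanI) (metis gcoeff_scal_times gspanD mult_zero_right)

lemma gspan_times_scal:
  "a \<in> gspan X \<Longrightarrow> a * scal r \<in> (gspan X :: ('v::linorder, 'a::comm_ring_1) grassmann set)"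
  unfolding scal_commute by (rule gspan_scal_times)

lemma gspan_sign_times:
  "a \<in> gspan X \<Longrightarrow> (- 1) ^ k * a \<in> (gspan X :: ('v::linorder, 'a::comm_ring_1) grassmann set)"
  by (cases "even k") (auto intro: gspan_uminus)

lemma gspan_times:
  fixes a b :: "('v::linorder, 'a::comm_ring_1) grassmann"
  assumes "a \<in> gspan X" "b \<in> gspan Y"
    and XY: "\<And>S T. S \<in> X \<Longrightarrow> T \<in> Y \<Longrightarrow> S \<union> T \<in> Z"
  shows "a * b \<in> gspan Z"
proof (rule gspanI)
  fix S assume "gcoeff (a * b) S \<noteq> 0"
  then obtain T where T: "T \<in> Pow S" "shuffle_sign T (S - T) * gcoeff a T * gcoeff b (S - T) \<noteq> 0"
    unfolding gcoeff_times by (rule sum.not_neutral_contains_not_neutral)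
  then have "gcoeff a T \<noteq> 0" "gcoeff b (S - T) \<noteq> 0" by auto
  then have "T \<in> X" "S - T \<in> Y" using assms(1,2) gspanD by metis+
  from XY[OF this] show "S \<in> Z" using T(1) by (simp add: Un_absorb1)
qed

lemma gspan_Pow_times:
  fixes a b :: "('v::linorder, 'a::comm_ring_1) grassmann"
  shows "a \<in> gspan (Pow A) \<Longrightarrow> b \<in> gspan (Pow A) \<Longrightarrow> a * b \<in> gspan (Pow A)"
  by (erule gspan_times) auto

lemma lacking_times_left:
  fixes a b :: "('v::linorder, 'a::comm_ring_1) grassmann"
  assumes "a \<in> gspan (Pow (- W))" "b \<in> lacking W"
  shows "a * b \<in> lacking W"
  by (rule gspan_times[OF assms]) auto

lemma lacking_times_right:
  fixes a b :: "('v::linorder, 'a::comm_ring_1) grassmann"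
  assumes "a \<in> lacking W" "b \<in> gspan (Pow (- W))"
  shows "a * b \<in> lacking W"
  by (rule gspan_times[OF assms]) auto

lemma gspan_Pow_prod_list:
  fixes xs :: "('v::linorder, 'a::comm_ring_1) grassmann list"
  assumes "\<And>x. x \<in> set xs \<Longrightarrow> x \<in> gspan (Pow A)"
  shows "prod_list xs \<in> gspan (Pow A)"
  using assms
proof (induction xs)
  case Nil
  then show ?case using gspan_gbasis[of "{}" "Pow A"] by simp
qed (simp add: gspan_Pow_times)

text \<open>
  On elements free of \<open>U\<close>, multiplication by \<open>gbasis U\<close> only shifts each index set by \<open>U\<close> and changes
  signs, so it can be undone on supports.
\<close>

lemma gspan_gbasis_cancel:
  fixes Q :: "('v::linorder, 'a::comm_ring_1) grassmann"
  assumes "finite U" "Q \<in> gspan (Pow (- U))" "gbasis U * Q \<in> gspan {S. U \<subseteq> S \<longrightarrow> S - U \<in> X}"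
  shows "Q \<in> gspan X"
proof (rule gspanI)
  fix S assume S: "gcoeff Q S \<noteq> 0"
  then have "S \<inter> U = {}" using gspanD[OF assms(2)] by blast
  then have d: "U \<union> S - U = S" by blast
  have "gcoeff Q S = shuffle_sign U S * gcoeff (gbasis U * Q) (U \<union> S)"
    by (simp add: gcoeff_gbasis_times[OF assms(1)] d)
  then have "gcoeff (gbasis U * Q) (U \<union> S) \<noteq> 0" using S by auto
  then show "S \<in> X" using gspanD[OF assms(3), of "U \<union> S"] d by auto
qed

lemma gmon_in_gspan: "S \<in> X \<Longrightarrow> gmon r m S \<in> gspan X"
  unfolding gmon_def by (intro gspan_scal_times gspan_gbasis)

lemma gspan_gmon_induct [consumes 1, case_names zero add gmon]:
  fixes w :: "'r::comm_ring_1 galg"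
  assumes "w \<in> gspan X" "P 0" and add: "\<And>a b. P a \<Longrightarrow> P b \<Longrightarrow> P (a + b)"
    and gmon: "\<And>r m S. finite S \<Longrightarrow> S \<in> X \<Longrightarrow> P (gmon r m S)"
  shows "P w"
proof -
  \<comment> \<open>stated for two index types, monomials in the polynomial variables and sets of Grassmann variables\<close>
  have P_sum: "P (sum h I)" if "\<And>i. i \<in> I \<Longrightarrow> P (h i)" for h :: "'i \<Rightarrow> 'r galg" and I
    using that by (induction I rule: infinite_finite_induct) (auto simp: assms(2) add)
  have P_sum': "P (sum h I)" if "\<And>i. i \<in> I \<Longrightarrow> P (h i)" for h :: "'j \<Rightarrow> 'r galg" and I
    using that by (induction I rule: infinite_finite_induct) (auto simp: assms(2) add)
  show ?thesis
    by (subst gmon_expand, intro P_sum P_sum' gmon)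
      (use assms(1) in \<open>auto simp: gspan_def intro: finite_in_gsupp\<close>)
qed

text \<open>
  A contraction over \<open>y\<close> is not linear over the polynomials in \<open>y\<close>. Therefore additive maps are
  compared on the monomials \<open>gmon r m S\<close>, in which the powers \<open>m\<close> of \<open>x\<close> and \<open>y\<close> are split off as well.
\<close>

lemma additive_eq_on_gspan:
  fixes G H :: "'r::comm_ring_1 galg \<Rightarrow> 'b::ab_group_add"
  assumes "additive G" "additive H" "w \<in> gspan X"
    and "\<And>r m S. finite S \<Longrightarrow> S \<in> X \<Longrightarrow> G (gmon r m S) = H (gmon r m S)"
  shows "G w = H w"
  using assms(3)
proof (induction rule: gspan_gmon_induct)
qed (simp_all add: assms additive.zero additive.add)

lemma additive_sign:
  assumes "additive (f :: 'a::ring_1 \<Rightarrow> 'b::ring_1)"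
  shows "f ((- 1) ^ k * x) = (- 1) ^ k * f x"
  by (cases "even k") (simp_all add: additive.minus[OF assms])

lemma sign_left_commute: "a * ((- 1) ^ k * b) = (- 1) ^ k * (a * b :: 'a::ring_1)"
  by (cases "even k") simp_all

lemma sign_times_sign: "((- 1) ^ k * a) * ((- 1) ^ l * b) = (- 1) ^ (k + l) * (a * b :: 'a::ring_1)"
  by (simp add: minus_one_power_iff)

lemma sign_cancel: "(- 1) ^ k * ((- 1) ^ k * a) = (a :: 'a::ring_1)"
  by (simp add: minus_one_power_iff)

lemma additive_times_left: "additive (\<lambda>w. a * w :: 'a::ring_1)"
  by unfold_locales (simp add: distrib_left)

lemma additive_times_right: "additive (\<lambda>w. w * a :: 'a::ring_1)"
  by unfold_locales (simp add: distrib_right)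

lemma additive_compose: "additive f \<Longrightarrow> additive g \<Longrightarrow> additive (\<lambda>w. f (g w))"
  by (simp add: additive_def)

section \<open>Signs of products of monomials\<close>

lemma shuffle_sign_sorted: "(\<And>a b. a \<in> S \<Longrightarrow> b \<in> T \<Longrightarrow> a < b) \<Longrightarrow> shuffle_sign S T = 1"
proof -
  assume "\<And>a b. a \<in> S \<Longrightarrow> b \<in> T \<Longrightarrow> a < b"
  then have "{(a, b). a \<in> S \<and> b \<in> T \<and> b < a} = {}" by (auto dest: less_asym)
  then show ?thesis unfolding shuffle_sign_def by (metis card.empty power_0)
qed

text \<open>
  The inversions of \<open>(S, T)\<close> and the flipped inversions of \<open>(T, S)\<close> together exhaust \<open>S \<times> T\<close>.
\<close>

lemma shuffle_sign_swap:
  assumes "finite S" "finite T" "S \<inter> T = {}"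
  shows "shuffle_sign S T = (- 1) ^ (card S * card T) * (shuffle_sign T S :: 'a::comm_ring_1)"
proof -
  let ?A = "{(a, b). a \<in> S \<and> b \<in> T \<and> b < a}" and ?B = "{(b, a). b \<in> T \<and> a \<in> S \<and> a < b}"
  have "S \<times> T = ?A \<union> prod.swap ` ?B"
  proof (intro set_eqI iffI)
    fix x assume "x \<in> S \<times> T"
    then obtain a b where x: "x = (a, b)" "a \<in> S" "b \<in> T" by auto
    then have "b < a \<or> a < b" using assms(3) by (metis disjoint_iff linorder_cases)
    then show "x \<in> ?A \<union> prod.swap ` ?B" using x by force
  qed auto
  moreover have "?A \<inter> prod.swap ` ?B = {}"
  proof (rule equals0I)
    fix x assume "x \<in> ?A \<inter> prod.swap ` ?B"
    then have "snd x < fst x" "fst x < snd x" by auto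
    then show False by (rule less_asym)
  qed
  moreover have "finite ?A" "finite (prod.swap ` ?B)"
    by (rule finite_inv[OF assms(1,2)], rule finite_imageI[OF finite_inv[OF assms(2,1)]])
  ultimately have "card (S \<times> T) = card ?A + card (prod.swap ` ?B)"
    by (simp only: card_Un_disjoint)
  also have "card (prod.swap ` ?B) = card ?B" by (rule card_image) simp
  finally have "(- 1) ^ (card S * card T) = (shuffle_sign S T * shuffle_sign T S :: 'a)"
    by (simp add: shuffle_sign_def card_cartesian_product power_add)
  then show ?thesis by (simp add: mult.assoc)
qed

lemma shuffle_sign_image:
  assumes "strict_mono_on A \<sigma>" "S \<subseteq> A" "T \<subseteq> A"
  shows "shuffle_sign (\<sigma> ` S) (\<sigma> ` T) = shuffle_sign S T"
proof -
  have "inj_on \<sigma> A" using assms(1) by (rule strict_mono_on_imp_inj_on)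
  then have "inj_on (map_prod \<sigma> \<sigma>) {(a, b). a \<in> S \<and> b \<in> T \<and> b < a}"
    using assms(2,3) by (auto simp: inj_on_def)
  moreover have "{(a, b). a \<in> \<sigma> ` S \<and> b \<in> \<sigma> ` T \<and> b < a} =
      map_prod \<sigma> \<sigma> ` {(a, b). a \<in> S \<and> b \<in> T \<and> b < a}"
  proof -
    have "\<sigma> b < \<sigma> a \<longleftrightarrow> b < a" if "a \<in> S" "b \<in> T" for a b
      using strict_mono_on_less[OF assms(1)] that assms(2,3) by blast
    then show ?thesis by (force simp: image_iff)
  qed
  ultimately show ?thesis unfolding shuffle_sign_def by (simp add: card_image)
qed

lemma gbasis_eq_gmon: "gbasis S = gmon 1 0 S"
  by (simp add: gmon_def single_one)

lemma gmon_mult_overlap: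
  assumes "finite S" "finite T" "S \<inter> T \<noteq> {}"
  shows "gmon a m S * gmon b k T = 0"
  using assms by (simp add: gmon_def mult.assoc scal_left_commute[of "gbasis S"] gbasis_mult)

lemma gmon_sign: "gmon ((- 1) ^ k * r) m S = (- 1) ^ k * gmon r m S"
  by (cases "even k") (simp_all add: gmon_def single_uminus scal_uminus)

lemma gmon_supercommute:
  fixes x :: "'r::comm_ring_1 galg"
  assumes "finite S" "x \<in> gspan {T. card T mod 2 = p mod 2}"
  shows "gmon r m S * x = (- 1) ^ (p * card S) * (x * gmon r m S)"
proof (rule additive_eq_on_gspan[OF _ _ assms(2)])
  show "additive ((*) (gmon r m S))" by (rule additive_times_left)
  show "additive (\<lambda>x. (- 1) ^ (p * card S) * (x * gmon r m S))"
    by (intro additive_compose[OF additive_times_left additive_times_right])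
  fix r' m' and T :: "gvar set" assume T: "finite T" "T \<in> {T. card T mod 2 = p mod 2}"
  show "gmon r m S * gmon r' m' T = (- 1) ^ (p * card S) * (gmon r' m' T * gmon r m S)"
  proof (cases "S \<inter> T = {}")
    case True
    have "even (card T) \<longleftrightarrow> even p" using T(2) by simp presburger
    then have "(- 1) ^ (p * card S) = ((- 1) ^ (card S * card T) :: 'r galg)"
      by (simp add: minus_one_power_iff)
    then show ?thesis
      using True assms(1) T(1)
      by (simp add: gmon_mult Int_commute shuffle_sign_swap[of S T] gmon_sign[symmetric]
          add.commute Un_commute ac_simps)
  qed (use assms(1) T(1) in \<open>simp add: gmon_mult_overlap Int_commute\<close>)
qed

section \<open>Order-preserving substitution of variables\<close>

lemma gsubst_superset:
  assumes "finite A" "gsupp w \<subseteq> A"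
  shows "gsubst \<sigma> w = (\<Sum>S\<in>A. scal (gcoeff w S) * prod_list (map (gen \<circ> \<sigma>) (sorted_list_of_set S)))"
  unfolding gsubst_def by (rule sum.mono_neutral_left) (use assms in \<open>auto simp: gsupp_def\<close>)

lemma additive_gsubst: "additive (gsubst \<sigma> :: ('v::linorder, 'a::comm_ring_1) grassmann \<Rightarrow> _)"
proof
  fix a b :: "('v, 'a) grassmann"
  have "gsupp (a + b) \<subseteq> gsupp a \<union> gsupp b" by (auto simp: gsupp_def)
  then show "gsubst \<sigma> (a + b) = gsubst \<sigma> a + gsubst \<sigma> b"
    by (simp add: gsubst_superset[of "gsupp a \<union> gsupp b"] scal_add distrib_right sum.distrib)
qed

lemma gsubst_scal_times: "gsubst \<sigma> (scal r * w) = scal r * gsubst \<sigma> w"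
proof -
  have "gsupp (scal r * w) \<subseteq> gsupp w" by (auto simp: gsupp_def)
  then show ?thesis
    by (simp add: gsubst_superset[of "gsupp w"] scal_mult sum_distrib_left mult.assoc)
qed

text \<open>
  An increasing substitution leaves the factors of a basis monomial in increasing order, hence no sign.
\<close>

lemma gsubst_gbasis:
  assumes "finite S" "strict_mono_on S \<sigma>"
  shows "gsubst \<sigma> (gbasis S) = gbasis (\<sigma> ` S)"
proof -
  have "sorted_wrt (<) (map \<sigma> (sorted_list_of_set S))"
    unfolding sorted_wrt_map
    by (rule sorted_wrt_mono_rel[OF _ strict_sorted_list_of_set])
      (use assms in \<open>auto intro: strict_mono_onD\<close>)
  from prod_list_gen[OF this] show ?thesis
    using assms(1)
    by (subst gsubst_superset[of "{S}"]) (auto simp: gsupp_def gcoeff_gbasis split: if_splits)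
qed

lemma gsubst_gmon:
  assumes "finite S" "strict_mono_on S \<sigma>"
  shows "gsubst \<sigma> (gmon r m S) = gmon r m (\<sigma> ` S)"
  unfolding gmon_def gsubst_scal_times gsubst_gbasis[OF assms] ..

lemma gsubst_times:
  fixes a b :: "'r::comm_ring_1 galg"
  assumes \<sigma>: "strict_mono_on A \<sigma>" and "a \<in> gspan (Pow A)" "b \<in> gspan (Pow A)"
  shows "gsubst \<sigma> (a * b) = gsubst \<sigma> a * gsubst \<sigma> b"
proof -
  note compose = additive_compose[OF additive_gsubst] additive_compose[OF _ additive_gsubst]
  have monomials: "gsubst \<sigma> (gmon r m S * gmon r' m' T) = gsubst \<sigma> (gmon r m S) * gsubst \<sigma> (gmon r' m' T)"
    if ST: "finite S" "finite T" "S \<subseteq> A" "T \<subseteq> A" for r r' :: 'r and m m' S T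
  proof -
    have mono: "strict_mono_on S \<sigma>" "strict_mono_on T \<sigma>" "strict_mono_on (S \<union> T) \<sigma>"
      using \<sigma> ST(3,4) by (auto intro: monotone_on_subset)
    have "\<sigma> ` S \<inter> \<sigma> ` T = \<sigma> ` (S \<inter> T)"
      using inj_on_image_Int[OF strict_mono_on_imp_inj_on[OF \<sigma>] ST(3,4)] by simp
    then show ?thesis
      using ST mono
      by (cases "S \<inter> T = {}")
        (simp_all add: gmon_mult gmon_mult_overlap gsubst_gmon shuffle_sign_image[OF \<sigma>] image_Un
          additive.zero[OF additive_gsubst])
  qed
  have "gsubst \<sigma> (gmon r m S * b) = gsubst \<sigma> (gmon r m S) * gsubst \<sigma> b"
    if "finite S" "S \<subseteq> A" for r :: 'r and m S
    by (rule additive_eq_on_gspan[OF _ _ assms(3)])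
      (use that monomials in \<open>auto intro!: compose additive_times_left\<close>)
  then show ?thesis
    by (intro additive_eq_on_gspan[OF _ _ assms(2), of "\<lambda>a. gsubst \<sigma> (a * b)"])
      (auto intro!: compose additive_times_right)
qed

lemma gsubst_prod_list:
  fixes xs :: "'r::comm_ring_1 galg list"
  assumes \<sigma>: "strict_mono_on A \<sigma>" and "\<And>x. x \<in> set xs \<Longrightarrow> x \<in> gspan (Pow A)"
  shows "gsubst \<sigma> (prod_list xs) = prod_list (map (gsubst \<sigma>) xs)"
  using assms(2)
proof (induction xs)
  case Nil
  show ?case using gsubst_gbasis[of "{}" \<sigma>] by (simp add: strict_mono_on_def)
next
  case (Cons x xs)
  then show ?case
    by (simp add: gsubst_times[OF \<sigma>] gspan_Pow_prod_list)
qed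

section \<open>The leading part of a determinant\<close>

text \<open>
  The product whose component of top degree in \<open>u\<close> defines the determinant.
\<close>

definition column_product :: "nat \<Rightarrow> ((nat \<Rightarrow> 'r::comm_ring_1 poly2) \<times> 'r galg) list \<Rightarrow> 'r galg" where
  "column_product n cs = prod_list (map (\<lambda>(h, w). (\<Sum>k=1..n. gen (VU k) * scal (h k)) + w) cs)"

lemma column_product_append: "column_product n (cs @ ds) = column_product n cs * column_product n ds"
  by (simp add: column_product_def)

lemma prod_list_VU: "prod_list (map (\<lambda>k. gen (VU k)) [1..<Suc n]) = (gbasis (VU ` {1..n}) :: 'r::comm_ring_1 galg)"
  using prod_list_collection[of VU n, where 'r = 'r]
  by (simp add: comp_def less_gvar_def less_eq_gvar_def del: upt_Suc)

lemma card_Int_VU: "card (S \<inter> VU ` {1..n}) = n \<longleftrightarrow> VU ` {1..n} \<subseteq> S"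
proof -
  have U: "finite (VU ` {1..n})" and c: "card (VU ` {1..n}) = n"
    by (simp_all add: card_image inj_on_def)
  show ?thesis
    using card_subset_eq[OF U, of "S \<inter> VU ` {1..n}"] c by (auto simp: Int_absorb1)
qed

text \<open>
  Modulo terms that lack some \<open>u\<^sub>k\<close>, taking the component of top degree in \<open>u\<close> is the identity. In this
  form the definition of the determinant is stable under multiplication by elements free of \<open>u\<close>, and
  by \<open>gdet_eqI\<close> it still determines the determinant.
\<close>

lemma gdet_top:
  fixes cs :: "((nat \<Rightarrow> 'r::comm_ring_1 poly2) \<times> 'r galg) list"
  shows "gdet n cs \<in> gspan (Pow (- VU ` {1..n}))"
    and "column_product n cs - gbasis (VU ` {1..n}) * gdet n cs \<in> lacking (VU ` {1..n})"
proof -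
  note * = theI'[OF gdet_unique[of n "column_product n cs"], unfolded column_product_def,
      folded gdet_def, folded column_product_def, unfolded prod_list_VU]
  show "gdet n cs \<in> gspan (Pow (- VU ` {1..n}))"
    using * by (auto simp: gspan_def)
  have "gbasis (VU ` {1..n}) * gdet n cs = gfilter (\<lambda>S. VU ` {1..n} \<subseteq> S) (column_product n cs)"
    using * unfolding card_Int_VU by blast
  then show "column_product n cs - gbasis (VU ` {1..n}) * gdet n cs \<in> lacking (VU ` {1..n})"
    by (intro gspanI) (simp add: gcoeff_gfilter split: if_splits)
qed

lemma gdet_eqI:
  fixes cs :: "((nat \<Rightarrow> 'r::comm_ring_1 poly2) \<times> 'r galg) list"
  assumes Q: "Q \<in> gspan (Pow (- VU ` {1..n}))"
    and top: "column_product n cs - gbasis (VU ` {1..n}) * Q \<in> lacking (VU ` {1..n})"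
  shows "gdet n cs = Q"
proof -
  let ?U = "VU ` {1..n}"
  let ?d = "gdet n cs - Q"
  have "gbasis ?U * ?d = (column_product n cs - gbasis ?U * Q) - (column_product n cs - gbasis ?U * gdet n cs)"
    by (simp add: right_diff_distrib)
  also have "\<dots> \<in> lacking ?U" by (intro gspan_diff top gdet_top)
  finally have "gbasis ?U * ?d \<in> gspan {S. ?U \<subseteq> S \<longrightarrow> S - ?U \<in> {}}" by simp
  then have "?d \<in> gspan {}"
    by (rule gspan_gbasis_cancel[rotated 2]) (simp, intro gspan_diff Q gdet_top)
  then have "?d = 0" by (intro grassmann_eqI) (simp only: gspanD empty_iff not_False_eq_True gcoeff_0)
  then show ?thesis by simp
qed

lemma gdet_in_gspan:
  fixes cs :: "((nat \<Rightarrow> 'r::comm_ring_1 poly2) \<times> 'r galg) list"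
  assumes z: "column_product n cs \<in> gspan (Pow A)"
  shows "gdet n cs \<in> gspan (Pow (A - VU ` {1..n}))"
proof (rule gspan_gbasis_cancel[OF _ gdet_top(1)])
  let ?U = "VU ` {1..n}"
  have "gbasis ?U * gdet n cs = column_product n cs - (column_product n cs - gbasis ?U * gdet n cs)"
    by simp
  also have "\<dots> \<in> gspan {S. ?U \<subseteq> S \<longrightarrow> S - ?U \<in> Pow (A - ?U)}"
    by (rule gspan_diff) (rule gspan_mono[OF z], blast, rule gspan_mono[OF gdet_top(2)], blast)
  finally show "gbasis ?U * gdet n cs \<in> gspan {S. ?U \<subseteq> S \<longrightarrow> S - ?U \<in> Pow (A - ?U)}" .
qed simp

text \<open>
  A congruence modulo \<open>lacking W\<close> between elements free of \<open>u\<close> may be tested after multiplication by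
  \<open>u\<^sub>1 \<dots> u\<^sub>n\<close> and up to terms that lack some \<open>u\<^sub>k\<close>.
\<close>

lemma gdet_cancel:
  fixes X :: "'r::comm_ring_1 galg"
  assumes "X \<in> gspan (Pow (- VU ` {1..n}))"
    and "gbasis (VU ` {1..n}) * X = Y + Z" "Y \<in> lacking (VU ` {1..n})" "Z \<in> lacking W"
  shows "X \<in> lacking W"
proof (rule gspan_gbasis_cancel[OF _ assms(1)])
  show "gbasis (VU ` {1..n}) * X \<in>
      gspan {S. VU ` {1..n} \<subseteq> S \<longrightarrow> S - VU ` {1..n} \<in> {S. \<not> W \<subseteq> S}}"
    unfolding assms(2)
    by (intro gspan_add) (rule gspan_mono[OF assms(3)], blast, rule gspan_mono[OF assms(4)], blast)
qed simp

text \<open>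
  If the product over the last columns has leading part \<open>(-1)\<^sup>k gbasis W\<close>, the remaining columns alone
  must supply the full monomial in \<open>u\<close>, which is their determinant. No sign arises, because
  \<open>gbasis W\<close> stands on the right of the variables \<open>u\<close>.
\<close>

lemma gdet_append_right:
  fixes cs ds :: "((nat \<Rightarrow> 'r::comm_ring_1 poly2) \<times> 'r galg) list"
  assumes W: "W \<inter> VU ` {1..n} = {}"
    and cs: "column_product n cs \<in> gspan (Pow (- W))"
    and ds: "column_product n ds - (- 1) ^ k * gbasis W \<in> lacking W"
  shows "gdet n (cs @ ds) - (- 1) ^ k * (gdet n cs * gbasis W) \<in> lacking W"
proof (rule gdet_cancel)
  let ?U = "VU ` {1..n}" and ?z = "column_product n cs" and ?z' = "column_product n ds"
  have WU: "gbasis W \<in> gspan (Pow (- ?U))" using W by (intro gspan_gbasis) auto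
  show "gdet n (cs @ ds) - (- 1) ^ k * (gdet n cs * gbasis W) \<in> gspan (Pow (- ?U))"
    by (intro gspan_diff gspan_sign_times gspan_Pow_times gdet_top WU)
  show "gbasis ?U * (gdet n (cs @ ds) - (- 1) ^ k * (gdet n cs * gbasis W)) =
      ((- 1) ^ k * ((?z - gbasis ?U * gdet n cs) * gbasis W)
        - (column_product n (cs @ ds) - gbasis ?U * gdet n (cs @ ds)))
      + ?z * (?z' - (- 1) ^ k * gbasis W)"
    unfolding column_product_append
    by (simp add: left_diff_distrib right_diff_distrib sign_left_commute mult.assoc)
  show "(- 1) ^ k * ((?z - gbasis ?U * gdet n cs) * gbasis W)
        - (column_product n (cs @ ds) - gbasis ?U * gdet n (cs @ ds)) \<in> lacking ?U"
    by (intro gspan_diff gspan_sign_times lacking_times_right gdet_top WU)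
  show "?z * (?z' - (- 1) ^ k * gbasis W) \<in> lacking W"
    by (intro lacking_times_left cs ds)
qed

lemma gbasis_VU_commute:
  assumes "finite W" "W \<inter> VU ` {1..n} = {}"
  shows "gbasis (VU ` {1..n}) * gbasis W = (- 1) ^ (n * card W) * (gbasis W * gbasis (VU ` {1..n}) :: 'r::comm_ring_1 galg)"
  using assms gmon_supercommute[of "VU ` {1..n}" "gbasis W" "card W" 1 0]
  by (simp add: gbasis_eq_gmon[symmetric] gspan_gbasis card_image inj_on_def mult.commute)

text \<open>
  Here \<open>gbasis W\<close> stands on the left and has to be moved past \<open>u\<^sub>1 \<dots> u\<^sub>n\<close>.
\<close>

lemma gdet_append_left:
  fixes cs ds :: "((nat \<Rightarrow> 'r::comm_ring_1 poly2) \<times> 'r galg) list"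
  assumes fin: "finite W" and W: "W \<inter> VU ` {1..n} = {}"
    and cs: "column_product n cs - gbasis W \<in> lacking W"
    and ds: "column_product n ds \<in> gspan (Pow (- W))"
  shows "gdet n (cs @ ds) - (- 1) ^ (n * card W) * (gbasis W * gdet n ds) \<in> lacking W"
proof (rule gdet_cancel)
  let ?U = "VU ` {1..n}" and ?z = "column_product n cs" and ?z' = "column_product n ds"
  have WU: "gbasis W \<in> gspan (Pow (- ?U))" using W by (intro gspan_gbasis) auto
  show "gdet n (cs @ ds) - (- 1) ^ (n * card W) * (gbasis W * gdet n ds) \<in> gspan (Pow (- ?U))"
    by (intro gspan_diff gspan_sign_times gspan_Pow_times gdet_top WU)
  have "gbasis ?U * ((- 1) ^ (n * card W) * (gbasis W * gdet n ds)) =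
      (- 1) ^ (n * card W) * ((gbasis ?U * gbasis W) * gdet n ds)"
    by (simp add: sign_left_commute mult.assoc)
  also have "\<dots> = gbasis W * (gbasis ?U * gdet n ds)"
    unfolding gbasis_VU_commute[OF fin W] by (simp add: mult.assoc minus_one_power_iff)
  finally show "gbasis ?U * (gdet n (cs @ ds) - (- 1) ^ (n * card W) * (gbasis W * gdet n ds)) =
      (gbasis W * (?z' - gbasis ?U * gdet n ds)
        - (column_product n (cs @ ds) - gbasis ?U * gdet n (cs @ ds)))
      + (?z - gbasis W) * ?z'"
    by (simp add: column_product_append algebra_simps)
  show "gbasis W * (?z' - gbasis ?U * gdet n ds)
        - (column_product n (cs @ ds) - gbasis ?U * gdet n (cs @ ds)) \<in> lacking ?U"
    by (intro gspan_diff lacking_times_left gdet_top WU)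
  show "(?z - gbasis W) * ?z' \<in> lacking W"
    by (intro lacking_times_right cs ds)
qed

text \<open>
  Only the choice of the variable \<open>v i\<close> in every factor produces the full monomial in the \<open>v i\<close>.
\<close>

lemma prod_linear_factors:
  fixes a :: "nat \<Rightarrow> 'r::comm_ring_1 galg"
  assumes v: "\<And>i j. i < j \<Longrightarrow> v i < v j" and A: "\<And>i. v i \<notin> A"
    and a: "\<And>i. a i \<in> gspan (Pow A)"
  shows "prod_list (map (\<lambda>i. a i + (- 1) ^ e * gen (v i)) [1..<Suc m])
    - (- 1) ^ (e * m) * gbasis (v ` {1..m}) \<in> lacking (v ` {1..m})"
proof (induction m)
  case 0
  show ?case by (simp add: gspan_0)
next
  case (Suc m)
  let ?Z = "\<lambda>m. prod_list (map (\<lambda>i. a i + (- 1) ^ e * gen (v i)) [1..<Suc m])"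
  let ?V = "v ` {1..m}" and ?y = "v (Suc m)"
  have V': "v ` {1..Suc m} = insert ?y ?V" by (simp add: atLeastAtMostSuc_conv)
  have yV: "?y \<notin> ?V"
  proof
    assume "?y \<in> ?V"
    then obtain j where "?y = v j" "j \<in> {1..m}" by (rule imageE)
    then show False using v[of j "Suc m"] by simp
  qed
  have e: "gbasis ?V * gen ?y = (gbasis (insert ?y ?V) :: 'r galg)"
  proof -
    have "shuffle_sign ?V {?y} = (1 :: 'r poly2)" by (rule shuffle_sign_sorted) (use v in auto)
    then show ?thesis using yV by (simp add: gbasis_mult)
  qed
  have Z: "?Z m \<in> gspan (Pow (A \<union> ?V))"
    by (rule gspan_Pow_prod_list)
      (auto intro!: gspan_add gspan_sign_times gspan_gbasis intro: gspan_mono[OF a])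
  have Z_Suc: "?Z (Suc m) = ?Z m * a (Suc m) + (- 1) ^ e * (?Z m * gen ?y)"
    by (simp add: distrib_left sign_left_commute)
  have sign: "(- 1) ^ (e * Suc m) = ((- 1) ^ e * (- 1) ^ (e * m) :: 'r galg)"
    by (simp add: power_add)
  \<comment> \<open>the first summand does not contain \<open>?y\<close>, the second lacks one of the earlier variables\<close>
  have "?Z (Suc m) - (- 1) ^ (e * Suc m) * gbasis (insert ?y ?V) =
      ?Z m * a (Suc m) + (- 1) ^ e * ((?Z m - (- 1) ^ (e * m) * gbasis ?V) * gen ?y)"
    unfolding Z_Suc sign e[symmetric]
    by (simp only: left_diff_distrib right_diff_distrib mult.assoc add_diff_eq)
  also have "\<dots> \<in> lacking (insert ?y ?V)"
  proof (rule gspan_add)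
    have "?Z m * a (Suc m) \<in> gspan (Pow (A \<union> ?V))"
      by (intro gspan_Pow_times Z) (rule gspan_mono[OF a], auto)
    then show "?Z m * a (Suc m) \<in> lacking (insert ?y ?V)"
      by (rule gspan_mono) (use A yV in auto)
    have "(?Z m - (- 1) ^ (e * m) * gbasis ?V) * gen ?y \<in> lacking ?V"
      by (rule lacking_times_right[OF Suc.IH]) (use yV in \<open>auto intro: gspan_gbasis\<close>)
    then show "(- 1) ^ e * ((?Z m - (- 1) ^ (e * m) * gbasis ?V) * gen ?y) \<in> lacking (insert ?y ?V)"
      by (intro gspan_sign_times) (erule gspan_mono, auto)
  qed
  finally show ?case unfolding V' .
qed

text \<open>
  A renaming that fixes the variables \<open>u\<close> and maps no other variable to one of them respects the
  characterisation of the determinant by \<open>gdet_top\<close>.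
\<close>

lemma gdet_gsubst:
  fixes cs ds :: "((nat \<Rightarrow> 'r::comm_ring_1 poly2) \<times> 'r galg) list"
  assumes \<sigma>: "strict_mono_on A \<sigma>" and U: "VU ` {1..n} \<subseteq> A"
    and fixed: "\<And>z. z \<in> VU ` {1..n} \<Longrightarrow> \<sigma> z = z"
    and avoid: "\<And>z. z \<in> A - VU ` {1..n} \<Longrightarrow> \<sigma> z \<notin> VU ` {1..n}"
    and cs: "column_product n cs \<in> gspan (Pow A)"
    and ds: "gsubst \<sigma> (column_product n cs) = column_product n ds"
  shows "gsubst \<sigma> (gdet n cs) = gdet n ds"
proof (rule gdet_eqI[symmetric])
  let ?U = "VU ` {1..n}" and ?z = "column_product n cs" and ?Q = "gdet n cs"
  have image: "gsubst \<sigma> w \<in> gspan Y"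
    if "w \<in> gspan X" "\<And>S. S \<in> X \<Longrightarrow> S \<subseteq> A \<and> \<sigma> ` S \<in> Y" for w :: "'r galg" and X Y
    using that(1)
  proof (induction rule: gspan_gmon_induct)
    case (gmon r m S)
    then show ?case using that(2)[of S] monotone_on_subset[OF \<sigma>]
      by (simp add: gsubst_gmon gmon_in_gspan)
  qed (simp_all add: additive.zero[OF additive_gsubst] additive.add[OF additive_gsubst] gspan_0 gspan_add)
  have Q: "?Q \<in> gspan (Pow (A - ?U))" by (rule gdet_in_gspan[OF cs])
  show "gsubst \<sigma> ?Q \<in> gspan (Pow (- ?U))"
    by (rule image[OF Q]) (use avoid in auto)
  have QA: "?Q \<in> gspan (Pow A)" and UA: "gbasis ?U \<in> gspan (Pow A)"
    by (rule gspan_mono[OF Q], blast, rule gspan_gbasis, use U in blast)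
  have "?z - gbasis ?U * ?Q \<in> gspan ({S. \<not> ?U \<subseteq> S} \<inter> Pow A)"
    by (intro gspan_Int gdet_top gspan_diff cs gspan_Pow_times QA UA)
  then have "gsubst \<sigma> (?z - gbasis ?U * ?Q) \<in> lacking ?U"
  proof (rule image)
    fix S assume S: "S \<in> {S. \<not> ?U \<subseteq> S} \<inter> Pow A"
    \<comment> \<open>only the variables \<open>u\<close> themselves are mapped to variables \<open>u\<close>\<close>
    have "?U \<subseteq> S" if "?U \<subseteq> \<sigma> ` S"
    proof
      fix u assume u: "u \<in> ?U"
      with that obtain z where z: "z \<in> S" "u = \<sigma> z" by blast
      then have "z \<in> ?U" using avoid[of z] S u by blast
      then show "u \<in> S" using fixed z by simp
    qed
    then show "S \<subseteq> A \<and> \<sigma> ` S \<in> {S. \<not> ?U \<subseteq> S}" using S by blast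
  qed
  moreover have "gsubst \<sigma> (gbasis ?U) = (gbasis ?U :: 'r galg)"
  proof -
    have "\<sigma> ` ?U = id ` ?U" by (rule image_cong) (use fixed in simp_all)
    then show ?thesis using gsubst_gbasis[OF _ monotone_on_subset[OF \<sigma> U]] by simp
  qed
  ultimately show "column_product n ds - gbasis ?U * gsubst \<sigma> ?Q \<in> lacking ?U"
    by (simp only: additive.diff[OF additive_gsubst] ds gsubst_times[OF \<sigma> UA QA])
qed

lemma column_product_columns:
  "column_product n (columns nabla H v w m) = prod_list (map (\<lambda>j.
    (\<Sum>k=1..n. gen (VU k) * scal (nabla (H j) k)) + (gen (v j) - gen (w j))) [1..<Suc m])"
  by (simp add: column_product_def columns_def comp_def del: upt_Suc)

lemma column_product_columns_in_gspan:
  "column_product n (columns nabla H v w m) \<in> gspan (Pow (VU ` {1..n} \<union> v ` {1..m} \<union> w ` {1..m}))"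
  unfolding column_product_columns
  by (rule gspan_Pow_prod_list)
    (auto intro!: gspan_add gspan_diff gspan_sum gspan_times_scal gspan_gbasis)

lemma gdet_columns_in_gspan:
  assumes "range v \<inter> range VU = {}" "range w \<inter> range VU = {}"
  shows "gdet n (columns nabla H v w m) \<in> gspan (Pow (v ` {1..m} \<union> w ` {1..m}))"
  by (rule gspan_mono[OF gdet_in_gspan[OF column_product_columns_in_gspan]]) (use assms in auto)

lemma gsubst_gdet_columns:
  assumes \<sigma>: "strict_mono_on (VU ` {1..n} \<union> v ` {1..m} \<union> w ` {1..m}) \<sigma>"
    and fixed: "\<And>k. \<sigma> (VU k) = VU k"
    and image: "\<And>j. j \<in> {1..m} \<Longrightarrow> \<sigma> (v j) = v' j" "\<And>j. j \<in> {1..m} \<Longrightarrow> \<sigma> (w j) = w' j"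
    and avoid: "range v' \<inter> range VU = {}" "range w' \<inter> range VU = {}"
  shows "gsubst \<sigma> (gdet n (columns nabla H v w m)) = gdet n (columns nabla H v' w' m)"
proof (rule gdet_gsubst[OF \<sigma>])
  show "gsubst \<sigma> (column_product n (columns nabla H v w m)) = column_product n (columns nabla H v' w' m)"
  proof -
    have gen: "gsubst \<sigma> (gen z) = (gen (\<sigma> z) :: 'a galg)" for z
      using gsubst_gbasis[of "{z}" \<sigma>] by (simp add: strict_mono_on_def)
    have col: "gsubst \<sigma> ((\<Sum>k=1..n. gen (VU k) * scal (nabla (H j) k)) + (gen (v j) - gen (w j))) =
        (\<Sum>k=1..n. gen (VU k) * scal (nabla (H j) k)) + (gen (v' j) - gen (w' j))" if "j \<in> {1..m}" for j
      by (simp only: additive.add[OF additive_gsubst] additive.diff[OF additive_gsubst]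
          additive.sum[OF additive_gsubst] scal_commute gsubst_scal_times gen fixed image[OF that])
    show ?thesis
      unfolding column_product_columns
      by (subst gsubst_prod_list[OF \<sigma>])
        (auto intro!: gspan_add gspan_diff gspan_sum gspan_times_scal gspan_gbasis
          arg_cong[where f = prod_list] simp: col simp del: upt_Suc One_nat_def)
  qed
  show "\<sigma> z \<notin> VU ` {1..n}" if "z \<in> VU ` {1..n} \<union> v ` {1..m} \<union> w ` {1..m} - VU ` {1..n}" for z
    using that image avoid by auto blast+
qed (use fixed column_product_columns_in_gspan in auto)

lemma column_product_columns_lower_leading:
  assumes "\<And>i j. i < j \<Longrightarrow> w i < w j" and disj: "range w \<inter> (range VU \<union> range v) = {}"
  shows "column_product n (columns nabla H v w m) - (- 1) ^ m * gbasis (w ` {1..m}) \<in> lacking (w ` {1..m})"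
proof -
  have "prod_list (map (\<lambda>j. ((\<Sum>k=1..n. gen (VU k) * scal (nabla (H j) k)) + gen (v j)) + (- 1) ^ 1 * gen (w j)) [1..<Suc m])
    - (- 1) ^ (1 * m) * gbasis (w ` {1..m}) \<in> lacking (w ` {1..m})"
    by (rule prod_linear_factors[OF assms(1), of _ "range VU \<union> range v"])
      (use disj in \<open>auto intro!: gspan_add gspan_sum gspan_times_scal gspan_gbasis\<close>)
  then show ?thesis
    unfolding column_product_columns by (simp del: upt_Suc add: add_diff_eq)
qed

lemma column_product_columns_upper_leading:
  assumes "\<And>i j. i < j \<Longrightarrow> v i < v j" and disj: "range v \<inter> (range VU \<union> range w) = {}"
  shows "column_product n (columns nabla H v w m) - gbasis (v ` {1..m}) \<in> lacking (v ` {1..m})"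
proof -
  have "prod_list (map (\<lambda>j. ((\<Sum>k=1..n. gen (VU k) * scal (nabla (H j) k)) - gen (w j)) + (- 1) ^ 0 * gen (v j)) [1..<Suc m])
    - (- 1) ^ (0 * m) * gbasis (v ` {1..m}) \<in> lacking (v ` {1..m})"
    by (rule prod_linear_factors[OF assms(1), of _ "range VU \<union> range w"])
      (use disj in \<open>auto intro!: gspan_diff gspan_sum gspan_times_scal gspan_gbasis\<close>)
  then show ?thesis
    unfolding column_product_columns by (simp del: upt_Suc add: algebra_simps)
qed

section \<open>Contractions of monomials\<close>

lemma mon_restrict_empty: "mon_restrict {} m = 0"
  by (rule mon_restrict_0) simp

lemma mon_restrict_UNIV: "mon_restrict UNIV m = m"
  by (rule mon_restrict_id) simp

lemma keys_mon_restrict: "Poly_Mapping.keys (mon_restrict P m) \<subseteq> P"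
  by (auto simp: in_keys_iff lookup_mon_restrict split: if_splits)

lemma hcomp_0: "hcomp p 0 = (0 :: ('v, 'a::ab_group_add) grassmann)"
  by (rule grassmann_eqI) (simp add: gcoeff_hcomp)

lemma hcomp_mod: "hcomp (p mod 2) = hcomp p"
  by (simp add: hcomp_def)

lemma hcomp_cong: "p mod 2 = q mod 2 \<Longrightarrow> hcomp p = hcomp q"
  by (metis hcomp_mod)

lemma hcomp_add: "hcomp p (a + b) = hcomp p a + hcomp p (b :: ('v, 'a::ab_group_add) grassmann)"
  by (rule grassmann_eqI) (simp add: gcoeff_hcomp)

lemma additive_hcomp: "additive (hcomp p :: ('v, 'a::ab_group_add) grassmann \<Rightarrow> _)"
  by unfold_locales (rule hcomp_add)

lemma hcomp_hcomp: "hcomp p (hcomp q w) = (if p mod 2 = q mod 2 then hcomp q w else 0 :: ('v, 'a::ab_group_add) grassmann)"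
  by (rule grassmann_eqI) (simp add: gcoeff_hcomp)

lemma hcomp_gmon: "hcomp p (gmon r m S) = (if card S mod 2 = p mod 2 then gmon r m S else 0)"
  by (rule grassmann_eqI) (simp add: gcoeff_hcomp gmon_def gcoeff_gbasis)

lemma hcomp_split: "hcomp p w + hcomp (Suc p) w = (w :: ('v, 'a::ab_group_add) grassmann)"
  by (rule grassmann_eqI) (auto simp: gcoeff_hcomp mod_Suc)

lemma hcomp_in_gspan: "hcomp p w \<in> gspan {T. card T mod 2 = p mod 2}"
  by (rule gspanI) (simp add: gcoeff_hcomp split: if_splits)

lemma parity_part_gmon:
  assumes "\<phi> 0 = 0"
  shows "parity_part p \<phi> (gmon r m S) = hcomp (p + card S) (\<phi> (gmon r m S))"
proof -
  have "parity_part p \<phi> (gmon r m S) = hcomp (p + card S mod 2) (\<phi> (gmon r m S))"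
    by (cases "even (card S)")
      (auto simp: parity_part_def hcomp_gmon assms hcomp_0 even_iff_mod_2_eq_zero odd_iff_mod_2_eq_one)
  also have "\<dots> = hcomp (p + card S) (\<phi> (gmon r m S))"
    by (rule arg_cong[where f = "\<lambda>h. h _"], rule hcomp_cong) presburger
  finally show ?thesis .
qed

lemma additive_contract_left: "additive (contract_left P V \<phi>)"
  by unfold_locales (simp add: contract_left_def extend_add)

lemma additive_contract_right: "additive (\<lambda>w. contract_right P V w \<phi>)"
  by unfold_locales (simp add: contract_right_def hcomp_add extend_add distrib_left)

text \<open>
  When the functional is written first, parameters simply stand on the right of its value: the sign in
  the extension of \<open>\<phi>\<close> to a parameter \<open>\<theta>\<close> on the left is the one of commuting \<open>\<theta>\<close> past the
  functional, and commuting \<open>\<theta>\<close> past the argument and the value undoes it. Therefore no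
  parity of \<open>\<phi>\<close> enters, and the two parity components recombine.
\<close>

lemma contract_left_gmon:
  assumes S: "finite S" and \<phi>: "\<phi> 0 = 0"
  shows "contract_left P V \<phi> (gmon r m S) =
    \<phi> (gmon 1 (mon_restrict P m) (S \<inter> V)) *
      gmon (shuffle_sign (S \<inter> V) (S - V) * r) (mon_restrict (- P) m) (S - V)"
proof -
  let ?x = "\<phi> (gmon 1 (mon_restrict P m) (S \<inter> V))"
  let ?c = "card (S - V)" and ?d = "card (S \<inter> V)"
  define \<theta> where "\<theta> = gmon (shuffle_sign (S - V) (S \<inter> V) * r) (mon_restrict (- P) m) (S - V)"
  have comm: "\<theta> * hcomp j ?x = (- 1) ^ (j * ?c) * (hcomp j ?x * \<theta>)" for j
    unfolding \<theta>_def using S by (intro gmon_supercommute hcomp_in_gspan) simp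
  have "extend p P V (parity_part p \<phi>) (gmon r m S) = (- 1) ^ (?d * ?c) * (hcomp (p + ?d) ?x * \<theta>)" for p
  proof -
    have "extend p P V (parity_part p \<phi>) (gmon r m S) = (- 1) ^ (p * ?c) * (\<theta> * hcomp (p + ?d) ?x)"
      using S by (simp add: extend_gmon extend_term_def parity_part_gmon[of \<phi>, OF \<phi>] \<theta>_def mult.assoc)
    also have "\<dots> = (- 1) ^ (p * ?c + (p + ?d) * ?c) * (hcomp (p + ?d) ?x * \<theta>)"
      unfolding comm by (simp only: power_add mult.assoc)
    \<comment> \<open>the exponent is \<open>2 p ?c + ?d ?c\<close>, so \<open>p\<close> drops out\<close>
    also have "(- 1) ^ (p * ?c + (p + ?d) * ?c) = ((- 1) ^ (?d * ?c) :: 'a galg)"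
      by (simp add: minus_one_power_iff)
    finally show ?thesis .
  qed
  then have "contract_left P V \<phi> (gmon r m S) =
      (- 1) ^ (?d * ?c) * ((hcomp ?d ?x + hcomp (Suc ?d) ?x) * \<theta>)"
    by (simp add: contract_left_def distrib_left distrib_right)
  also have "\<dots> = ?x * ((- 1) ^ (?d * ?c) * \<theta>)"
    unfolding hcomp_split sign_left_commute ..
  also have "(- 1) ^ (?d * ?c) * \<theta> =
      gmon (shuffle_sign (S \<inter> V) (S - V) * r) (mon_restrict (- P) m) (S - V)"
  proof -
    have "shuffle_sign (S \<inter> V) (S - V) = (- 1) ^ (?d * ?c) * (shuffle_sign (S - V) (S \<inter> V) :: 'a)"
      using S by (intro shuffle_sign_swap) auto
    then show ?thesis unfolding \<theta>_def by (simp only: gmon_sign[symmetric] mult.assoc)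
  qed
  finally show ?thesis .
qed

text \<open>
  When the function is written first, parameters stay on the left. The functional sends a monomial of
  parity \<open>d = card (S \<inter> V)\<close> to an element of parity \<open>b\<close>, so it acts with parity \<open>b + d\<close>; the part of
  the sign that involves the parameters cancels and \<open>(-1)\<^bsup>(b + d) d\<^esup>\<close> remains.
\<close>

lemma contract_right_gmon:
  assumes S: "finite S" and \<phi>: "\<phi> 0 = 0"
    and b: "hcomp b (\<phi> (gmon 1 (mon_restrict P m) (S \<inter> V))) = \<phi> (gmon 1 (mon_restrict P m) (S \<inter> V))"
  shows "contract_right P V (gmon r m S) \<phi> =
    (- 1) ^ ((b + card (S \<inter> V)) * card (S \<inter> V)) *
      (gmon (shuffle_sign (S - V) (S \<inter> V) * r) (mon_restrict (- P) m) (S - V) *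
        \<phi> (gmon 1 (mon_restrict P m) (S \<inter> V)))"
proof -
  let ?x = "\<phi> (gmon 1 (mon_restrict P m) (S \<inter> V))"
  let ?c = "card (S - V)" and ?d = "card (S \<inter> V)"
  define \<theta> where "\<theta> = gmon (shuffle_sign (S - V) (S \<inter> V) * r) (mon_restrict (- P) m) (S - V)"
  have cS: "card S = ?c + ?d"
    using card_Int_Diff[OF S, of V] by simp
  \<comment> \<open>only the component of \<open>\<phi>\<close> of parity \<open>b + ?d\<close> contributes\<close>
  have ext: "extend p P V (parity_part p \<phi>) (gmon r m S) =
      (if even (p + ?d + b) then (- 1) ^ (p * ?c) * (\<theta> * ?x) else 0)" for p
  proof -
    have "hcomp (p + ?d) ?x = (if even (p + ?d + b) then ?x else 0)"
    proof -
      have "(p + ?d) mod 2 = b mod 2 \<longleftrightarrow> even (p + ?d + b)" by presburger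
      then have "hcomp (p + ?d) (hcomp b ?x) = (if even (p + ?d + b) then hcomp b ?x else 0)"
        unfolding hcomp_hcomp by simp
      then show ?thesis unfolding b .
    qed
    then show ?thesis
      using S by (simp add: extend_gmon extend_term_def parity_part_gmon[of \<phi>, OF \<phi>] \<theta>_def mult.assoc)
  qed
  have "contract_right P V (gmon r m S) \<phi> =
      (\<Sum>p\<in>{0, 1}. (- 1) ^ (p * card S) * extend p P V (parity_part p \<phi>) (gmon r m S))"
    by (cases "even (card S)")
      (auto simp: contract_right_def hcomp_gmon extend_0 even_iff_mod_2_eq_zero odd_iff_mod_2_eq_one)
  also have "\<dots> = (- 1) ^ ((b + ?d) * ?d) * (\<theta> * ?x)"
    unfolding ext by (auto simp: cS minus_one_power_iff)
  finally show ?thesis unfolding \<theta>_def .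
qed

lemma det_star_gmon:
  assumes S: "finite S"
  shows "det_star v m (gmon r k S) =
    (if v ` {1..m} \<subseteq> S then gmon (shuffle_sign (v ` {1..m}) (S - v ` {1..m}) * r) k (S - v ` {1..m}) else 0)"
proof -
  let ?V = "v ` {1..m}"
  have "gcoeff (gmon 1 0 (S \<inter> ?V)) ?V = (if ?V \<subseteq> S then 1 else 0 :: 'a poly2)"
    using S by (auto simp: gmon_def gcoeff_gbasis single_one)
  moreover have "S \<inter> ?V = ?V" if "?V \<subseteq> S" using that by blast
  ultimately show ?thesis
    unfolding det_star_def by (simp add: contract_left_gmon[OF S] mon_restrict_empty mon_restrict_UNIV)
qed

section \<open>Contraction against a functional that kills all but a top monomial\<close>

text \<open>
  The hypothesis \<open>top\<close> says that \<open>\<phi>\<close> strips the full monomial in \<open>W\<close> from the left of its argument and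
  then acts as \<open>\<psi>\<close>; its sign is \<open>(-1)\<^bsup>card W * p\<^esup>\<close>, where \<open>p = b T + card T\<close> is the parity with which
  \<open>\<psi>\<close> acts. In \<open>Q\<close> the monomial stands on the right of \<open>\<theta>\<close>. The sign for moving it to the left
  combines with the signs of the two contractions to \<open>(-1)\<^bsup>card W\<^esup>\<close>, which cancels the sign in \<open>lead\<close>.
\<close>

lemma contract_right_through_top:
  fixes \<phi> \<psi> :: "'r::comm_ring_1 galg \<Rightarrow> 'r galg"
  assumes W: "finite W" and less: "\<And>a b. a \<in> W \<Longrightarrow> b \<in> V \<Longrightarrow> a < b"
    and \<phi>: "\<phi> 0 = 0" and \<psi>: "\<psi> 0 = 0"
    and lead: "Q - (- 1) ^ card W * (\<theta> * gbasis W) \<in> lacking W" and \<theta>: "\<theta> \<in> gspan (Pow (- W))"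
    and vanish: "\<And>m T. finite T \<Longrightarrow> Poly_Mapping.keys m \<subseteq> P \<Longrightarrow> T \<subseteq> W \<union> V \<Longrightarrow> \<not> W \<subseteq> T \<Longrightarrow>
      \<phi> (gmon 1 m T) = 0"
    and top: "\<And>m T. finite T \<Longrightarrow> Poly_Mapping.keys m \<subseteq> P \<Longrightarrow> T \<subseteq> V \<Longrightarrow>
      \<phi> (gmon 1 m (W \<union> T)) = (- 1) ^ (card W * (b T + card T)) * \<psi> (gmon 1 m T)"
    and hom: "\<And>m T. finite T \<Longrightarrow> Poly_Mapping.keys m \<subseteq> P \<Longrightarrow> T \<subseteq> V \<Longrightarrow>
      hcomp (b T) (\<psi> (gmon 1 m T)) = \<psi> (gmon 1 m T)"
  shows "contract_right P (W \<union> V) Q \<phi> = contract_right P V \<theta> \<psi>"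
proof -
  note add = additive_contract_right[of P "W \<union> V" \<phi>]
  have rest: "contract_right P (W \<union> V) w \<phi> = 0" if "w \<in> lacking W" for w
  proof (rule additive_eq_on_gspan[OF add _ that, where H = "\<lambda>_. 0"])
    fix r :: 'r and m S assume S: "finite (S :: gvar set)" "S \<in> {S. \<not> W \<subseteq> S}"
    have "\<phi> (gmon 1 (mon_restrict P m) (S \<inter> (W \<union> V))) = 0"
      by (rule vanish[OF _ keys_mon_restrict]) (use S in auto)
    then show "contract_right P (W \<union> V) (gmon r m S) \<phi> = 0"
      using S(1) by (simp add: contract_right_gmon[of S \<phi> 0, OF _ \<phi>] hcomp_0)
  qed (unfold_locales, simp)
  have "contract_right P (W \<union> V) (\<theta> * gbasis W) \<phi> = (- 1) ^ card W * contract_right P V \<theta> \<psi>"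
  proof (rule additive_eq_on_gspan[OF _ _ \<theta>])
    show "additive (\<lambda>\<theta>. contract_right P (W \<union> V) (\<theta> * gbasis W) \<phi>)"
      by (intro additive_compose[OF add additive_times_right])
    show "additive (\<lambda>\<theta>. (- 1) ^ card W * contract_right P V \<theta> \<psi>)"
      by (intro additive_compose[OF additive_times_left additive_contract_right])
    fix r :: 'r and m T assume T: "finite (T :: gvar set)" "T \<in> Pow (- W)"
    let ?T1 = "T - V" and ?T2 = "T \<inter> V" and ?k = "mon_restrict P m"
    let ?c = "card W" and ?a = "card (T \<inter> V)" and ?b = "b (T \<inter> V)"
    have prod: "gmon r m T * gbasis W = gmon (shuffle_sign T W * r) m (T \<union> W)"
      unfolding gbasis_eq_gmon using T W by (subst gmon_mult) auto
    have sets: "(T \<union> W) \<inter> (W \<union> V) = W \<union> ?T2" "(T \<union> W) - (W \<union> V) = ?T1" using T by auto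
    have card: "card (W \<union> ?T2) = ?c + ?a" using T W by (intro card_Un_disjoint) auto
    have \<phi>T: "\<phi> (gmon 1 ?k (W \<union> ?T2)) = (- 1) ^ (?c * (?b + ?a)) * \<psi> (gmon 1 ?k ?T2)"
      by (rule top[OF _ keys_mon_restrict]) (use T in auto)
    have \<psi>T: "hcomp ?b (\<psi> (gmon 1 ?k ?T2)) = \<psi> (gmon 1 ?k ?T2)"
      by (rule hom[OF _ keys_mon_restrict]) (use T in auto)
    then have \<phi>T': "hcomp ?b (\<phi> (gmon 1 ?k (W \<union> ?T2))) = \<phi> (gmon 1 ?k (W \<union> ?T2))"
      unfolding \<phi>T additive_sign[OF additive_hcomp] by simp
    have "shuffle_sign ?T1 (W \<union> ?T2) * (shuffle_sign T W * r) = (- 1) ^ (?a * ?c) * (shuffle_sign ?T1 ?T2 * r)"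
    proof -
      have "shuffle_sign ?T1 (W \<union> ?T2) = (shuffle_sign ?T1 W * shuffle_sign ?T1 ?T2 :: 'r)"
        using T W by (intro shuffle_sign_Un_right) auto
      moreover have "shuffle_sign (?T1 \<union> ?T2) W = (shuffle_sign ?T1 W * shuffle_sign ?T2 W :: 'r)"
        using T W by (intro shuffle_sign_Un_left) auto
      moreover have "?T1 \<union> ?T2 = T" by blast
      moreover have "shuffle_sign ?T2 W = (- 1) ^ (?a * ?c) * (shuffle_sign W ?T2 :: 'r)"
        using T W by (intro shuffle_sign_swap) auto
      moreover have "shuffle_sign W ?T2 = (1 :: 'r)" by (rule shuffle_sign_sorted) (use less in auto)
      ultimately show ?thesis by (simp add: ac_simps)
    qed
    then have "contract_right P (W \<union> V) (gmon r m T * gbasis W) \<phi> =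
        (- 1) ^ ((?b + (?c + ?a)) * (?c + ?a) + ?a * ?c + ?c * (?b + ?a)) *
          (gmon (shuffle_sign ?T1 ?T2 * r) (mon_restrict (- P) m) ?T1 * \<psi> (gmon 1 ?k ?T2))"
      unfolding prod using T W \<phi>T'
      by (subst contract_right_gmon[of _ \<phi> ?b])
        (simp_all only: \<phi> sets card finite_Un \<phi>T gmon_sign sign_times_sign, simp only: power_add mult.assoc)
    \<comment> \<open>the three exponents come from the contraction, from the reordering of \<open>T\<close> and \<open>W\<close>, and from \<open>top\<close>\<close>
    also have "(- 1) ^ ((?b + (?c + ?a)) * (?c + ?a) + ?a * ?c + ?c * (?b + ?a)) =
        ((- 1) ^ (?c + (?b + ?a) * ?a) :: 'r galg)"
      by (simp add: minus_one_power_iff) blast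
    finally show "contract_right P (W \<union> V) (gmon r m T * gbasis W) \<phi> =
        (- 1) ^ ?c * contract_right P V (gmon r m T) \<psi>"
      using T by (simp add: contract_right_gmon[of T \<psi> ?b, OF _ \<psi> \<psi>T] power_add mult.assoc)
  qed
  then show ?thesis
    using rest[OF lead, unfolded additive.diff[OF add] additive_sign[OF add]]
    by (simp add: sign_cancel)
qed

text \<open>
  The counterpart with the functional written first. As \<open>W\<close> comes after \<open>V\<close> in the order of the
  variables, \<open>gbasis (W \<union> T)\<close> is \<open>(-1)\<^bsup>card W * card T\<^esup>\<close> times \<open>gbasis W * gbasis T\<close>, which accounts for
  the sign in \<open>top\<close>.
\<close>

lemma contract_left_through_top:
  fixes \<phi> \<psi> :: "'r::comm_ring_1 galg \<Rightarrow> 'r galg"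
  assumes W: "finite W" and less: "\<And>a b. a \<in> V \<Longrightarrow> b \<in> W \<Longrightarrow> a < b"
    and \<phi>: "\<phi> 0 = 0" and \<psi>: "\<psi> 0 = 0"
    and lead: "Q - (- 1) ^ k * (gbasis W * \<theta>) \<in> lacking W" and \<theta>: "\<theta> \<in> gspan (Pow (- W))"
    and vanish: "\<And>m T. finite T \<Longrightarrow> Poly_Mapping.keys m \<subseteq> P \<Longrightarrow> T \<subseteq> W \<union> V \<Longrightarrow> \<not> W \<subseteq> T \<Longrightarrow>
      \<phi> (gmon 1 m T) = 0"
    and top: "\<And>m T. finite T \<Longrightarrow> Poly_Mapping.keys m \<subseteq> P \<Longrightarrow> T \<subseteq> V \<Longrightarrow>
      \<phi> (gmon 1 m (W \<union> T)) = (- 1) ^ (k + card W * card T) * \<psi> (gmon 1 m T)"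
  shows "contract_left P (W \<union> V) \<phi> Q = contract_left P V \<psi> \<theta>"
proof -
  note add = additive_contract_left[of P "W \<union> V" \<phi>]
  have rest: "contract_left P (W \<union> V) \<phi> w = 0" if "w \<in> lacking W" for w
  proof (rule additive_eq_on_gspan[OF add _ that, where H = "\<lambda>_. 0"])
    fix r :: 'r and m S assume S: "finite (S :: gvar set)" "S \<in> {S. \<not> W \<subseteq> S}"
    have "\<phi> (gmon 1 (mon_restrict P m) (S \<inter> (W \<union> V))) = 0"
      by (rule vanish[OF _ keys_mon_restrict]) (use S in auto)
    then show "contract_left P (W \<union> V) \<phi> (gmon r m S) = 0"
      using S(1) by (simp add: contract_left_gmon[of S \<phi>, OF _ \<phi>])
  qed (unfold_locales, simp)
  have "contract_left P (W \<union> V) \<phi> (gbasis W * \<theta>) = (- 1) ^ k * contract_left P V \<psi> \<theta>"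
  proof (rule additive_eq_on_gspan[OF _ _ \<theta>])
    show "additive (\<lambda>\<theta>. contract_left P (W \<union> V) \<phi> (gbasis W * \<theta>))"
      by (intro additive_compose[OF add additive_times_left])
    show "additive (\<lambda>\<theta>. (- 1) ^ k * contract_left P V \<psi> \<theta>)"
      by (intro additive_compose[OF additive_times_left additive_contract_left])
    fix r :: 'r and m T assume T: "finite (T :: gvar set)" "T \<in> Pow (- W)"
    let ?T1 = "T - V" and ?T2 = "T \<inter> V" and ?k = "mon_restrict P m"
    let ?c = "card W" and ?a = "card (T \<inter> V)"
    have prod: "gbasis W * gmon r m T = gmon (shuffle_sign W T * r) m (W \<union> T)"
      unfolding gbasis_eq_gmon using T W by (subst gmon_mult) auto
    have sets: "(W \<union> T) \<inter> (W \<union> V) = W \<union> ?T2" "(W \<union> T) - (W \<union> V) = ?T1" using T by auto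
    have \<phi>T: "\<phi> (gmon 1 ?k (W \<union> ?T2)) = (- 1) ^ (k + ?c * ?a) * \<psi> (gmon 1 ?k ?T2)"
      by (rule top[OF _ keys_mon_restrict]) (use T in auto)
    have "shuffle_sign (W \<union> ?T2) ?T1 * (shuffle_sign W T * r) = (- 1) ^ (?c * ?a) * (shuffle_sign ?T2 ?T1 * r)"
    proof -
      have 1: "shuffle_sign (W \<union> ?T2) ?T1 = (shuffle_sign W ?T1 * shuffle_sign ?T2 ?T1 :: 'r)"
        using T W by (intro shuffle_sign_Un_left) auto
      have "?T1 \<union> ?T2 = T" by blast
      moreover have "shuffle_sign W (?T1 \<union> ?T2) = (shuffle_sign W ?T1 * shuffle_sign W ?T2 :: 'r)"
        using T W by (intro shuffle_sign_Un_right) auto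
      ultimately have 2: "shuffle_sign W T = (shuffle_sign W ?T1 * shuffle_sign W ?T2 :: 'r)" by simp
      have "shuffle_sign W ?T2 = (- 1) ^ (?c * ?a) * (shuffle_sign ?T2 W :: 'r)"
        using T W by (intro shuffle_sign_swap) auto
      also have "shuffle_sign ?T2 W = (1 :: 'r)" by (rule shuffle_sign_sorted) (use less in auto)
      finally show ?thesis unfolding 1 2 by (simp add: ac_simps)
    qed
    then have "contract_left P (W \<union> V) \<phi> (gbasis W * gmon r m T) =
        (- 1) ^ (k + ?c * ?a + ?c * ?a) *
          (\<psi> (gmon 1 ?k ?T2) * gmon (shuffle_sign ?T2 ?T1 * r) (mon_restrict (- P) m) ?T1)"
      unfolding prod using T W
      by (subst contract_left_gmon[of _ \<phi>])
        (simp_all only: \<phi> sets finite_Un \<phi>T gmon_sign sign_times_sign)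
    also have "(- 1) ^ (k + ?c * ?a + ?c * ?a) = ((- 1) ^ k :: 'r galg)"
      using sign_cancel[of "?c * ?a" "1 :: 'r galg"] by (simp only: power_add mult.assoc mult_1_right)
    finally show "contract_left P (W \<union> V) \<phi> (gbasis W * gmon r m T) =
        (- 1) ^ k * contract_left P V \<psi> (gmon r m T)"
      using T by (simp add: contract_left_gmon[of T \<psi>, OF _ \<psi>])
  qed
  then show ?thesis
    using rest[OF lead, unfolded additive.diff[OF add] additive_sign[OF add]]
    by (simp add: sign_cancel)
qed

section \<open>Contracting substitutions and functionals\<close>

text \<open>
  Applied to a renaming of variables in \<open>V\<close>, contraction over \<open>V\<close> is the renaming itself, since a
  renaming is an even algebra homomorphism that fixes the parameters.
\<close>

lemma contract_left_gsubst:
  assumes \<sigma>: "strict_mono_on A \<sigma>" and fixed: "\<And>z. z \<in> A - V \<Longrightarrow> \<sigma> z = z"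
    and w: "w \<in> gspan (Pow A)"
  shows "contract_left {} V (gsubst \<sigma>) w = (gsubst \<sigma> w :: 'r::comm_ring_1 galg)"
proof (rule additive_eq_on_gspan[OF additive_contract_left additive_gsubst w])
  fix r :: 'r and m S assume S: "finite S" "S \<in> Pow A"
  let ?\<theta> = "gmon (shuffle_sign (S \<inter> V) (S - V) * r) m (S - V)"
  have "gmon 1 0 (S \<inter> V) * ?\<theta> = gmon r m ((S \<inter> V) \<union> (S - V))"
    using S by (subst gmon_mult) auto
  then have split: "gmon r m S = gmon 1 0 (S \<inter> V) * ?\<theta>" by (simp add: Int_Diff_Un)
  have "\<sigma> ` (S - V) = id ` (S - V)" by (rule image_cong) (use S fixed in auto)
  then have "gsubst \<sigma> ?\<theta> = ?\<theta>"
    using S monotone_on_subset[OF \<sigma>, of "S - V"] by (subst gsubst_gmon) auto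
  moreover have "gsubst \<sigma> (gmon r m S) = gsubst \<sigma> (gmon 1 0 (S \<inter> V)) * gsubst \<sigma> ?\<theta>"
    unfolding split by (rule gsubst_times[OF \<sigma>]) (use S in \<open>auto intro!: gmon_in_gspan\<close>)
  ultimately show "contract_left {} V (gsubst \<sigma>) (gmon r m S) = gsubst \<sigma> (gmon r m S)"
    using S(1) by (simp add: contract_left_gmon additive.zero[OF additive_gsubst] mon_restrict_empty mon_restrict_UNIV)
qed

lemma hcomp_gsubst_gmon:
  assumes "finite S" "strict_mono_on S \<sigma>"
  shows "hcomp (card S) (gsubst \<sigma> (gmon r m S)) = gsubst \<sigma> (gmon r m S)"
  using assms card_image[OF strict_mono_on_imp_inj_on[OF assms(2)]] by (simp add: gsubst_gmon hcomp_gmon)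

lemma contract_right_gsubst:
  assumes \<sigma>: "strict_mono_on A \<sigma>" and fixed: "\<And>z. z \<in> A - V \<Longrightarrow> \<sigma> z = z"
    and w: "w \<in> gspan (Pow A)"
  shows "contract_right {} V w (gsubst \<sigma>) = (gsubst \<sigma> w :: 'r::comm_ring_1 galg)"
proof (rule additive_eq_on_gspan[OF additive_contract_right additive_gsubst w])
  fix r :: 'r and m S assume S: "finite S" "S \<in> Pow A"
  let ?\<theta> = "gmon (shuffle_sign (S - V) (S \<inter> V) * r) m (S - V)"
  have "?\<theta> * gmon 1 0 (S \<inter> V) = gmon r m ((S - V) \<union> (S \<inter> V))"
    using S by (subst gmon_mult) auto
  then have split: "gmon r m S = ?\<theta> * gmon 1 0 (S \<inter> V)" by (simp add: Un_Diff_Int)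
  have "\<sigma> ` (S - V) = id ` (S - V)" by (rule image_cong) (use S fixed in auto)
  then have "gsubst \<sigma> ?\<theta> = ?\<theta>"
    using S monotone_on_subset[OF \<sigma>, of "S - V"] by (subst gsubst_gmon) auto
  moreover have "gsubst \<sigma> (gmon r m S) = gsubst \<sigma> ?\<theta> * gsubst \<sigma> (gmon 1 0 (S \<inter> V))"
    unfolding split by (rule gsubst_times[OF \<sigma>]) (use S in \<open>auto intro!: gmon_in_gspan\<close>)
  moreover have "hcomp (card (S \<inter> V)) (gsubst \<sigma> (gmon 1 0 (S \<inter> V))) = (gsubst \<sigma> (gmon 1 0 (S \<inter> V)) :: 'r galg)"
    using S monotone_on_subset[OF \<sigma>, of "S \<inter> V"] by (intro hcomp_gsubst_gmon) auto
  ultimately show "contract_right {} V (gmon r m S) (gsubst \<sigma>) = gsubst \<sigma> (gmon r m S)"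
    using S(1) by (subst contract_right_gmon[where b = "card (S \<inter> V)"])
      (simp_all add: additive.zero[OF additive_gsubst] mon_restrict_empty mon_restrict_UNIV)
qed

lemma det_star_gsubst_gmon:
  assumes T: "finite T" and \<sigma>: "strict_mono_on T \<sigma>"
    and fixed: "\<And>z. z \<in> v ` {1..m} \<Longrightarrow> \<sigma> z = z" and avoid: "\<And>z. z \<in> T - v ` {1..m} \<Longrightarrow> \<sigma> z \<notin> v ` {1..m}"
  shows "det_star v m (gsubst \<sigma> (gmon r k T)) =
    (if v ` {1..m} \<subseteq> T
     then gmon (shuffle_sign (v ` {1..m}) (\<sigma> ` (T - v ` {1..m})) * r) k (\<sigma> ` (T - v ` {1..m})) else 0)"
proof -
  let ?V = "v ` {1..m}"
  have "?V \<subseteq> \<sigma> ` T \<longleftrightarrow> ?V \<subseteq> T"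
  proof
    assume *: "?V \<subseteq> \<sigma> ` T"
    show "?V \<subseteq> T"
    proof
      fix u assume u: "u \<in> ?V"
      with * obtain z where "z \<in> T" "u = \<sigma> z" by blast
      then show "u \<in> T" using u avoid fixed by (metis DiffI)
    qed
  next
    assume "?V \<subseteq> T"
    moreover have "\<sigma> ` ?V = id ` ?V" by (rule image_cong) (use fixed in simp_all)
    ultimately show "?V \<subseteq> \<sigma> ` T" using image_mono[of ?V T \<sigma>] by simp
  qed
  moreover have "\<sigma> ` T - ?V = \<sigma> ` (T - ?V)"
  proof (intro equalityI subsetI)
    fix x assume x: "x \<in> \<sigma> ` T - ?V"
    then obtain z where z: "z \<in> T" "x = \<sigma> z" by blast
    then have "z \<notin> ?V" using x fixed[of z] by auto
    then show "x \<in> \<sigma> ` (T - ?V)" using z by blast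
  next
    fix x assume "x \<in> \<sigma> ` (T - ?V)"
    then obtain z where "z \<in> T - ?V" "x = \<sigma> z" by blast
    then show "x \<in> \<sigma> ` T - ?V" using avoid[of z] by auto
  qed
  ultimately show ?thesis
    unfolding gsubst_gmon[OF T \<sigma>] using T by (simp only: det_star_gmon finite_imageI)
qed

lemma functional_eq_gmon: "functional c w = gmon (c w) 0 {}"
  by (simp add: functional_def gmon_def)

lemma hcomp_functional: "hcomp p (functional c w) = (if even p then functional c w else 0)"
  by (simp add: functional_eq_gmon hcomp_gmon even_iff_mod_2_eq_zero)

lemma parity_part_functional: "p \<in> {0, 1} \<Longrightarrow> parity_part p (functional c) w = functional c (hcomp p w)"
  by (auto simp: parity_part_def hcomp_functional)

lemma functional_0: "c \<in> dual P V \<Longrightarrow> functional c 0 = 0"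
proof -
  assume c: "c \<in> dual P V"
  have "(0 :: 'r::comm_ring_1 galg) \<in> Lam P V" by (simp add: Lam_def gsupp_def)
  with c have "c (scal (Poly_Mapping.single 0 0) * 0) = 0 * c 0" unfolding dual_def by blast
  then show ?thesis by (simp add: functional_def)
qed

lemma gmon_in_Lam:
  assumes "T \<subseteq> V" "Poly_Mapping.keys m \<subseteq> P"
  shows "gmon r m T \<in> Lam P V"
  using assms by (auto simp: Lam_def gsupp_def gmon_def gcoeff_gbasis polys_in_def split: if_splits)

lemma contract_right_functional_gmon:
  assumes "finite S" "functional c 0 = 0"
  shows "contract_right P V (gmon r m S) (functional c) =
    gmon ((- 1) ^ card (S \<inter> V) * (shuffle_sign (S - V) (S \<inter> V) * r * c (gmon 1 (mon_restrict P m) (S \<inter> V))))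
      (mon_restrict (- P) m) (S - V)"
proof -
  have "gmon a k T * functional c w = gmon (a * c w) k T" if "finite T" for a k T w
    using that by (simp add: functional_eq_gmon gmon_mult)
  moreover have "(- 1) ^ (card (S \<inter> V) * card (S \<inter> V)) = ((- 1) ^ card (S \<inter> V) :: 'a galg)"
    by (simp add: minus_one_power_iff)
  ultimately show ?thesis
    using assms(1) by (subst contract_right_gmon[of S "functional c" 0, OF assms])
      (simp_all add: hcomp_functional gmon_sign mult.assoc)
qed

lemma contract_right_functional_in_gspan:
  assumes "w \<in> gspan X" "functional c 0 = 0" "\<And>S. S \<in> X \<Longrightarrow> S - V \<in> Y"
  shows "contract_right P V w (functional c) \<in> gspan Y"
  using assms(1)
proof (induction rule: gspan_gmon_induct)
qed (simp_all add: additive.zero[OF additive_contract_right] additive.add[OF additive_contract_right]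
    gspan_0 gspan_add contract_right_functional_gmon assms gmon_in_gspan)

text \<open>
  With the function \<open>\<theta> w\<close> written first, a functional of parity \<open>p\<close> contributes
  \<open>(-1)\<^bsup>p(|\<theta>| + |w|)\<^esup>\<close> from the order of contraction and \<open>(-1)\<^bsup>p|\<theta>|\<^esup>\<close> from its extension to the
  parameter \<open>\<theta>\<close>, so \<open>\<theta>\<close> leaves the contraction without a sign.
\<close>

lemma contract_right_functional_parameter:
  fixes w :: "'r::comm_ring_1 galg"
  assumes W: "finite W" "W \<inter> V = {}" and w: "w \<in> gspan (Pow (- W))" and c: "functional c 0 = 0"
  shows "contract_right P V (gbasis W * w) (functional c) = gbasis W * contract_right P V w (functional c)"
proof (rule additive_eq_on_gspan[OF _ _ w])
  show "additive (\<lambda>w. contract_right P V (gbasis W * w) (functional c))"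
    by (intro additive_compose[OF additive_contract_right additive_times_left])
  show "additive (\<lambda>w. gbasis W * contract_right P V w (functional c))"
    by (intro additive_compose[OF additive_times_left additive_contract_right])
  fix r :: 'r and m S assume S: "finite (S :: gvar set)" "S \<in> Pow (- W)"
  have sets: "(W \<union> S) \<inter> V = S \<inter> V" "(W \<union> S) - V = W \<union> (S - V)" "S - V \<union> S \<inter> V = S"
    using W(2) by blast+
  have "shuffle_sign (W \<union> (S - V)) (S \<inter> V) = (shuffle_sign W (S \<inter> V) * shuffle_sign (S - V) (S \<inter> V) :: 'r)"
    using W S by (intro shuffle_sign_Un_left) auto
  moreover have "shuffle_sign W (S - V \<union> S \<inter> V) = (shuffle_sign W (S - V) * shuffle_sign W (S \<inter> V) :: 'r)"
    using W S by (intro shuffle_sign_Un_right) auto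
  ultimately have sign: "shuffle_sign (W \<union> (S - V)) (S \<inter> V) * shuffle_sign W S =
      (shuffle_sign W (S - V) * shuffle_sign (S - V) (S \<inter> V) :: 'r)"
    unfolding sets by (simp add: ac_simps)
  have "gbasis W * gmon r m S = gmon (shuffle_sign W S * r) m (W \<union> S)"
    unfolding gbasis_eq_gmon using W S by (subst gmon_mult) auto
  moreover have "W \<inter> (S - V) = {}" using S by auto
  ultimately show "contract_right P V (gbasis W * gmon r m S) (functional c) =
      gbasis W * contract_right P V (gmon r m S) (functional c)"
    using W S by (simp add: contract_right_functional_gmon c sets gbasis_eq_gmon gmon_mult
        mult.assoc[symmetric] sign) (simp add: ac_simps)
qed

lemma contract_right_functional_cong:
  fixes w :: "'r::comm_ring_1 galg"
  assumes "w \<in> gspan (Pow A)" "functional c 0 = 0" "functional c' 0 = 0" and V: "A \<inter> V' = A \<inter> V"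
    and eq: "\<And>m T. T \<subseteq> V \<Longrightarrow> Poly_Mapping.keys m \<subseteq> P \<Longrightarrow> c' (gmon 1 m T) = c (gmon 1 m T)"
  shows "contract_right P V' w (functional c') = contract_right P V w (functional c)"
proof (rule additive_eq_on_gspan[OF additive_contract_right additive_contract_right assms(1)])
  fix r :: 'r and m S assume S: "finite (S :: gvar set)" "S \<in> Pow A"
  have "S \<inter> V' = S \<inter> V" "S - V' = S - V" using S V by blast+
  then show "contract_right P V' (gmon r m S) (functional c') = contract_right P V (gmon r m S) (functional c)"
    using S by (simp add: contract_right_functional_gmon assms eq keys_mon_restrict)
qed

section \<open>The leading parts of the determinant with two block columns\<close>

definition renaming :: "(nat \<Rightarrow> gvar) \<Rightarrow> (nat \<Rightarrow> gvar) \<Rightarrow> nat \<Rightarrow> gvar \<Rightarrow> gvar" where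
  "renaming w v m z = (if z \<in> v ` {1..m} then w (inv_into {1..m} v z) else z)"

lemma collection_less [simp]:
  "VU i < VU j \<longleftrightarrow> i < j" "Vfx i < Vfx j \<longleftrightarrow> i < j" "Vfx' i < Vfx' j \<longleftrightarrow> i < j"
  "Vfy i < Vfy j \<longleftrightarrow> i < j" "Vfy' i < Vfy' j \<longleftrightarrow> i < j" "VFx i < VFx j \<longleftrightarrow> i < j"
  "VFx' i < VFx' j \<longleftrightarrow> i < j" "VFy i < VFy j \<longleftrightarrow> i < j" "VFy' i < VFy' j \<longleftrightarrow> i < j"
  by (auto simp: less_gvar_def less_eq_gvar_def)

lemma increasing_inj:
  fixes v :: "nat \<Rightarrow> gvar"
  assumes "\<And>i j. i < j \<Longrightarrow> v i < v j"
  shows "inj v"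
  by (rule strict_mono_imp_inj_on[of v UNIV]) (simp add: strict_mono_def assms)

lemma exp_star_eq_gsubst: "exp_star w v m = gsubst (renaming w v m)"
  unfolding exp_star_def renaming_def[abs_def] ..

lemma renaming_moved: "inj v \<Longrightarrow> j \<in> {1..m} \<Longrightarrow> renaming w v m (v j) = w j"
  by (simp add: renaming_def inj_on_subset inv_into_f_f[OF inj_on_subset])

lemma renaming_fixed: "z \<notin> v ` {1..m} \<Longrightarrow> renaming w v m z = z"
  by (simp add: renaming_def)

text \<open>
  It suffices that \<open>v i\<close> and \<open>w i\<close> compare in the same way with every fixed variable of \<open>A\<close>. For the
  collections at hand this depends only on the order of the collections.
\<close>

lemma strict_mono_on_renaming:
  assumes v: "\<And>i j. i < j \<Longrightarrow> v i < v j" and w: "\<And>i j. i < j \<Longrightarrow> w i < w j"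
    and between: "\<And>z i. z \<in> A - v ` {1..m} \<Longrightarrow> (z < v i \<longleftrightarrow> z < w i) \<and> (v i < z \<longleftrightarrow> w i < z)"
  shows "strict_mono_on A (renaming w v m)"
proof (rule strict_mono_onI)
  fix x y assume xy: "x \<in> A" "y \<in> A" "x < y"
  have inj: "inj v" by (rule increasing_inj[OF v])
  have less: "i < j" if "v i < v j" for i j using that v[of j i] by (cases i j rule: linorder_cases) auto
  consider i j where "i \<in> {1..m}" "j \<in> {1..m}" "x = v i" "y = v j"
    | i where "i \<in> {1..m}" "x = v i" "y \<notin> v ` {1..m}"
    | j where "x \<notin> v ` {1..m}" "j \<in> {1..m}" "y = v j"
    | "x \<notin> v ` {1..m}" "y \<notin> v ` {1..m}" by blast
  then show "renaming w v m x < renaming w v m y"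
    by cases (use xy between w less in \<open>simp_all add: renaming_moved[OF inj] renaming_fixed\<close>)
qed

lemma det_star_gsubst_lacking:
  assumes "finite T" "strict_mono_on T \<sigma>" "\<not> v ` {1..m} \<subseteq> T"
    and "\<And>z. z \<in> v ` {1..m} \<Longrightarrow> \<sigma> z = z" "\<And>z. z \<in> T - v ` {1..m} \<Longrightarrow> \<sigma> z \<notin> v ` {1..m}"
  shows "det_star v m (gsubst \<sigma> (gmon r k T)) = 0"
  using assms(3) by (simp only: det_star_gsubst_gmon[of T \<sigma> v m, OF assms(1,2,4,5)] if_False)

lemma det_star_gsubst_top:
  assumes T: "finite T" and \<sigma>: "strict_mono_on (v ` {1..m} \<union> T) \<sigma>"
    and "\<And>z. z \<in> v ` {1..m} \<Longrightarrow> \<sigma> z = z" "v ` {1..m} \<inter> T = {}" "v ` {1..m} \<inter> \<sigma> ` T = {}"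
  shows "det_star v m (gsubst \<sigma> (gmon 1 k (v ` {1..m} \<union> T))) =
    gmon (shuffle_sign (v ` {1..m}) (\<sigma> ` T)) k (\<sigma> ` T)"
proof -
  have d: "v ` {1..m} \<union> T - v ` {1..m} = T" using assms(4) by blast
  have "\<sigma> z \<notin> v ` {1..m}" if "z \<in> T" for z using that assms(5) by blast
  then show ?thesis
    using T by (subst det_star_gsubst_gmon[where v = v and m = m, OF _ \<sigma> assms(3)]) (auto simp only: d, simp_all)
qed

text \<open>
  The sign is \<open>(-1)\<^sup>s\<close> because the \<open>Vfy i\<close> enter the columns with coefficient \<open>-1\<close>. It is written
  with \<open>card (Vfy ` {1..s})\<close> to fit \<open>contract_right_through_top\<close>.
\<close>

lemma gdet_append_lower:
  "gdet n (columns nabla F VFx VFy t @ columns nabla f Vfx Vfy s)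
     - (- 1) ^ card (Vfy ` {1..s}) * (gdet n (columns nabla F VFx VFy t) * gbasis (Vfy ` {1..s})) \<in> lacking (Vfy ` {1..s})"
proof -
  have "card (Vfy ` {1..s}) = s" by (simp add: card_image inj_on_def)
  then show ?thesis
    by (simp only:) (rule gdet_append_right, blast,
      rule gspan_mono[OF column_product_columns_in_gspan], blast,
      rule column_product_columns_lower_leading, simp only: collection_less, blast)
qed

lemma gdet_append_upper:
  fixes Fx Fy fx fy :: "nat \<Rightarrow> gvar"
  assumes "\<And>i j. i < j \<Longrightarrow> Fx i < Fx j" "\<And>i. Fx i \<notin> range VU \<union> range Fy \<union> range fx \<union> range fy"
  shows "gdet n (columns nabla F Fx Fy t @ columns nabla f fx fy s)
     - (- 1) ^ (t * n) * (gbasis (Fx ` {1..t}) * gdet n (columns nabla f fx fy s)) \<in> lacking (Fx ` {1..t})"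
proof -
  have "inj Fx" by (rule increasing_inj[OF assms(1)])
  then have "card (Fx ` {1..t}) = t" by (simp add: card_image inj_on_subset)
  moreover have "gdet n (columns nabla F Fx Fy t @ columns nabla f fx fy s)
     - (- 1) ^ (n * card (Fx ` {1..t})) * (gbasis (Fx ` {1..t}) * gdet n (columns nabla f fx fy s)) \<in> lacking (Fx ` {1..t})"
  proof (rule gdet_append_left)
    show "Fx ` {1..t} \<inter> VU ` {1..n} = {}" using assms(2) by fastforce
    show "column_product n (columns nabla F Fx Fy t) - gbasis (Fx ` {1..t}) \<in> lacking (Fx ` {1..t})"
      by (rule column_product_columns_upper_leading[OF assms(1)]) (use assms(2) in fastforce)+
    have "Pow (VU ` {1..n} \<union> fx ` {1..s} \<union> fy ` {1..s}) \<subseteq> Pow (- Fx ` {1..t})"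
      using assms(2) by (intro Pow_mono) fastforce
    then show "column_product n (columns nabla f fx fy s) \<in> gspan (Pow (- Fx ` {1..t}))"
      by (rule gspan_mono[OF column_product_columns_in_gspan])
  qed simp
  ultimately show ?thesis by (simp only: mult.commute[of n])
qed

section \<open>The four identities\<close>

text \<open>
  Both sides are the determinant over \<open>F\<close> in the variables \<open>VFx\<close> and \<open>VFy'\<close>: on the left \<open>VFy\<close> is
  renamed after the \<open>Vfy\<close> have been stripped, on the right \<open>VFx'\<close> is renamed.
\<close>

lemma substituted_det_F:
  fixes f F :: "nat \<Rightarrow> 'r::comm_ring_1 poly1"
  shows "contract_right {} (Vfy ` {1..s} \<union> VFy ` {1..t})
     (gdet n (columns nabla F VFx VFy t @ columns nabla f Vfx Vfy s))
     (det_star Vfy s \<circ> exp_star VFy' VFy t)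
   = contract_left {} (VFx' ` {1..t}) (exp_star VFx VFx' t) (gdet n (columns nabla F VFx' VFy' t))"
proof -
  let ?\<sigma> = "renaming VFy' VFy t" and ?\<tau> = "renaming VFx VFx' t"
  let ?W = "Vfy ` {1..s}" and ?V = "VFy ` {1..t}"
  let ?A = "VU ` {1..n} \<union> VFx ` {1..t} \<union> VFy ` {1..t}" and ?B = "VU ` {1..n} \<union> VFx' ` {1..t} \<union> VFy' ` {1..t}"
  have \<sigma>: "strict_mono_on (?A \<union> ?W) ?\<sigma>"
    by (rule strict_mono_on_renaming) (simp, simp, elim DiffE UnE imageE, simp_all add: less_gvar_def less_eq_gvar_def)
  have \<tau>: "strict_mono_on ?B ?\<tau>"
    by (rule strict_mono_on_renaming) (simp, simp, elim DiffE UnE imageE, simp_all add: less_gvar_def less_eq_gvar_def)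
  have \<sigma>v: "?\<sigma> (VFy j) = VFy' j" if "j \<in> {1..t}" for j using that by (intro renaming_moved) (simp_all add: inj_on_def)
  have \<tau>v: "?\<tau> (VFx' j) = VFx j" if "j \<in> {1..t}" for j using that by (intro renaming_moved) (simp_all add: inj_on_def)
  have QF: "gdet n (columns nabla F VFx VFy t) \<in> gspan (Pow (VFx ` {1..t} \<union> VFy ` {1..t}))"
    by (rule gdet_columns_in_gspan) auto
  have QF': "gdet n (columns nabla F VFx' VFy' t) \<in> gspan (Pow (VFx' ` {1..t} \<union> VFy' ` {1..t}))"
    by (rule gdet_columns_in_gspan) auto
  have avoid: "?\<sigma> z \<notin> ?W" if "z \<in> ?V" for z using that \<sigma>v by auto
  have mono: "strict_mono_on T ?\<sigma>" if "T \<subseteq> ?W \<union> ?V" for T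
    by (rule monotone_on_subset[OF \<sigma>]) (use that in blast)
  have "contract_right {} (?W \<union> ?V)
     (gdet n (columns nabla F VFx VFy t @ columns nabla f Vfx Vfy s)) (det_star Vfy s \<circ> exp_star VFy' VFy t)
     = contract_right {} ?V (gdet n (columns nabla F VFx VFy t)) (gsubst ?\<sigma>)"
  proof (rule contract_right_through_top[OF _ _ _ _ gdet_append_lower, where b = card])
    fix m :: "pvar \<Rightarrow>\<^sub>0 nat" and T assume T: "finite T" "T \<subseteq> ?V"
    have "det_star Vfy s (gsubst ?\<sigma> (gmon 1 m (?W \<union> T))) = (gsubst ?\<sigma> (gmon 1 m T) :: 'r galg)"
    proof -
      have "shuffle_sign ?W (?\<sigma> ` T) = (1 :: 'r)"
        by (rule shuffle_sign_sorted) (use T \<sigma>v in \<open>auto simp: less_gvar_def less_eq_gvar_def\<close>)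
      moreover have "gsubst ?\<sigma> (gmon 1 m T) = (gmon 1 m (?\<sigma> ` T) :: 'r galg)"
        using T by (intro gsubst_gmon mono) auto
      moreover have "det_star Vfy s (gsubst ?\<sigma> (gmon 1 m (?W \<union> T))) =
          (gmon (shuffle_sign ?W (?\<sigma> ` T)) m (?\<sigma> ` T) :: 'r galg)"
        by (rule det_star_gsubst_top[OF T(1) mono]) (use T \<sigma>v in \<open>auto intro!: renaming_fixed\<close>)
      ultimately show ?thesis by simp
    qed
    moreover have "(- 1) ^ (card ?W * (card T + card T)) = (1 :: 'r galg)" by (simp add: minus_one_power_iff)
    ultimately show "(det_star Vfy s \<circ> exp_star VFy' VFy t) (gmon 1 m (?W \<union> T)) =
        (- 1) ^ (card ?W * (card T + card T)) * (gsubst ?\<sigma> (gmon 1 m T) :: 'r galg)"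
      by (simp add: exp_star_eq_gsubst)
    show "hcomp (card T) (gsubst ?\<sigma> (gmon 1 m T)) = gsubst ?\<sigma> (gmon 1 m T)"
      using T by (intro hcomp_gsubst_gmon mono) auto
  next
    fix m :: "pvar \<Rightarrow>\<^sub>0 nat" and T assume "finite T" "T \<subseteq> ?W \<union> ?V" "\<not> ?W \<subseteq> T"
    then show "(det_star Vfy s \<circ> exp_star VFy' VFy t) (gmon 1 m T) = 0"
      unfolding comp_def exp_star_eq_gsubst
      by (intro det_star_gsubst_lacking mono) (blast, blast, blast, fastforce intro: renaming_fixed, use avoid in blast)
  next
    show "gdet n (columns nabla F VFx VFy t) \<in> gspan (Pow (- ?W))" by (rule gspan_mono[OF QF]) auto
  qed (auto simp: exp_star_eq_gsubst additive.zero[OF additive_gsubst] det_star_def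
      additive.zero[OF additive_contract_left] less_gvar_def less_eq_gvar_def)
  also have "\<dots> = gsubst ?\<sigma> (gdet n (columns nabla F VFx VFy t))"
    by (rule contract_right_gsubst[OF monotone_on_subset[OF \<sigma>] _ QF]) (auto intro!: renaming_fixed)
  also have "\<dots> = gdet n (columns nabla F VFx VFy' t)"
    by (rule gsubst_gdet_columns) (auto intro!: renaming_fixed \<sigma>v monotone_on_subset[OF \<sigma>])
  also have "\<dots> = gsubst ?\<tau> (gdet n (columns nabla F VFx' VFy' t))"
    by (rule gsubst_gdet_columns[OF \<tau>, symmetric]) (auto intro!: renaming_fixed \<tau>v)
  also have "\<dots> = contract_left {} (VFx' ` {1..t}) (exp_star VFx VFx' t) (gdet n (columns nabla F VFx' VFy' t))"
    unfolding exp_star_eq_gsubst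
    by (rule contract_left_gsubst[OF monotone_on_subset[OF \<tau>] _ QF', symmetric]) (auto intro!: renaming_fixed)
  finally show ?thesis .
qed

text \<open>
  Both sides are the determinant over \<open>f\<close> in the variables \<open>Vfx\<close> and \<open>Vfy'\<close>. The factor
  \<open>(-1)\<^bsup>tn\<^esup>\<close> of the functional cancels the sign of the leading part.
\<close>

lemma substituted_det_f:
  fixes f F :: "nat \<Rightarrow> 'r::comm_ring_1 poly1"
  shows "contract_right {} (Vfy ` {1..s}) (gdet n (columns nabla f Vfx Vfy s)) (exp_star Vfy' Vfy s)
    = contract_left {} (Vfx' ` {1..s} \<union> VFx' ` {1..t})
        (\<lambda>w. (- 1) ^ (t * n) * (det_star VFx' t \<circ> exp_star Vfx Vfx' s) w)
        (gdet n (columns nabla F VFx' VFy' t @ columns nabla f Vfx' Vfy' s))"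
proof -
  let ?\<sigma> = "renaming Vfy' Vfy s" and ?\<tau> = "renaming Vfx Vfx' s"
  let ?W = "VFx' ` {1..t}" and ?V = "Vfx' ` {1..s}"
  let ?A = "VU ` {1..n} \<union> Vfx ` {1..s} \<union> Vfy ` {1..s}" and ?B = "VU ` {1..n} \<union> Vfx' ` {1..s} \<union> Vfy' ` {1..s}"
  let ?\<phi> = "\<lambda>w. (- 1) ^ (t * n) * (det_star VFx' t \<circ> exp_star Vfx Vfx' s) w"
  have \<sigma>: "strict_mono_on ?A ?\<sigma>"
    by (rule strict_mono_on_renaming) (simp, simp, elim DiffE UnE imageE, simp_all add: less_gvar_def less_eq_gvar_def)
  have \<tau>: "strict_mono_on (?B \<union> ?W) ?\<tau>"
    by (rule strict_mono_on_renaming) (simp, simp, elim DiffE UnE imageE, simp_all add: less_gvar_def less_eq_gvar_def)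
  have \<sigma>v: "?\<sigma> (Vfy j) = Vfy' j" if "j \<in> {1..s}" for j using that by (intro renaming_moved) (simp_all add: inj_on_def)
  have \<tau>v: "?\<tau> (Vfx' j) = Vfx j" if "j \<in> {1..s}" for j using that by (intro renaming_moved) (simp_all add: inj_on_def)
  have Qf: "gdet n (columns nabla f Vfx Vfy s) \<in> gspan (Pow (Vfx ` {1..s} \<union> Vfy ` {1..s}))"
    by (rule gdet_columns_in_gspan) auto
  have Qf': "gdet n (columns nabla f Vfx' Vfy' s) \<in> gspan (Pow (Vfx' ` {1..s} \<union> Vfy' ` {1..s}))"
    by (rule gdet_columns_in_gspan) auto
  have avoid: "?\<tau> z \<notin> ?W" if "z \<in> ?V" for z using that \<tau>v by auto
  have mono: "strict_mono_on T ?\<tau>" if "T \<subseteq> ?W \<union> ?V" for T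
    by (rule monotone_on_subset[OF \<tau>]) (use that in blast)
  have cW: "card ?W = t" by (simp add: card_image inj_on_def)
  have "contract_left {} (?W \<union> ?V) ?\<phi> (gdet n (columns nabla F VFx' VFy' t @ columns nabla f Vfx' Vfy' s))
     = contract_left {} ?V (gsubst ?\<tau>) (gdet n (columns nabla f Vfx' Vfy' s))"
  proof (rule contract_left_through_top[OF _ _ _ _ gdet_append_upper])
    fix m :: "pvar \<Rightarrow>\<^sub>0 nat" and T assume T: "finite T" "T \<subseteq> ?V"
    have "inj_on ?\<tau> T" by (rule strict_mono_on_imp_inj_on[OF mono]) (use T in blast)
    then have cT: "card (?\<tau> ` T) = card T" by (rule card_image)
    have "shuffle_sign (?\<tau> ` T) ?W = (1 :: 'r)"
      by (rule shuffle_sign_sorted) (use T \<tau>v in \<open>auto simp: less_gvar_def less_eq_gvar_def\<close>)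
    moreover have "shuffle_sign ?W (?\<tau> ` T) = (- 1) ^ (t * card T) * (shuffle_sign (?\<tau> ` T) ?W :: 'r)"
    proof -
      have "?W \<inter> ?\<tau> ` T = {}"
      proof (rule equals0I)
        fix x assume "x \<in> ?W \<inter> ?\<tau> ` T"
        then obtain z where "z \<in> T" "?\<tau> z \<in> ?W" by (elim IntE imageE) simp
        then show False using avoid[of z] T(2) by auto
      qed
      then show ?thesis
        using shuffle_sign_swap[of ?W "?\<tau> ` T", where 'a = 'r, unfolded cT cW] T(1) by simp
    qed
    moreover have "gsubst ?\<tau> (gmon 1 m T) = (gmon 1 m (?\<tau> ` T) :: 'r galg)"
      using T by (intro gsubst_gmon mono) auto
    moreover have "det_star VFx' t (gsubst ?\<tau> (gmon 1 m (?W \<union> T))) =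
        (gmon (shuffle_sign ?W (?\<tau> ` T)) m (?\<tau> ` T) :: 'r galg)"
      by (rule det_star_gsubst_top[OF T(1) mono]) (use T \<tau>v in \<open>auto intro!: renaming_fixed\<close>)
    ultimately have "det_star VFx' t (gsubst ?\<tau> (gmon 1 m (?W \<union> T))) =
        (- 1) ^ (t * card T) * (gsubst ?\<tau> (gmon 1 m T) :: 'r galg)"
      by (simp only: gmon_sign)
    then show "?\<phi> (gmon 1 m (?W \<union> T)) = (- 1) ^ (t * n + card ?W * card T) * (gsubst ?\<tau> (gmon 1 m T) :: 'r galg)"
      unfolding comp_def exp_star_eq_gsubst cW by (simp only: power_add mult.assoc)
  next
    fix m :: "pvar \<Rightarrow>\<^sub>0 nat" and T assume "finite T" "T \<subseteq> ?W \<union> ?V" "\<not> ?W \<subseteq> T"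
    then have "det_star VFx' t (gsubst ?\<tau> (gmon 1 m T)) = (0 :: 'r galg)"
      by (intro det_star_gsubst_lacking mono) (blast, blast, blast, fastforce intro: renaming_fixed, use avoid in blast)
    then show "?\<phi> (gmon 1 m T) = (0 :: 'r galg)"
      unfolding comp_def exp_star_eq_gsubst by simp
  next
    show "gdet n (columns nabla f Vfx' Vfy' s) \<in> gspan (Pow (- ?W))" by (rule gspan_mono[OF Qf']) auto
  qed (auto simp: exp_star_eq_gsubst additive.zero[OF additive_gsubst] det_star_def
      additive.zero[OF additive_contract_left] less_gvar_def less_eq_gvar_def)
  also have "\<dots> = gsubst ?\<tau> (gdet n (columns nabla f Vfx' Vfy' s))"
    by (rule contract_left_gsubst[OF monotone_on_subset[OF \<tau>] _ Qf']) (auto intro!: renaming_fixed)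
  also have "\<dots> = gdet n (columns nabla f Vfx Vfy' s)"
    by (rule gsubst_gdet_columns) (auto intro!: renaming_fixed \<tau>v monotone_on_subset[OF \<tau>])
  also have "\<dots> = gsubst ?\<sigma> (gdet n (columns nabla f Vfx Vfy s))"
    by (rule gsubst_gdet_columns[OF \<sigma>, symmetric]) (auto intro!: renaming_fixed \<sigma>v)
  also have "\<dots> = contract_right {} (Vfy ` {1..s}) (gdet n (columns nabla f Vfx Vfy s)) (exp_star Vfy' Vfy s)"
    unfolding exp_star_eq_gsubst
    by (rule contract_right_gsubst[OF monotone_on_subset[OF \<sigma>] _ Qf, symmetric]) (auto intro!: renaming_fixed)
  finally show ?thesis by (simp only: Un_commute[of ?V])
qed

text \<open>
  The functional on the left is \<open>c\<close> after \<open>det \<parallel>Vfy\<^sub>*\<parallel>\<close>, with the sign \<open>(-1)\<^bsup>s|c|\<^esup>\<close> that the stripping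
  of \<open>s\<close> variables requires for a functional that acts with parity \<open>|c|\<close>.
\<close>

lemma functional_det_F:
  fixes f F :: "nat \<Rightarrow> 'r::comm_ring_1 poly1"
  assumes c: "c \<in> dual (yvars n) (VFy ` {1..t})"
  shows "contract_right (yvars n) (Vfy ` {1..s} \<union> VFy ` {1..t})
      (gdet n (columns nabla F VFx VFy t @ columns nabla f Vfx Vfy s))
      (restrict (\<lambda>w. \<Sum>p\<in>{0, 1}. (- 1) ^ (s * p) * parity_part p (functional c) (det_star Vfy s w))
        (Lam (yvars n) (Vfy ` {1..s} \<union> VFy ` {1..t})))
    = contract_right (yvars n) (VFy ` {1..t}) (gdet n (columns nabla F VFx VFy t)) (functional c)"
proof -
  let ?W = "Vfy ` {1..s}" and ?V = "VFy ` {1..t}"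
  let ?L = "Lam (yvars n) (?W \<union> ?V) :: 'r galg set"
  let ?\<chi> = "\<lambda>w. \<Sum>p\<in>{0, 1}. (- 1) ^ (s * p) * parity_part p (functional c) w"
  let ?\<phi> = "restrict (\<lambda>w. ?\<chi> (det_star Vfy s w)) ?L"
  note c0 = functional_0[OF c]
  have cW: "card ?W = s" by (simp add: card_image inj_on_def)
  have \<chi>: "?\<chi> (gmon r m T) = (- 1) ^ (s * card T) * functional c (gmon r m T)" for r m T
    by (cases "even (card T)")
      (simp_all add: parity_part_functional hcomp_gmon c0 minus_one_power_iff flip: even_iff_mod_2_eq_zero odd_iff_mod_2_eq_one)
  have \<chi>0: "?\<chi> 0 = 0" by (simp add: parity_part_functional hcomp_0 c0)
  have QF: "gdet n (columns nabla F VFx VFy t) \<in> gspan (Pow (VFx ` {1..t} \<union> VFy ` {1..t}))"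
    by (rule gdet_columns_in_gspan) auto
  show ?thesis
  proof (rule contract_right_through_top[where \<psi> = "functional c" and \<phi> = ?\<phi> and b = "\<lambda>_. 0",
      OF _ _ _ c0 gdet_append_lower])
    fix m :: "pvar \<Rightarrow>\<^sub>0 nat" and T
    assume T: "finite T" "Poly_Mapping.keys m \<subseteq> yvars n" "T \<subseteq> ?V"
    have "gmon 1 m (?W \<union> T) \<in> ?L" by (rule gmon_in_Lam) (use T in blast)+
    moreover have "det_star Vfy s (gmon 1 m (?W \<union> T)) = (gmon 1 m T :: 'r galg)"
    proof -
      have "?W \<union> T - ?W = T" using T by blast
      moreover have "shuffle_sign ?W T = (1 :: 'r)"
        by (rule shuffle_sign_sorted) (use T in \<open>auto simp: less_gvar_def less_eq_gvar_def\<close>)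
      ultimately show ?thesis using T(1) by (subst det_star_gmon) simp_all
    qed
    ultimately show "?\<phi> (gmon 1 m (?W \<union> T)) = (- 1) ^ (card ?W * (0 + card T)) * functional c (gmon 1 m T)"
      by (simp only: restrict_apply' \<chi> cW add_0)
  next
    fix m :: "pvar \<Rightarrow>\<^sub>0 nat" and T
    assume T: "finite T" "Poly_Mapping.keys m \<subseteq> yvars n" "T \<subseteq> ?W \<union> ?V" "\<not> ?W \<subseteq> T"
    have "gmon 1 m T \<in> ?L" by (rule gmon_in_Lam) (use T in blast)+
    moreover have "det_star Vfy s (gmon 1 m T) = (0 :: 'r galg)"
      using T by (subst det_star_gmon) simp_all
    ultimately show "?\<phi> (gmon 1 m T) = 0" by (simp only: restrict_apply' \<chi>0)
  next
    have "0 \<in> ?L" by (simp add: Lam_def gsupp_def)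
    moreover have "det_star Vfy s 0 = (0 :: 'r galg)"
      unfolding det_star_def by (rule additive.zero[OF additive_contract_left])
    ultimately show "?\<phi> 0 = 0" by (simp only: restrict_apply' \<chi>0)
  next
    show "gdet n (columns nabla F VFx VFy t) \<in> gspan (Pow (- ?W))" by (rule gspan_mono[OF QF]) auto
  qed (auto simp: hcomp_functional less_gvar_def less_eq_gvar_def)
qed

text \<open>
  Contraction with \<open>c\<close> preserves the decomposition of \<open>Q\<close> with respect to the \<open>VFx\<close>, since these are
  parameters for it. The contraction with \<open>det \<parallel>VFx\<^sub>*\<parallel>\<close> then leaves the contraction of \<open>Q\<^sub>f\<close> with
  \<open>c\<close>, and as \<open>Q\<^sub>f\<close> does not involve the \<open>VFy\<close>, only the restriction of \<open>c\<close> matters.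
\<close>

lemma functional_det_f:
  fixes f F :: "nat \<Rightarrow> 'r::comm_ring_1 poly1"
  assumes c: "c \<in> dual (yvars n) (Vfy ` {1..s} \<union> VFy ` {1..t})"
  shows "contract_right (yvars n) (Vfy ` {1..s}) (gdet n (columns nabla f Vfx Vfy s))
      (functional (restrict c (Lam (yvars n) (Vfy ` {1..s}))))
    = contract_left {} (VFx ` {1..t}) (\<lambda>w. (- 1) ^ (t * n) * det_star VFx t w)
        (contract_right (yvars n) (Vfy ` {1..s} \<union> VFy ` {1..t})
          (gdet n (columns nabla F VFx VFy t @ columns nabla f Vfx Vfy s)) (functional c))"
proof -
  let ?W = "VFx ` {1..t}" and ?V = "Vfy ` {1..s} \<union> VFy ` {1..t}" and ?Y = "yvars n"
  let ?Q = "gdet n (columns nabla F VFx VFy t @ columns nabla f Vfx Vfy s)"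
  let ?Qf = "gdet n (columns nabla f Vfx Vfy s)"
  let ?c = "restrict c (Lam ?Y (Vfy ` {1..s}))"
  let ?\<phi> = "\<lambda>w. (- 1) ^ (t * n) * det_star VFx t w :: 'r galg"
  note c0 = functional_0[OF c]
  have Qf: "?Qf \<in> gspan (Pow (Vfx ` {1..s} \<union> Vfy ` {1..s}))"
    by (rule gdet_columns_in_gspan) auto
  have "0 \<in> Lam ?Y (Vfy ` {1..s})" by (simp add: Lam_def gsupp_def)
  then have restrict: "contract_right ?Y ?V ?Qf (functional c) = contract_right ?Y (Vfy ` {1..s}) ?Qf (functional ?c)"
    using c0 by (intro contract_right_functional_cong[OF Qf])
      (auto simp: functional_def gmon_in_Lam)
  let ?C = "\<lambda>w. contract_right ?Y ?V w (functional c)"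
  have "?C (?Q - (- 1) ^ (t * n) * (gbasis ?W * ?Qf)) \<in> lacking ?W"
    by (rule contract_right_functional_in_gspan[OF gdet_append_upper c0])
      (auto simp: less_gvar_def less_eq_gvar_def)
  moreover have "?C (gbasis ?W * ?Qf) = gbasis ?W * ?C ?Qf"
    by (rule contract_right_functional_parameter[OF _ _ gspan_mono[OF Qf] c0]) auto
  ultimately have lead: "?C ?Q - (- 1) ^ (t * n) * (gbasis ?W * ?C ?Qf) \<in> lacking ?W"
    by (simp only: additive.diff[OF additive_contract_right] additive_sign[OF additive_contract_right])
  \<comment> \<open>the functional acts on the \<open>VFx\<close> alone, so nothing but the identity is left of it\<close>
  have "contract_left {} (?W \<union> {}) ?\<phi> (?C ?Q) = contract_left {} {} (\<lambda>w. w) (?C ?Qf)"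
  proof (rule contract_left_through_top[OF _ _ _ _ lead])
    show "?C ?Qf \<in> gspan (Pow (- ?W))"
      by (rule contract_right_functional_in_gspan[OF Qf c0]) auto
    fix m :: "pvar \<Rightarrow>\<^sub>0 nat" and T :: "gvar set"
    show "?\<phi> (gmon 1 m (?W \<union> T)) = (- 1) ^ (t * n + card ?W * card T) * gmon 1 m T" if "T \<subseteq> {}"
      using that by (subst det_star_gmon) simp_all
    show "?\<phi> (gmon 1 m T) = 0" if "finite T" "\<not> ?W \<subseteq> T"
      using that by (subst det_star_gmon) simp_all
  qed (auto simp: det_star_def additive.zero[OF additive_contract_left])
  also have "\<dots> = ?C ?Qf"
    by (rule additive_eq_on_gspan[OF additive_contract_left _ contract_right_functional_in_gspan[OF Qf c0, of _ UNIV]])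
      (auto intro: additive.intro simp: contract_left_gmon mon_restrict_empty mon_restrict_UNIV gbasis_eq_gmon[symmetric])
  finally show ?thesis unfolding restrict by simp
qed

theorem theorem2:
  fixes n s t :: nat
    and f F :: "nat \<Rightarrow> 'r::comm_ring_1 poly1"
    and nabla :: "'r poly1 \<Rightarrow> nat \<Rightarrow> 'r poly2"
    and D :: "'r galg \<Rightarrow> 'r galg"
  assumes f: "\<And>i. i \<in> {1..s} \<Longrightarrow> f i \<in> polys_in {1..n}"
    and F: "\<And>j. j \<in> {1..t} \<Longrightarrow> F j \<in> polys_in {1..n}"
    and D: "koszul_differential n s t f F D"
    and nabla: "difference_quotients n nabla"
  shows
    "contract_right {} (Vfy ` {1..s} \<union> VFy ` {1..t})
       (gdet n (columns nabla F VFx VFy t @ columns nabla f Vfx Vfy s))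
       (det_star Vfy s \<circ> exp_star VFy' VFy t)
     = contract_left {} (VFx' ` {1..t})
         (exp_star VFx VFx' t)
         (gdet n (columns nabla F VFx' VFy' t))
     \<and>
     contract_right {} (Vfy ` {1..s})
       (gdet n (columns nabla f Vfx Vfy s))
       (exp_star Vfy' Vfy s)
     = contract_left {} (Vfx' ` {1..s} \<union> VFx' ` {1..t})
         (\<lambda>w. (- 1) ^ (t * n) * (det_star VFx' t \<circ> exp_star Vfx Vfx' s) w)
         (gdet n (columns nabla F VFx' VFy' t @ columns nabla f Vfx' Vfy' s))
     \<and>
     (\<forall>c \<in> dual (yvars n) (VFy ` {1..t}).
       contract_right (yvars n) (Vfy ` {1..s} \<union> VFy ` {1..t})
         (gdet n (columns nabla F VFx VFy t @ columns nabla f Vfx Vfy s))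
         (restrict
           (\<lambda>w. \<Sum>p\<in>{0, 1}. (- 1) ^ (s * p) * parity_part p (functional c) (det_star Vfy s w))
           (Lam (yvars n) (Vfy ` {1..s} \<union> VFy ` {1..t})))
       = contract_right (yvars n) (VFy ` {1..t})
           (gdet n (columns nabla F VFx VFy t))
           (functional c))
     \<and>
     (\<forall>c \<in> dual (yvars n) (Vfy ` {1..s} \<union> VFy ` {1..t}).
       contract_right (yvars n) (Vfy ` {1..s})
         (gdet n (columns nabla f Vfx Vfy s))
         (functional (restrict c (Lam (yvars n) (Vfy ` {1..s}))))
       = contract_left {} (VFx ` {1..t})
           (\<lambda>w. (- 1) ^ (t * n) * det_star VFx t w)
           (contract_right (yvars n) (Vfy ` {1..s} \<union> VFy ` {1..t})
             (gdet n (columns nabla F VFx VFy t @ columns nabla f Vfx Vfy s))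
             (functional c)))"
  by (intro conjI ballI substituted_det_F substituted_det_f functional_det_F functional_det_f)

end
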